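(* Let $0<\alpha,\beta<\infty$, let $u,v\in H(\mathbb{B})$, and let $\varphi,\psi:\mathbb{B}\to\mathbb{B}$ be holomorphic. Assume that there is a constant $C>0$ such that both $$\inf_{a}\ \frac{1-|\varphi(a)|^2}{|1-\langle \varphi(a),\xi_a\rangle|}>C\qquad\text{and}\qquad \inf_{a}\ \frac{1-|\psi(a)|^2}{|1-\langle \psi(a),\zeta_a\rangle|}>C,$$ where $$\xi_a=\frac{\Phi_{\varphi(a)}(\psi(a))}{|\Phi_{\varphi(a)}(\psi(a))|},\qquad \zeta_a=\frac{\Phi_{\psi(a)}(\varphi(a))}{|\Phi_{\psi(a)}(\varphi(a))|},$$ and the infima are over all $a\in\mathbb{B}$ with $\varphi(a)\ne\psi(a)$. Suppose that $uC_\varphi:H_\alpha^\infty\to H_\beta^\infty$ and $vC_\psi:H_\alpha^\infty\to H_\beta^\infty$ are bounded. Then $uC_\varphi-vC_\psi:H_\alpha^\infty\to H_\beta^\infty$ is compact if and only if $$\limsup_{j\to\infty}\sup_{\xi\in\partial\mathbb{B}}\frac{\|u\langle\varphi,\xi\rangle^j-v\langle\psi,\xi\rangle^j\|_\beta}{\|\langle z,\xi\rangle^j\|_\alpha}=0$$ and $$\limsup_{j\to\infty}\sup_{\xi,\xi'\in\partial\mathbb{B}}\frac{\|u\langle\varphi,\xi\rangle^j\langle\varphi,\xi'\rangle-v\langle\psi,\xi\rangle^j\langle\psi,\xi'\rangle\|_\beta}{\|\langle z,\xi\rangle^j\langle z,\xi'\rangle\|_\alpha}=0.$$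
   Context: $\mathbb{B}$ is the open unit ball of $\mathbb{C}^n$ ($n\ge 1$), $\partial\mathbb{B}$ its boundary, $\langle\cdot,\cdot\rangle$ the standard Hermitian inner product (linear in the first variable), $H(\mathbb{B})$ the space of holomorphic functions $\mathbb{B}\to\mathbb{C}$. For $a\in\mathbb{B}\setminus\{0\}$, $\Phi_a(z)=\dfrac{a-P_az-s_aQ_az}{1-\langle z,a\rangle}$, where $s_a=\sqrt{1-|a|^2}$, $P_az=\frac{\langle z,a\rangle}{\langle a,a\rangle}a$, $Q_az=z-P_az$; and $\Phi_0(z)=-z$. One has $\Phi_w(z)=0$ exactly when $z=w$. For $\gamma>0$ and $f\in H(\mathbb{B})$, $\|f\|_\gamma=\sup_{z\in\mathbb{B}}(1-|z|^2)^\gamma|f(z)|\in[0,\infty]$, and $H_\gamma^\infty=\{f\in H(\mathbb{B}):\|f\|_\gamma<\infty\}$, a Banach space under $\|\cdot\|_\gamma$. For $u\in H(\mathbb{B})$ and a holomorphic self-map $\varphi$ of $\mathbb{B}$, the weighted composition operator is $uC_\varphi f(z)=u(z)f(\varphi(z))$. $\langle\varphi,\xi\rangle$ denotes the function $z\mapsto\langle\varphi(z),\xi\rangle$; in denominators $\langle z,\xi\rangle$ denotes the function $z\mapsto\langle z,\xi\rangle$. *)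

theory Defs
  imports "HOL-Analysis.Analysis"
begin

text \<open>The Hermitian inner product, linear in the first argument. The norm of
  \<open>complex ^ 'n\<close> is the induced one, see \<open>hinner_self\<close>.\<close>

definition hinner :: "complex ^ 'n \<Rightarrow> complex ^ 'n \<Rightarrow> complex"
  where "hinner z w = (\<Sum>i\<in>UNIV. z $ i * cnj (w $ i))"

lemma hinner_self: "hinner z z = of_real ((norm z)\<^sup>2)"
  by (simp add: hinner_def norm_vec_def L2_set_def sum_nonneg complex_norm_square[symmetric] of_real_sum[symmetric])

text \<open>Holomorphy in several variables: at every point the real Frechet derivative exists and
  is complex linear. On sets that are not open this would be complex differentiability in a
  full neighbourhood; it is only used on the open unit ball.\<close>

definition holomorphic_sv :: "(complex ^ 'n \<Rightarrow> complex) \<Rightarrow> (complex ^ 'n) set \<Rightarrow> bool"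
  where "holomorphic_sv f S \<longleftrightarrow>
    (\<forall>z\<in>S. \<exists>D. (f has_derivative D) (at z) \<and> (\<forall>c v. D (c *s v) = c * D v))"

definition holomorphic_self_map :: "(complex ^ 'n \<Rightarrow> complex ^ 'n) \<Rightarrow> bool"
  where "holomorphic_self_map \<phi> \<longleftrightarrow>
    \<phi> ` ball 0 1 \<subseteq> ball 0 1 \<and> (\<forall>i. holomorphic_sv (\<lambda>z. \<phi> z $ i) (ball 0 1))"

definition proj_line :: "complex ^ 'n \<Rightarrow> complex ^ 'n \<Rightarrow> complex ^ 'n"
  where "proj_line a z = (hinner z a / hinner a a) *s a"

definition ball_aut :: "complex ^ 'n \<Rightarrow> complex ^ 'n \<Rightarrow> complex ^ 'n"
  where "ball_aut a z =
    (if a = 0 then - z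
     else (1 / (1 - hinner z a)) *s
       (a - proj_line a z - sqrt (1 - (norm a)\<^sup>2) *\<^sub>R (z - proj_line a z)))"

definition wnorm :: "real \<Rightarrow> (complex ^ 'n \<Rightarrow> complex) \<Rightarrow> ennreal"
  where "wnorm \<gamma> f = (SUP z\<in>ball 0 1. ennreal ((1 - (norm z)\<^sup>2) powr \<gamma> * norm (f z)))"

text \<open>Functions on the unit ball are represented by total functions that vanish outside of it,
  so that distinct elements of the space differ on the ball and \<open>wnorm \<gamma>\<close> separates points.\<close>

definition Hinf :: "real \<Rightarrow> (complex ^ 'n \<Rightarrow> complex) set"
  where "Hinf \<gamma> =
    {f. holomorphic_sv f (ball 0 1) \<and> wnorm \<gamma> f < \<infinity> \<and> (\<forall>z. z \<notin> ball 0 1 \<longrightarrow> f z = 0)}"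

definition wdist :: "real \<Rightarrow> (complex ^ 'n \<Rightarrow> complex) \<Rightarrow> (complex ^ 'n \<Rightarrow> complex) \<Rightarrow> real"
  where "wdist \<gamma> f g = enn2real (wnorm \<gamma> (\<lambda>z. f z - g z))"

definition wcomp :: "(complex ^ 'n \<Rightarrow> complex) \<Rightarrow> (complex ^ 'n \<Rightarrow> complex ^ 'n) \<Rightarrow>
    (complex ^ 'n \<Rightarrow> complex) \<Rightarrow> (complex ^ 'n \<Rightarrow> complex)"
  where "wcomp u \<phi> f = (\<lambda>z. if z \<in> ball 0 1 then u z * f (\<phi> z) else 0)"

text \<open>The next two notions are meant for linear operators. A bounded set is one that is bounded
  in the norm, and an operator is compact if it maps bounded sets to relatively compact ones.\<close>

definition bounded_op ::
    "real \<Rightarrow> real \<Rightarrow> ((complex ^ 'n \<Rightarrow> complex) \<Rightarrow> (complex ^ 'n \<Rightarrow> complex)) \<Rightarrow> bool"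
  where "bounded_op \<alpha> \<beta> T \<longleftrightarrow>
    T ` Hinf \<alpha> \<subseteq> Hinf \<beta> \<and> (\<exists>K\<ge>0. \<forall>f\<in>Hinf \<alpha>. wnorm \<beta> (T f) \<le> ennreal K * wnorm \<alpha> f)"

definition compact_op ::
    "real \<Rightarrow> real \<Rightarrow> ((complex ^ 'n \<Rightarrow> complex) \<Rightarrow> (complex ^ 'n \<Rightarrow> complex)) \<Rightarrow> bool"
  where "compact_op \<alpha> \<beta> T \<longleftrightarrow>
    T ` Hinf \<alpha> \<subseteq> Hinf \<beta> \<and>
    (\<forall>B. Metric_space.mbounded (Hinf \<alpha>) (wdist \<alpha>) B \<longrightarrow>
      compactin (Metric_space.mtopology (Hinf \<beta>) (wdist \<beta>))
        (Metric_space.mtopology (Hinf \<beta>) (wdist \<beta>) closure_of (T ` B)))"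

lemma wnorm_triangle: "wnorm \<gamma> (\<lambda>z. f z + g z) \<le> wnorm \<gamma> f + wnorm \<gamma> g"
  for f g :: "complex ^ 'n \<Rightarrow> complex"
  unfolding wnorm_def
proof (rule SUP_least)
  fix z :: "complex ^ 'n" assume z: "z \<in> ball 0 1"
  let ?c = "(1 - (norm z)\<^sup>2) powr \<gamma>"
  have "?c * norm (f z + g z) \<le> ?c * norm (f z) + ?c * norm (g z)"
    by (metis distrib_left mult_left_mono norm_triangle_ineq powr_ge_zero)
  then have "ennreal (?c * norm (f z + g z)) \<le> ennreal (?c * norm (f z)) + ennreal (?c * norm (g z))"
    by (simp flip: ennreal_plus add: ennreal_leI)
  also have "\<dots> \<le> (SUP z\<in>ball 0 1. ennreal ((1 - (norm z)\<^sup>2) powr \<gamma> * norm (f z)))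
      + (SUP z\<in>ball 0 1. ennreal ((1 - (norm z)\<^sup>2) powr \<gamma> * norm (g z)))"
    using z by (intro add_mono SUP_upper)
  finally show "ennreal (?c * norm (f z + g z)) \<le> \<dots>" .
qed

lemma wnorm_minus_commute: "wnorm \<gamma> (\<lambda>z. f z - g z) = wnorm \<gamma> (\<lambda>z. g z - f z)"
  by (simp add: wnorm_def norm_minus_commute)

lemma wnorm_diff_triangle:
  "wnorm \<gamma> (\<lambda>z. f z - h z) \<le> wnorm \<gamma> (\<lambda>z. f z - g z) + wnorm \<gamma> (\<lambda>z. g z - h z)"
  using wnorm_triangle[of \<gamma> "\<lambda>z. f z - g z" "\<lambda>z. g z - h z"] by simp

lemma wnorm_diff_finite:
  assumes "f \<in> Hinf \<gamma>" "g \<in> Hinf \<gamma>"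
  shows "wnorm \<gamma> (\<lambda>z. f z - g z) < \<infinity>"
proof -
  have "wnorm \<gamma> (\<lambda>z. f z - g z) \<le> wnorm \<gamma> f + wnorm \<gamma> g"
    using wnorm_diff_triangle[of \<gamma> f g "\<lambda>_. 0"] wnorm_triangle[of \<gamma> f "\<lambda>z. - g z"]
    by (simp add: wnorm_def)
  then show ?thesis
    using assms by (auto simp: Hinf_def intro: le_less_trans)
qed

lemma Metric_space_Hinf: "Metric_space (Hinf \<gamma>) (wdist \<gamma>)"
proof
  fix f g h :: "complex ^ 'n \<Rightarrow> complex"
  show "0 \<le> wdist \<gamma> f g" by (simp add: wdist_def)
  show "wdist \<gamma> f g = wdist \<gamma> g f" by (simp add: wdist_def wnorm_minus_commute[of \<gamma> f g])
  assume f: "f \<in> Hinf \<gamma>" and g: "g \<in> Hinf \<gamma>"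
  show "wdist \<gamma> f g = 0 \<longleftrightarrow> f = g"
  proof
    assume "wdist \<gamma> f g = 0"
    then have 0: "wnorm \<gamma> (\<lambda>z. f z - g z) = 0"
      using wnorm_diff_finite[OF f g] by (auto simp: wdist_def enn2real_eq_0_iff)
    show "f = g"
    proof
      fix z
      show "f z = g z"
      proof (cases "z \<in> ball 0 1")
        case True
        then have "ennreal ((1 - (norm z)\<^sup>2) powr \<gamma> * norm (f z - g z)) \<le> 0"
          unfolding 0[symmetric] wnorm_def by (rule SUP_upper)
        moreover have "(norm z)\<^sup>2 < 1" using True by (simp add: power_less_one_iff abs_square_less_1)
        then have "0 < (1 - (norm z)\<^sup>2) powr \<gamma>" by simp
        ultimately show ?thesis
          by (auto simp: ennreal_eq_0_iff mult_le_0_iff)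
      qed (use f g in \<open>auto simp: Hinf_def\<close>)
    qed
  qed (simp add: wdist_def wnorm_def)
  assume h: "h \<in> Hinf \<gamma>"
  show "wdist \<gamma> f h \<le> wdist \<gamma> f g + wdist \<gamma> g h"
    unfolding wdist_def
    using wnorm_diff_triangle[of \<gamma> f h g] wnorm_diff_finite[OF f g] wnorm_diff_finite[OF g h]
    by (metis enn2real_mono enn2real_plus ennreal_add_less_top infinity_ennreal_def)
qed

end

theory Submission
  imports Defs "HOL-Complex_Analysis.Complex_Analysis"
begin

text \<open>Fix a point \<open>a\<close> of the ball and write \<open>p = \<phi> a\<close>, \<open>q = \<psi> a\<close>, \<open>A = 1 - |p|^2\<close>, \<open>B = 1 - |q|^2\<close>,
\<open>D = 1 - <q,p>\<close>, and \<open>U\<close>, \<open>V\<close> for the weights \<open>u a\<close>, \<open>v a\<close> multiplied by \<open>(1 - |a|^2)^\<beta>\<close>. The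
difference of the two operators sends \<open>f\<close> to a function whose weighted value at \<open>a\<close> is
\<open>U f(p) - V f(q)\<close>, so everything is about such two-point expressions.

Powers of linear forms, divided by their norms, tend to 0 at each point of the ball, uniformly in the
unit vectors that define them. Hence a compact operator sends them to 0 in norm: a limit point of
their images vanishes at every point (\<open>compact_op_normalized_tendsto_0\<close>). This is necessity.

For sufficiency, the norm of \<open><z,\<eta>>^j\<close> is at most of order \<open>j^(-\<alpha>)\<close>, and that of \<open><z,\<eta>>^j <z,\<eta>'>\<close> with
\<open>\<eta>'\<close> orthogonal to \<open>\<eta>\<close> is smaller by the factor \<open>j^(-1/2)\<close>. Multiplying the resulting bounds for the two
families of powers with the power series coefficients of \<open>(1 - <z,p>)^(-m)\<close> and summing turns the
hypothesis into the smallness of Abel means, which controls what happens as \<open>|p|\<close> tends to 1. The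
kernels with exponents \<open>n + 1\<close> and \<open>n + 2\<close>, and the latter times \<open><z,\<eta>'>\<close> for the direction \<open>\<eta>'\<close> of
the part of \<open>q\<close> that is orthogonal to \<open>p\<close>, together show (\<open>kernel_test_pair\<close>) that
\<open>U / A^(n+1) - V / D^(n+1)\<close> and \<open>\<sigma> V / D^(n+1)\<close>, both multiplied by \<open>A^(n+1-\<alpha>)\<close>, tend to 0. Here
\<open>\<sigma> = 1 - A B / |D|^2\<close> is the square of the pseudohyperbolic distance of \<open>p\<close> and \<open>q\<close>.

Now let \<open>f k\<close> be bounded in the weighted norm and tend to 0 at each point, and let \<open>a k\<close> be points of
the ball; along a subsequence \<open>p\<close>, \<open>q\<close> and \<open>\<sigma>\<close> converge. If the limit of \<open>\<sigma>\<close> is positive, \<open>U f(p)\<close> and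
\<open>V f(q)\<close> tend to 0 separately. If it is 0, then \<open>A\<close>, \<open>B\<close> and \<open>D\<close> are asymptotically equal, so that \<open>U\<close>
and \<open>V\<close> are close, and so are \<open>f(p)\<close> and \<open>f(q)\<close>, because \<open>f\<close> extends boundedly along the complex line
through \<open>p\<close> and \<open>q\<close> to a disc that is large compared with the distance of the points
(\<open>weighted_difference_tendsto_0\<close>). Since every bounded sequence has a pointwise convergent subsequence
with holomorphic limit, this gives compactness (\<open>compact_op_if_power_tests\<close>).\<close>

section \<open>The Hermitian inner product\<close>

lemma hinner_add_left: "hinner (x + y) z = hinner x z + hinner y z"
  by (simp add: hinner_def ring_distribs sum.distrib)

lemma hinner_diff_left: "hinner (x - y) z = hinner x z - hinner y z"
  by (simp add: hinner_def ring_distribs sum_subtractf)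

lemma hinner_scale_left: "hinner (c *s x) z = c * hinner x z"
  by (simp add: hinner_def sum_distrib_left mult.assoc)

lemma hinner_commute: "hinner x y = cnj (hinner y x)"
  by (simp add: hinner_def mult.commute)

lemma hinner_add_right: "hinner z (x + y) = hinner z x + hinner z y"
  by (simp add: hinner_def ring_distribs sum.distrib)

lemma hinner_diff_right: "hinner z (x - y) = hinner z x - hinner z y"
  by (simp add: hinner_def ring_distribs sum_subtractf)

lemma hinner_scale_right: "hinner z (c *s x) = cnj c * hinner z x"
  by (simp add: hinner_def sum_distrib_left mult_ac)

lemma hinner_zero_left [simp]: "hinner 0 x = 0"
  by (simp add: hinner_def)

lemmas hinner_simps = hinner_add_left hinner_diff_left hinner_scale_left
  hinner_add_right hinner_diff_right hinner_scale_right

lemma norm_hinner_le: "norm (hinner x y) \<le> norm x * norm y"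
proof -
  have "norm (hinner x y) \<le> (\<Sum>i\<in>UNIV. \<bar>norm (x $ i)\<bar> * \<bar>norm (y $ i)\<bar>)"
    unfolding hinner_def by (rule order_trans[OF norm_sum]) (simp add: norm_mult)
  also have "\<dots> \<le> norm x * norm y"
    unfolding norm_vec_def by (rule L2_set_mult_ineq)
  finally show ?thesis .
qed

lemma norm_complex_scale: "norm (c *s x) = norm c * norm (x :: complex ^ 'n)"
proof -
  have n: "(norm y)\<^sup>2 = norm (hinner y y)" for y :: "complex ^ 'n"
    by (simp add: hinner_self norm_power)
  have "(norm (c *s x))\<^sup>2 = (norm c * norm x)\<^sup>2"
    unfolding power_mult_distrib n by (simp add: hinner_simps norm_mult power2_eq_square)
  then show ?thesis
    by (simp add: power2_eq_iff_nonneg)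
qed

lemma norm_square_eq: "(norm x)\<^sup>2 = Re (hinner x x)"
  by (simp add: hinner_self)

lemma norm_add_square:
  "(norm (x + y))\<^sup>2 = (norm x)\<^sup>2 + 2 * Re (hinner x y) + (norm y)\<^sup>2"
proof -
  have "Re (hinner y x) = Re (hinner x y)"
    by (subst hinner_commute) simp
  then show ?thesis
    by (simp add: norm_square_eq hinner_simps)
qed

lemma bounded_linear_hinner: "bounded_linear (\<lambda>z. hinner z w)"
proof (rule bounded_linear_intro)
  show "hinner (r *\<^sub>R x) w = r *\<^sub>R hinner x w" for r x
    by (simp add: hinner_def scaleR_conv_of_real[of _ "_ :: complex"] sum_distrib_left mult.assoc)
  show "norm (hinner x w) \<le> norm x * norm w" for x
    by (rule norm_hinner_le)
qed (rule hinner_add_left)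

lemma bessel_two:
  assumes "norm a = 1" "norm b = 1" "hinner a b = 0"
  shows "(norm (hinner z a))\<^sup>2 + (norm (hinner z b))\<^sup>2 \<le> (norm z)\<^sup>2"
proof -
  define w where "w = z - hinner z a *s a - hinner z b *s b"
  have ba: "hinner b a = 0" using assms(3) by (subst hinner_commute) simp
  have *: "hinner a z = cnj (hinner z a)" "hinner b z = cnj (hinner z b)"
    by (rule hinner_commute)+
  have "hinner w w = hinner z z - of_real ((norm (hinner z a))\<^sup>2) - of_real ((norm (hinner z b))\<^sup>2)"
    unfolding complex_norm_square
    by (simp add: w_def hinner_simps assms ba hinner_self[of a] hinner_self[of b] * algebra_simps)
  then have "(norm w)\<^sup>2 = (norm z)\<^sup>2 - (norm (hinner z a))\<^sup>2 - (norm (hinner z b))\<^sup>2"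
    by (simp add: norm_square_eq[of w] norm_square_eq[of z])
  then show ?thesis
    using zero_le_power2[of "norm w"] by linarith
qed

section \<open>Powers, kernels and Abel means\<close>

text \<open>The function \<open>(1 - x^2)^\<kappa> x^j\<close> of \<open>x\<close> is largest where \<open>1 - x\<close> is of order \<open>1 / j\<close>, and is at most of
order \<open>j^(-\<kappa>)\<close>. All norm bounds for powers of linear forms, and the summations of such bounds, come
from this.\<close>

lemma powr_times_power_bounded:
  fixes \<kappa> :: real
  assumes "0 \<le> \<kappa>"
  obtains C where "0 \<le> C"
    "\<And>x j. 0 \<le> x \<Longrightarrow> x \<le> 1 \<Longrightarrow> ((1 - x\<^sup>2) * real (Suc j)) powr \<kappa> * x ^ j \<le> C"
proof -
  define C where "C = (2 * (if \<kappa> = 0 then 1 else \<kappa>)) powr \<kappa> * exp 1"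
  have "((1 - x\<^sup>2) * real (Suc j)) powr \<kappa> * x ^ j \<le> C" if x: "0 \<le> x" "x \<le> 1" for x :: real and j :: nat
  proof -
    define y where "y = (1 - x) * real (Suc j)"
    have y: "0 \<le> y" using x by (simp add: y_def)
    \<comment> \<open>With \<open>y = (1 - x) (j + 1)\<close> the power \<open>x^j\<close> decays like \<open>exp (- y)\<close>, which beats \<open>y^\<kappa>\<close>.\<close>
    have "x ^ j \<le> exp (x - 1) ^ j"
      using x exp_ge_add_one_self[of "x - 1"] by (intro power_mono) auto
    also have "\<dots> = exp (-y + (1 - x))"
      by (simp add: y_def exp_of_nat_mult[symmetric] algebra_simps)
    also have "\<dots> \<le> exp (-y) * exp 1"
      unfolding exp_add using x by (intro mult_left_mono) auto
    finally have 1: "x ^ j \<le> exp (-y) * exp 1" .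
    have "(1 - x\<^sup>2) * real (Suc j) = (1 + x) * y"
      by (simp add: y_def power2_eq_square algebra_simps)
    also have "\<dots> \<le> 2 * y" using x y by (intro mult_right_mono) auto
    finally have 2: "((1 - x\<^sup>2) * real (Suc j)) powr \<kappa> \<le> (2 * y) powr \<kappa>"
      using x assms by (intro powr_mono2) (auto simp: power_le_one)
    have 3: "(2 * y) powr \<kappa> \<le> (2 * (if \<kappa> = 0 then 1 else \<kappa>)) powr \<kappa> * exp y"
    proof (cases "\<kappa> = 0")
      case False
      then have k: "\<kappa> > 0" using assms by simp
      have "y / \<kappa> \<le> exp (y / \<kappa>)"
        using exp_ge_add_one_self[of "y / \<kappa>"] by linarith
      then have "2 * y \<le> (2 * \<kappa>) * exp (y / \<kappa>)"
        using k by (simp add: field_simps)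
      then have "(2 * y) powr \<kappa> \<le> ((2 * \<kappa>) * exp (y / \<kappa>)) powr \<kappa>"
        using y k by (intro powr_mono2) auto
      also have "\<dots> = (2 * \<kappa>) powr \<kappa> * exp y"
        using k by (simp add: powr_mult exp_powr_real)
      finally show ?thesis using False by simp
    next
      case True
      then show ?thesis using y by simp
    qed
    have "((1 - x\<^sup>2) * real (Suc j)) powr \<kappa> * x ^ j \<le>
       ((2 * (if \<kappa> = 0 then 1 else \<kappa>)) powr \<kappa> * exp y) * (exp (-y) * exp 1)"
      using 1 2 3 x by (intro mult_mono) auto
    also have "\<dots> = C"
      by (simp add: C_def exp_minus)
    finally show ?thesis .
  qed
  moreover have "0 \<le> C" by (simp add: C_def)
  ultimately show ?thesis using that by blast
qed

text \<open>The coefficients are binomial coefficients, but only their sign and growth matter. Dividing by \<open>1 - z\<close>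
replaces the coefficients by their partial sums, which raises the growth by one power of \<open>j\<close>.\<close>

lemma inverse_power_series:
  obtains c :: "nat \<Rightarrow> real" where "\<And>j. 0 \<le> c j" "\<And>j. c j \<le> real (Suc j) ^ n"
    "\<And>z :: complex. norm z < 1 \<Longrightarrow> (\<lambda>j. of_real (c j) * z ^ j) sums (1 / (1 - z) ^ Suc n)"
proof -
  have "\<exists>c :: nat \<Rightarrow> real. (\<forall>j. 0 \<le> c j \<and> c j \<le> real (Suc j) ^ n) \<and>
    (\<forall>z :: complex. norm z < 1 \<longrightarrow> (\<lambda>j. of_real (c j) * z ^ j) sums (1 / (1 - z) ^ Suc n))"
  proof (induction n)
    case 0
    show ?case
      by (rule exI[of _ "\<lambda>_. 1"]) (auto intro: geometric_sums)
  next
    case (Suc n)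
    then obtain c :: "nat \<Rightarrow> real" where c: "\<And>j. 0 \<le> c j" "\<And>j. c j \<le> real (Suc j) ^ n"
      "\<And>z :: complex. norm z < 1 \<Longrightarrow> (\<lambda>j. of_real (c j) * z ^ j) sums (1 / (1 - z) ^ Suc n)"
      by blast
    define d where "d j = (\<Sum>i\<le>j. c i)" for j
    have "d j \<le> real (Suc j) ^ Suc n" for j
    proof -
      have "d j \<le> (\<Sum>i\<le>j. real (Suc j) ^ n)"
        unfolding d_def using c(2) by (intro sum_mono order_trans[OF c(2)] power_mono) auto
      then show ?thesis by simp
    qed
    moreover have "(\<lambda>j. of_real (d j) * z ^ j) sums (1 / (1 - z) ^ Suc (Suc n))"
      if z: "norm z < 1" for z :: complex
    proof -
      have s: "summable (\<lambda>j. norm (of_real (c j) * z ^ j))"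
      proof -
        have "(\<lambda>j. of_real (c j) * (of_real (norm z)) ^ j :: complex) sums (1 / (1 - of_real (norm z)) ^ Suc n)"
          using c(3)[of "of_real (norm z)"] z by simp
        then have "summable (\<lambda>j. complex_of_real (c j * norm z ^ j))"
          by (simp add: sums_iff)
        then have "summable (\<lambda>j. Re (complex_of_real (c j * norm z ^ j)))"
          by (rule summable_Re)
        then show ?thesis using c(1) by (simp add: norm_mult norm_power)
      qed
      have g: "summable (\<lambda>j. norm (z ^ j))"
        using z by (simp add: norm_power)
      have "(\<lambda>j. \<Sum>i\<le>j. of_real (c i) * z ^ i * z ^ (j - i)) sums
          ((\<Sum>j. of_real (c j) * z ^ j) * (\<Sum>j. z ^ j))"
        by (rule Cauchy_product_sums[OF s g])
      moreover have "(\<Sum>i\<le>j. of_real (c i) * z ^ i * z ^ (j - i)) = of_real (d j) * z ^ j" for j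
        by (simp add: d_def sum_distrib_right mult.assoc power_add[symmetric])
      ultimately show ?thesis
        using c(3)[OF z] geometric_sums[OF z] by (simp add: sums_iff)
    qed
    moreover have "0 \<le> d j" for j unfolding d_def using c(1) by (simp add: sum_nonneg)
    ultimately show ?case by blast
  qed
  then show ?thesis using that by blast
qed

text \<open>The weights \<open>(1 - y) y^j\<close> add up to 1.\<close>

definition abel_mean :: "(nat \<Rightarrow> real) \<Rightarrow> real \<Rightarrow> real"
  where "abel_mean e y = (1 - y) * (\<Sum>j. e j * y ^ j)"

lemma summable_bounded_times_power:
  fixes e :: "nat \<Rightarrow> real"
  assumes "\<And>j. \<bar>e j\<bar> \<le> M" "0 \<le> y" "y < 1"
  shows "summable (\<lambda>j. e j * y ^ j)"
proof (rule summable_comparison_test')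
  show "summable (\<lambda>j. M * y ^ j)" using assms by (intro summable_mult summable_geometric) auto
  show "norm (e j * y ^ j) \<le> M * y ^ j" for j
    using assms order_trans[OF abs_ge_zero assms(1)] by (auto simp: abs_mult intro!: mult_mono)
qed

lemma abel_mean_tendsto_0:
  assumes e: "e \<longlonglongrightarrow> 0" "\<And>j. 0 \<le> e j"
    and y: "\<And>k. 0 \<le> y k" "\<And>k. y k < 1" "y \<longlonglongrightarrow> 1"
  shows "(\<lambda>k. abel_mean e (y k)) \<longlonglongrightarrow> 0"
proof (rule LIMSEQ_I)
  fix r :: real assume r: "0 < r"
  obtain M where M: "\<And>j. \<bar>e j\<bar> \<le> M" "0 < M"
    using e(1) by (metis convergent_imp_Bseq Bseq_def convergentI real_norm_def)
  obtain J where J: "\<And>j. j \<ge> J \<Longrightarrow> e j \<le> r / 2"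
    using LIMSEQ_D[OF e(1), of "r / 2"] r by (metis abs_le_D1 diff_zero half_gt_zero less_eq_real_def real_norm_def)
  have bound: "abel_mean e (y k) \<le> (1 - y k) * (real J * M) + r / 2" for k
  proof -
    have "(\<Sum>j. e j * y k ^ j) \<le> (\<Sum>j. (if j < J then M else 0) + r / 2 * y k ^ j)"
    proof (rule suminf_le)
      fix j
      have "e j * y k ^ j \<le> M * 1"
        using M(1)[of j] M(2) e(2)[of j] y(1)[of k] y(2)[of k]
        by (intro mult_mono power_le_one) auto
      moreover have "0 \<le> r / 2 * y k ^ j" using r y by simp
      moreover have "e j * y k ^ j \<le> r / 2 * y k ^ j" if "\<not> j < J"
        using J[of j] that y by (intro mult_right_mono) auto
      ultimately show "e j * y k ^ j \<le> (if j < J then M else 0) + r / 2 * y k ^ j"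
        by (smt (verit))
    next
      show "summable (\<lambda>j. e j * y k ^ j)" using summable_bounded_times_power[OF M(1)] y by auto
      show "summable (\<lambda>j. (if j < J then M else 0) + r / 2 * y k ^ j)"
        using y by (intro summable_add summable_mult summable_geometric)
          (auto intro: summable_finite[of "{..<J}"])
    qed
    also have "\<dots> = (\<Sum>j<J. M) + r / 2 * (1 / (1 - y k))"
    proof -
      have "(\<lambda>j. if j < J then M else 0) sums (\<Sum>j<J. M)"
        using sums_If_finite_set[of "{..<J}" "\<lambda>_. M"] by simp
      moreover have "(\<lambda>j. r / 2 * y k ^ j) sums (r / 2 * (1 / (1 - y k)))"
        using y by (intro sums_mult geometric_sums) auto
      ultimately show ?thesis
        by (intro sums_unique[symmetric] sums_add)
    qed
    finally have "abel_mean e (y k) \<le> (1 - y k) * (real J * M + r / 2 * (1 / (1 - y k)))"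
      unfolding abel_mean_def using y(2)[of k] by (intro mult_left_mono) auto
    also have "\<dots> = (1 - y k) * (real J * M) + r / 2"
      using y(2)[of k] by (simp add: field_simps)
    finally show ?thesis .
  qed
  have "(\<lambda>k. (1 - y k) * (real J * M)) \<longlonglongrightarrow> (1 - 1) * (real J * M)"
    by (intro tendsto_intros y)
  then have *: "(\<lambda>k. (1 - y k) * (real J * M)) \<longlonglongrightarrow> 0" by simp
  obtain k0 where "\<And>k. k \<ge> k0 \<Longrightarrow> \<bar>(1 - y k) * (real J * M)\<bar> < r / 2"
    using LIMSEQ_D[OF *, of "r / 2"] r by auto
  moreover have "0 \<le> abel_mean e (y k)" for k
    unfolding abel_mean_def using y e M
    by (intro mult_nonneg_nonneg suminf_nonneg summable_bounded_times_power[OF M(1)]) (auto simp: less_imp_le)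
  ultimately have "norm (abel_mean e (y k) - 0) < r" if "k \<ge> k0" for k
    using bound[of k] that by (smt (verit) field_sum_of_halves real_norm_def)
  then show "\<exists>k0. \<forall>k\<ge>k0. norm (abel_mean e (y k) - 0) < r" by blast
qed

lemma abel_mean_const: "0 \<le> y \<Longrightarrow> y < 1 \<Longrightarrow> abel_mean (\<lambda>_. K) y = K"
  by (simp add: abel_mean_def suminf_mult suminf_geometric)

text \<open>Expand the two kernels in powers of \<open>P\<close> and \<open>Q\<close>. The coefficients grow like \<open>j^n\<close>, so the sum of the
bounds behaves like the sum of \<open>e j x^j j^(n - \<kappa>)\<close>. With the factor \<open>(1 - x^2)^(n - \<kappa> + 1)\<close> it becomes
an Abel mean of \<open>e\<close>, at the price of giving up half of the decay of \<open>x^j\<close>; this is why \<open>sqrt x\<close> appears.\<close>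

lemma kernel_difference_bound:
  fixes \<kappa> :: real
  assumes "\<kappa> \<le> real n"
  obtains C where "0 \<le> C"
    "\<And>x (P :: complex) Q u v e M. 0 < x \<Longrightarrow> x < 1 \<Longrightarrow> norm P < 1 \<Longrightarrow> norm Q < 1 \<Longrightarrow>
      (\<And>j. 0 \<le> e j) \<Longrightarrow> (\<And>j. e j \<le> M) \<Longrightarrow>
      (\<And>j. norm (u * P ^ j - v * Q ^ j) \<le> e j * x ^ j * real (Suc j) powr - \<kappa>) \<Longrightarrow>
      (1 - x\<^sup>2) powr (real n - \<kappa> + 1) * norm (u / (1 - P) ^ Suc n - v / (1 - Q) ^ Suc n)
        \<le> C * abel_mean e (sqrt x)"
proof -
  obtain C where C: "0 \<le> C" and C':
    "\<And>x j. 0 \<le> x \<Longrightarrow> x \<le> 1 \<Longrightarrow> ((1 - x\<^sup>2) * real (Suc j)) powr (real n - \<kappa>) * x ^ j \<le> C"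
    using powr_times_power_bounded[of "real n - \<kappa>"] assms by auto
  obtain c :: "nat \<Rightarrow> real" where c: "\<And>j. 0 \<le> c j" "\<And>j. c j \<le> real (Suc j) ^ n"
    "\<And>z :: complex. norm z < 1 \<Longrightarrow> (\<lambda>j. of_real (c j) * z ^ j) sums (1 / (1 - z) ^ Suc n)"
    using inverse_power_series by blast
  define C1 where "C1 = 4 * (2 powr (real n - \<kappa>) * C)"
  have "(1 - x\<^sup>2) powr (real n - \<kappa> + 1) * norm (u / (1 - P) ^ Suc n - v / (1 - Q) ^ Suc n)
        \<le> C1 * abel_mean e (sqrt x)"
    if x: "0 < x" "x < 1" and PQ: "norm P < 1" "norm Q < 1"
      and e: "\<And>j. 0 \<le> e j" "\<And>j. e j \<le> M"
      and le: "\<And>j. norm (u * P ^ j - v * Q ^ j) \<le> e j * x ^ j * real (Suc j) powr - \<kappa>"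
    for x and P Q u v :: complex and e M
  proof -
    define y where "y = sqrt x"
    define t where "t = 1 - x\<^sup>2"
    have y: "0 < y" "y < 1" "x = y\<^sup>2" using x by (auto simp: y_def)
    have t: "0 < t" using x by (simp add: t_def power_less_one_iff)
    have t2: "t \<le> 2 * (1 - y\<^sup>2)"
    proof -
      have "t = (1 + y\<^sup>2) * (1 - y\<^sup>2)" by (simp add: t_def y power2_eq_square algebra_simps)
      also have "\<dots> \<le> 2 * (1 - y\<^sup>2)" using y by (intro mult_right_mono) (auto simp: power_le_one)
      finally show ?thesis .
    qed
    have t4: "t \<le> 4 * (1 - y)"
    proof -
      have "1 - y\<^sup>2 = (1 + y) * (1 - y)" by (simp add: power2_eq_square algebra_simps)
      also have "\<dots> \<le> 2 * (1 - y)" using y by (intro mult_right_mono) auto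
      finally show ?thesis using t2 by simp
    qed
    have summand: "t powr (real n - \<kappa> + 1) * norm (of_real (c j) * (u * P ^ j - v * Q ^ j))
        \<le> t * (2 powr (real n - \<kappa>) * C) * (e j * y ^ j)" for j
    proof -
      have "norm (of_real (c j) * (u * P ^ j - v * Q ^ j))
          \<le> real (Suc j) ^ n * (e j * x ^ j * real (Suc j) powr - \<kappa>)"
        using c le[of j] by (auto simp: norm_mult intro!: mult_mono)
      also have "\<dots> = e j * x ^ j * real (Suc j) powr (real n - \<kappa>)"
      proof -
        have "real (Suc j) powr (real n - \<kappa>) = real (Suc j) ^ n * real (Suc j) powr - \<kappa>"
          using powr_add[of "real (Suc j)" "real n" "- \<kappa>"] powr_realpow[of "real (Suc j)" n] by simp
        then show ?thesis by (simp only: mult_ac)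
      qed
      finally have "t powr (real n - \<kappa> + 1) * norm (of_real (c j) * (u * P ^ j - v * Q ^ j))
          \<le> t powr (real n - \<kappa> + 1) * (e j * x ^ j * real (Suc j) powr (real n - \<kappa>))"
        by (intro mult_left_mono) auto
      also have "\<dots> = t * ((t * real (Suc j)) powr (real n - \<kappa>) * x ^ j) * e j"
        using t powr_add[of t "real n - \<kappa>" 1] by (simp add: powr_mult mult_ac del: of_nat_Suc)
      \<comment> \<open>Since \<open>x = y^2\<close>, one factor \<open>y^j\<close> of \<open>x^j\<close> absorbs the growth in \<open>j\<close>, and the other is kept.\<close>
      also have "\<dots> \<le> t * ((2 powr (real n - \<kappa>) * C) * y ^ j) * e j"
      proof -
        have "(t * real (Suc j)) powr (real n - \<kappa>) \<le> (2 * ((1 - y\<^sup>2) * real (Suc j))) powr (real n - \<kappa>)"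
          using t t2 assms by (intro powr_mono2) (auto intro: mult_right_mono simp del: of_nat_Suc simp: mult.assoc[symmetric])
        also have "\<dots> = 2 powr (real n - \<kappa>) * ((1 - y\<^sup>2) * real (Suc j)) powr (real n - \<kappa>)"
          using y by (intro powr_mult) 
        finally have "(t * real (Suc j)) powr (real n - \<kappa>) * x ^ j
          \<le> (2 powr (real n - \<kappa>) * ((1 - y\<^sup>2) * real (Suc j)) powr (real n - \<kappa>)) * (y ^ j * y ^ j)"
          using y by (intro mult_mono) (auto simp: power2_eq_square power_mult_distrib)
        also have "\<dots> = 2 powr (real n - \<kappa>) * (((1 - y\<^sup>2) * real (Suc j)) powr (real n - \<kappa>) * y ^ j) * y ^ j"
          by simp
        also have "\<dots> \<le> 2 powr (real n - \<kappa>) * C * y ^ j"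
          using y C'[of y j] by (intro mult_right_mono mult_left_mono) auto
        finally show ?thesis
          using t e by (intro mult_right_mono mult_left_mono) auto
      qed
      finally show ?thesis by (simp add: mult_ac)
    qed
    have sums: "(\<lambda>j. of_real (c j) * (u * P ^ j - v * Q ^ j)) sums
        (u / (1 - P) ^ Suc n - v / (1 - Q) ^ Suc n)"
    proof -
      have "(\<lambda>j. u * (of_real (c j) * P ^ j) - v * (of_real (c j) * Q ^ j)) sums
        (u * (1 / (1 - P) ^ Suc n) - v * (1 / (1 - Q) ^ Suc n))"
        using PQ c by (intro sums_diff sums_mult) auto
      then show ?thesis by (simp add: algebra_simps)
    qed
    let ?T = "t powr (real n - \<kappa> + 1)"
    have "?T * norm (u / (1 - P) ^ Suc n - v / (1 - Q) ^ Suc n)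
       = norm (\<Sum>j. of_real ?T * (of_real (c j) * (u * P ^ j - v * Q ^ j)))"
      using sums_mult[OF sums, of "of_real ?T"] by (simp add: sums_iff norm_mult)
    also have "\<dots> \<le> (\<Sum>j. t * (2 powr (real n - \<kappa>) * C) * (e j * y ^ j))"
    proof (rule norm_suminf_le)
      show "norm (of_real ?T * (of_real (c j) * (u * P ^ j - v * Q ^ j)))
          \<le> t * (2 powr (real n - \<kappa>) * C) * (e j * y ^ j)" for j
        using summand[of j] by (simp add: norm_mult)
      show "summable (\<lambda>j. t * (2 powr (real n - \<kappa>) * C) * (e j * y ^ j))"
        using e y by (intro summable_mult summable_bounded_times_power[where M = M]) auto
    qed
    also have "\<dots> = t * (2 powr (real n - \<kappa>) * C) * (\<Sum>j. e j * y ^ j)"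
      using e y by (intro suminf_mult summable_bounded_times_power[where M = M]) auto
    also have "\<dots> \<le> (4 * (1 - y)) * (2 powr (real n - \<kappa>) * C) * (\<Sum>j. e j * y ^ j)"
      using t4 C e y by (intro mult_right_mono suminf_nonneg summable_bounded_times_power[where M = M]) auto
    also have "\<dots> = C1 * abel_mean e y"
      by (simp add: C1_def abel_mean_def)
    finally show ?thesis by (simp add: t_def y_def)
  qed
  moreover have "0 \<le> C1" using C by (simp add: C1_def)
  ultimately show ?thesis using that by blast
qed

section \<open>Holomorphic functions along complex lines\<close>

text \<open>Cauchy's estimates on discs of radius \<open>R / 4\<close> about the points of the closed unit disc, followed by
Taylor's formula between 0 and 1: a bounded function on a large disc is almost constant, and even
closer to affine, on the unit disc.\<close>

lemma disc_taylor_bounds: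
  assumes g: "g holomorphic_on ball 0 R" and L: "\<And>z. norm z < R \<Longrightarrow> norm (g z) \<le> L" and R: "2 \<le> R"
  shows "norm (g 1 - g 0) \<le> 4 * L / R" "norm (g 1 - g 0 - deriv g 0) \<le> 32 * L / R\<^sup>2"
proof -
  have bound: "norm ((deriv ^^ n) g z) \<le> fact n * L / (R / 4) ^ n" if z: "z \<in> cball 0 1" for n z
  proof (rule Cauchy_inequality)
    have sub: "cball z (R / 4) \<subseteq> ball 0 R"
    proof
      fix w assume "w \<in> cball z (R / 4)"
      then have "dist z w \<le> R / 4" by simp
      then have "norm w \<le> norm z + R / 4"
        using norm_triangle_ineq2[of w z] by (simp add: dist_norm norm_minus_commute)
      then show "w \<in> ball 0 R" using z R by simp
    qed
    show "g holomorphic_on ball z (R / 4)"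
      using g sub by (meson ball_subset_cball holomorphic_on_subset order_trans)
    show "continuous_on (cball z (R / 4)) g"
      using g sub by (meson holomorphic_on_imp_continuous_on holomorphic_on_subset)
    show "0 < R / 4" using R by simp
    show "norm (g x) \<le> L" if "norm (z - x) = R / 4" for x
      using sub that L[of x] by (auto simp: subset_iff dist_norm)
  qed
  have der: "((deriv ^^ i) g has_field_derivative deriv ((deriv ^^ i) g) x) (at x within cball 0 1)"
    if "x \<in> cball 0 1" for i x
  proof -
    have "(deriv ^^ i) g holomorphic_on ball 0 R"
      using g by (simp add: holomorphic_higher_deriv)
    then have "(deriv ^^ i) g field_differentiable at x"
      using that R by (intro holomorphic_on_imp_differentiable_at[of _ "ball 0 R"]) auto
    then show ?thesis
      using DERIV_deriv_iff_field_differentiable has_field_derivative_at_within by fastforce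
  qed
  have "norm ((deriv ^^ 0) g 1 - (\<Sum>i\<le>0. (deriv ^^ i) g 0 * (1 - 0) ^ i / fact i))
      \<le> fact 1 * L / (R / 4) ^ 1 * norm (1 - 0 :: complex) ^ Suc 0 / fact 0"
  proof (rule complex_Taylor[where S = "cball 0 1" and f = "\<lambda>i. (deriv ^^ i) g"])
    show "norm ((deriv ^^ Suc 0) g x) \<le> fact 1 * L / (R / 4) ^ 1" if "x \<in> cball 0 1" for x
      using bound[OF that, of 1] by simp
  qed (use der der[of _ 0] in auto)
  then show "norm (g 1 - g 0) \<le> 4 * L / R"
    by (simp add: field_simps)
  have "norm ((deriv ^^ 0) g 1 - (\<Sum>i\<le>1. (deriv ^^ i) g 0 * (1 - 0) ^ i / fact i))
      \<le> fact 2 * L / (R / 4) ^ 2 * norm (1 - 0 :: complex) ^ Suc 1 / fact 1"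
  proof (rule complex_Taylor[where S = "cball 0 1" and f = "\<lambda>i. (deriv ^^ i) g"])
    show "norm ((deriv ^^ Suc 1) g x) \<le> fact 2 * L / (R / 4) ^ 2" if "x \<in> cball 0 1" for x
      using bound[OF that, of 2] by (simp add: numeral_2_eq_2)
  qed (use der der[of _ 0] in auto)
  then show "norm (g 1 - g 0 - deriv g 0) \<le> 32 * L / R\<^sup>2"
    by (simp add: field_simps)
qed

lemma has_derivative_complex_line:
  "((\<lambda>c. p + c *s d) has_derivative (\<lambda>c. c *s d)) (at (x :: complex))"
    for p d :: "complex ^ 'n"
proof -
  have "bounded_linear (\<lambda>c. c *s d)"
    by (rule bounded_linear_intro[where K = "norm d"])
      (auto simp: norm_complex_scale vec_eq_iff ring_distribs)
  then show ?thesis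
    by (auto intro!: derivative_eq_intros bounded_linear_imp_has_derivative)
qed

lemma has_field_derivative_on_line:
  fixes f :: "complex ^ 'n \<Rightarrow> complex"
  assumes "(f has_derivative D) (at (p + c *s d))" "\<And>c v. D (c *s v) = c * D v"
  shows "((\<lambda>c. f (p + c *s d)) has_field_derivative D d) (at c)"
proof -
  have "((\<lambda>c. f (p + c *s d)) has_derivative (\<lambda>c. D (c *s d))) (at c)"
    using has_derivative_compose[OF has_derivative_complex_line assms(1)] .
  then show ?thesis
    unfolding has_field_derivative_def by (simp add: assms(2) mult.commute[of _ "D d"])
qed

text \<open>The increment from \<open>p\<close> to \<open>p + d\<close> is small if \<open>f\<close> stays bounded on the much larger disc
\<open>{p + c d. |c| < R}\<close> in the complex line through both points.\<close>

lemma line_increment_bounds: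
  fixes f :: "complex ^ 'n \<Rightarrow> complex"
  assumes f: "holomorphic_sv f S" and R: "2 \<le> R"
    and L: "\<And>c. norm c < R \<Longrightarrow> p + c *s d \<in> S \<and> norm (f (p + c *s d)) \<le> L"
  shows "norm (f (p + d) - f p) \<le> 4 * L / R"
    "(f has_derivative D) (at p) \<Longrightarrow> (\<And>c v. D (c *s v) = c * D v) \<Longrightarrow>
      norm (f (p + d) - f p - D d) \<le> 32 * L / R\<^sup>2"
proof -
  define g where "g c = f (p + c *s d)" for c
  have "g holomorphic_on ball 0 R"
    unfolding holomorphic_on_def g_def
  proof
    fix c :: complex assume "c \<in> ball 0 R"
    then obtain D where "(f has_derivative D) (at (p + c *s d))" "\<And>c v. D (c *s v) = c * D v"
      using f L[of c] unfolding holomorphic_sv_def by auto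
    then have "((\<lambda>c. f (p + c *s d)) has_field_derivative D d) (at c)"
      by (rule has_field_derivative_on_line)
    then show "(\<lambda>c. f (p + c *s d)) field_differentiable at c within ball 0 R"
      unfolding field_differentiable_def using has_field_derivative_at_within by blast
  qed
  note * = disc_taylor_bounds[OF this _ R, of L]
  show "norm (f (p + d) - f p) \<le> 4 * L / R"
    using *(1) L by (simp add: g_def)
  assume "(f has_derivative D) (at p)" and D: "\<And>c v. D (c *s v) = c * D v"
  then have "(f has_derivative D) (at (p + 0 *s d))" by simp
  from has_field_derivative_on_line[OF this D] have "deriv g 0 = D d"
    unfolding g_def by (rule DERIV_imp_deriv)
  then show "norm (f (p + d) - f p - D d) \<le> 32 * L / R\<^sup>2"
    using *(2) L by (simp add: g_def)
qed

text \<open>The real-valued form of \<open>wnorm \<gamma> f \<le> M\<close>, in which the bound can be used pointwise.\<close>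

definition weighted_bound :: "real \<Rightarrow> real \<Rightarrow> (complex ^ 'n \<Rightarrow> complex) \<Rightarrow> bool"
  where "weighted_bound \<gamma> M f \<longleftrightarrow> (\<forall>z\<in>ball 0 1. (1 - (norm z)\<^sup>2) powr \<gamma> * norm (f z) \<le> M)"

lemma wnorm_le_iff: "0 \<le> M \<Longrightarrow> wnorm \<gamma> f \<le> ennreal M \<longleftrightarrow> weighted_bound \<gamma> M f"
  by (auto simp: wnorm_def weighted_bound_def SUP_le_iff)

lemma wnorm_upper: "z \<in> ball 0 1 \<Longrightarrow> ennreal ((1 - (norm z)\<^sup>2) powr \<gamma> * norm (f z)) \<le> wnorm \<gamma> f"
  unfolding wnorm_def by (rule SUP_upper)

lemma one_minus_norm_square_pos: "z \<in> ball 0 1 \<Longrightarrow> 0 < 1 - (norm z)\<^sup>2"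
  by (simp add: power_less_one_iff abs_square_less_1)

text \<open>The constants depend on \<open>p\<close>, \<open>\<gamma>\<close> and \<open>M\<close> only. The first estimate is the equicontinuity of a bounded
family; the second is a uniform rate of differentiability, which survives pointwise limits.\<close>

lemma local_increment_bounds:
  fixes p :: "complex ^ 'n"
  assumes p: "p \<in> ball 0 1" and \<gamma>: "0 < \<gamma>" and M: "0 \<le> M"
  obtains r C where "0 < r" "0 \<le> C" "\<And>d. norm d \<le> r \<Longrightarrow> p + d \<in> ball 0 1"
    "\<And>f d. holomorphic_sv f (ball 0 1) \<Longrightarrow> weighted_bound \<gamma> M f \<Longrightarrow> norm d \<le> r \<Longrightarrow>
      norm (f (p + d) - f p) \<le> C * norm d"
    "\<And>f d D. holomorphic_sv f (ball 0 1) \<Longrightarrow> weighted_bound \<gamma> M f \<Longrightarrow> norm d \<le> r \<Longrightarrow>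
      (f has_derivative D) (at p) \<Longrightarrow> (\<And>c v. D (c *s v) = c * D v) \<Longrightarrow>
      norm (f (p + d) - f p - D d) \<le> C * (norm d)\<^sup>2"
proof -
  define r where "r = (1 - norm p) / 2"
  define T where "T = 1 - ((1 + norm p) / 2)\<^sup>2"
  define L where "L = M / T powr \<gamma>"
  define C where "C = max (4 * L / r) (32 * L / r\<^sup>2)"
  have r: "0 < r" "r \<le> 1" using p by (auto simp: r_def intro: order_trans[OF _ norm_ge_zero])
  have "((1 + norm p) / 2)\<^sup>2 < 1" using p by (simp add: power_less_one_iff)
  then have T: "0 < T" by (simp add: T_def)
  then have L: "0 \<le> L" using M by (simp add: L_def)
  have near: "z \<in> ball 0 1 \<and> norm (f z) \<le> L"
    if z: "norm (z - p) \<le> r" and f: "weighted_bound \<gamma> M f" for z f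
  proof -
    have "norm z \<le> norm p + r" using z norm_triangle_ineq2[of z p] by simp
    then have nz: "norm z \<le> (1 + norm p) / 2" unfolding r_def by argo
    then have zb: "z \<in> ball 0 1" using p by simp
    have "T \<le> 1 - (norm z)\<^sup>2"
      unfolding T_def using power_mono[OF nz, of 2] by simp
    then have "T powr \<gamma> * norm (f z) \<le> (1 - (norm z)\<^sup>2) powr \<gamma> * norm (f z)"
      using T \<gamma> by (intro mult_right_mono powr_mono2) auto
    also have "\<dots> \<le> M" using f zb by (simp add: weighted_bound_def)
    finally show ?thesis using zb T by (simp add: L_def field_simps)
  qed
  have zero: "weighted_bound \<gamma> M (\<lambda>_. 0)" using M by (simp add: weighted_bound_def)
  have ball: "p + d \<in> ball 0 1" if "norm d \<le> r / 2" for d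
    using near[of "p + d" "\<lambda>_. 0"] that r zero by auto
  have main: "norm (f (p + d) - f p) \<le> C * norm d \<and>
      ((f has_derivative D) (at p) \<longrightarrow> (\<forall>c v. D (c *s v) = c * D v) \<longrightarrow>
      norm (f (p + d) - f p - D d) \<le> C * (norm d)\<^sup>2)"
    if f: "holomorphic_sv f (ball 0 1)" "weighted_bound \<gamma> M f" and d: "norm d \<le> r / 2" for f d D
  proof (cases "d = 0")
    case True
    moreover have "D d = 0" if "\<forall>c v. D (c *s v) = c * D v"
    proof -
      have "D (0 *s d) = 0 * D d" using that by blast
      then show ?thesis using True by simp
    qed
    ultimately show ?thesis by simp
  next
    case False
    have R: "2 \<le> r / norm d" using d False by (simp add: field_simps)
    have disc: "p + c *s d \<in> ball 0 1 \<and> norm (f (p + c *s d)) \<le> L" if "norm c < r / norm d" for c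
      using that near[OF _ f(2), of "p + c *s d"] False
      by (simp add: norm_complex_scale field_simps)
    have "norm (f (p + d) - f p) \<le> 4 * L / (r / norm d)"
      by (rule line_increment_bounds(1)[OF f(1) R]) (use disc in blast)
    also have "\<dots> = 4 * L / r * norm d" by simp
    also have "\<dots> \<le> C * norm d" by (intro mult_right_mono) (auto simp: C_def)
    finally have 1: "norm (f (p + d) - f p) \<le> C * norm d" .
    have "norm (f (p + d) - f p - D d) \<le> C * (norm d)\<^sup>2"
      if "(f has_derivative D) (at p)" "\<forall>c v. D (c *s v) = c * D v"
    proof -
      have "norm (f (p + d) - f p - D d) \<le> 32 * L / (r / norm d)\<^sup>2"
        by (rule line_increment_bounds(2)[OF f(1) R]) (use disc that in blast)+
      also have "\<dots> = 32 * L / r\<^sup>2 * (norm d)\<^sup>2"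
        by (simp add: power_divide)
      also have "\<dots> \<le> C * (norm d)\<^sup>2" by (intro mult_right_mono) (auto simp: C_def)
      finally show ?thesis .
    qed
    with 1 show ?thesis by blast
  qed
  have "0 \<le> C" using r L by (simp add: C_def le_max_iff_disj)
  then show ?thesis
    using that[of "r / 2" C] r ball main by (metis half_gt_zero)
qed

lemma convergent_if_approximable:
  fixes x :: "nat \<Rightarrow> 'a :: banach"
  assumes "\<And>e. 0 < e \<Longrightarrow> \<exists>c. convergent c \<and> (\<forall>k. norm (x k - c k) \<le> e)"
  shows "convergent x"
proof -
  have "Cauchy x"
  proof (rule CauchyI)
    fix e :: real assume "0 < e"
    then obtain c where c: "convergent c" "\<And>k. norm (x k - c k) \<le> e / 4"
      using assms[of "e / 4"] by auto
    then obtain N where N: "\<And>m n. m \<ge> N \<Longrightarrow> n \<ge> N \<Longrightarrow> norm (c m - c n) < e / 4"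
      using CauchyD[of c "e / 4"] convergent_Cauchy \<open>0 < e\<close> by (metis zero_less_divide_iff zero_less_numeral)
    have "norm (x m - x n) < e" if "m \<ge> N" "n \<ge> N" for m n
    proof -
      have "x m - x n = (x m - c m) + (c m - c n) - (x n - c n)" by simp
      also have "norm \<dots> \<le> norm (x m - c m) + norm (c m - c n) + norm (x n - c n)"
        by (intro order_trans[OF norm_triangle_ineq4] add_right_mono norm_triangle_ineq)
      finally show ?thesis using c(2)[of m] c(2)[of n] N[OF that] \<open>0 < e\<close> by simp
    qed
    then show "\<exists>N. \<forall>m\<ge>N. \<forall>n\<ge>N. norm (x m - x n) < e" by blast
  qed
  then show ?thesis by (simp add: Cauchy_convergent)
qed

text \<open>The derivatives at a point differ from difference quotients
by an error that is uniformly small, so they converge because the difference quotients do. Their limit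
is complex linear and inherits the quadratic error estimate, hence is the derivative of the limit.\<close>

lemma holomorphic_sv_pointwise_limit:
  fixes F :: "nat \<Rightarrow> complex ^ 'n \<Rightarrow> complex"
  assumes F: "\<And>k. holomorphic_sv (F k) (ball 0 1)" "\<And>k. weighted_bound \<gamma> M (F k)"
    and \<gamma>: "0 < \<gamma>" and M: "0 \<le> M"
    and lim: "\<And>z. z \<in> ball 0 1 \<Longrightarrow> (\<lambda>k. F k z) \<longlonglongrightarrow> f z"
  shows "holomorphic_sv f (ball 0 1)" "weighted_bound \<gamma> M f"
proof -
  show "weighted_bound \<gamma> M f"
    unfolding weighted_bound_def
  proof
    fix z :: "complex ^ 'n" assume z: "z \<in> ball 0 1"
    have "(\<lambda>k. (1 - (norm z)\<^sup>2) powr \<gamma> * norm (F k z)) \<longlonglongrightarrow> (1 - (norm z)\<^sup>2) powr \<gamma> * norm (f z)"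
      by (intro tendsto_intros lim z)
    then show "(1 - (norm z)\<^sup>2) powr \<gamma> * norm (f z) \<le> M"
      by (rule LIMSEQ_le_const2) (use F(2) z in \<open>auto simp: weighted_bound_def\<close>)
  qed
  show "holomorphic_sv f (ball 0 1)"
    unfolding holomorphic_sv_def
  proof
    fix p :: "complex ^ 'n" assume p: "p \<in> ball 0 1"
    obtain r C where r: "0 < r" and C: "0 \<le> C" and ball: "\<And>d. norm d \<le> r \<Longrightarrow> p + d \<in> ball 0 1"
      and rC: "\<And>f d D. holomorphic_sv f (ball 0 1) \<Longrightarrow> weighted_bound \<gamma> M f \<Longrightarrow> norm d \<le> r \<Longrightarrow>
      (f has_derivative D) (at p) \<Longrightarrow> (\<And>c v. D (c *s v) = c * D v) \<Longrightarrow>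
      norm (f (p + d) - f p - D d) \<le> C * (norm d)\<^sup>2"
      using local_increment_bounds[OF p \<gamma> M] by metis
    have "\<forall>k. \<exists>D. (F k has_derivative D) (at p) \<and> (\<forall>c v. D (c *s v) = c * D v)"
      using F(1) p unfolding holomorphic_sv_def by blast
    then obtain D where D: "\<And>k. (F k has_derivative D k) (at p)" "\<And>k c v. D k (c *s v) = c * D k v"
      by metis
    have est: "norm (F k (p + d) - F k p - D k d) \<le> C * (norm d)\<^sup>2" if "norm d \<le> r" for k d
      using rC[OF F(1)[of k] F(2)[of k] that D(1)] D(2) by blast
    have "convergent (\<lambda>k. D k h)" for h
    proof (rule convergent_if_approximable)
      fix e :: real assume e: "0 < e"
      \<comment> \<open>A step so short that \<open>t h\<close> stays in the good neighbourhood and the error \<open>t C |h|^2\<close> of the difference quotient is at most \<open>e\<close>.\<close>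
      define t where "t = min (r / (norm h + 1)) (e / (C * (norm h)\<^sup>2 + 1))"
      have pos: "0 < C * (norm h)\<^sup>2 + 1" using C by (intro add_nonneg_pos) auto
      have t: "0 < t" "t * norm h \<le> r" "t * (C * (norm h)\<^sup>2) \<le> e"
      proof -
        show t: "0 < t" using r e pos by (simp add: t_def add_nonneg_pos)
        have "t * norm h \<le> t * (norm h + 1)" using t by simp
        also have "\<dots> \<le> r / (norm h + 1) * (norm h + 1)" by (intro mult_right_mono) (auto simp: t_def)
        also have "\<dots> = r" by (simp add: add_nonneg_eq_0_iff)
        finally show "t * norm h \<le> r" .
        have "t * (C * (norm h)\<^sup>2) \<le> t * (C * (norm h)\<^sup>2 + 1)" using t by simp
        also have "\<dots> \<le> e / (C * (norm h)\<^sup>2 + 1) * (C * (norm h)\<^sup>2 + 1)"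
          using pos by (intro mult_right_mono) (auto simp: t_def)
        also have "\<dots> = e" using pos by simp
        finally show "t * (C * (norm h)\<^sup>2) \<le> e" .
      qed
      define d where "d = complex_of_real t *s h"
      have nd: "norm d = t * norm h" using t by (simp add: d_def norm_complex_scale)
      define c where "c k = (F k (p + d) - F k p) / of_real t" for k
      have "convergent c"
      proof -
        have "c \<longlonglongrightarrow> (f (p + d) - f p) / of_real t"
          unfolding c_def using p ball[of d] nd t by (intro tendsto_intros lim) auto
        then show ?thesis by (rule convergentI)
      qed
      moreover have "norm (D k h - c k) \<le> e" for k
      proof -
        have "D k h - c k = - ((F k (p + d) - F k p - D k d) / of_real t)"
          using t D(2)[of k "of_real t" h] by (simp add: c_def d_def field_simps)
        then have "norm (D k h - c k) = norm (F k (p + d) - F k p - D k d) / t"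
          using t by (simp add: norm_divide)
        also have "\<dots> \<le> C * (norm d)\<^sup>2 / t"
          using est[of d k] nd t by (intro divide_right_mono) auto
        also have "\<dots> = t * (C * (norm h)\<^sup>2)"
          using t by (simp add: nd power2_eq_square)
        also have "\<dots> \<le> e" by (rule t)
        finally show ?thesis .
      qed
      ultimately show "\<exists>c. convergent c \<and> (\<forall>k. norm (D k h - c k) \<le> e)" by blast
    qed
    then obtain E where E: "\<And>h. (\<lambda>k. D k h) \<longlonglongrightarrow> E h"
      unfolding convergent_def by metis
    have lin: "linear (D k)" for k
      using D(1) has_derivative_linear by blast
    have E_scale: "E (c *s v) = c * E v" for c v
      using E[of "c *s v"] tendsto_mult[OF tendsto_const[of c] E[of v]] LIMSEQ_unique by (fastforce simp: D(2))
    have "linear E"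
    proof (rule linearI)
      show "E (x + y) = E x + E y" for x y
        using E[of "x + y"] tendsto_add[OF E[of x] E[of y]] LIMSEQ_unique
        by (fastforce simp: linear_add[OF lin])
      show "E (c *\<^sub>R x) = c *\<^sub>R E x" for c x
        using E[of "c *\<^sub>R x"] tendsto_scaleR[OF tendsto_const[of c] E[of x]] LIMSEQ_unique
        by (fastforce simp: linear_scale[OF lin])
    qed
    have E_est: "norm (f (p + d) - f p - E d) \<le> C * (norm d)\<^sup>2" if "norm d \<le> r" for d
    proof -
      have "(\<lambda>k. norm (F k (p + d) - F k p - D k d)) \<longlonglongrightarrow> norm (f (p + d) - f p - E d)"
        using p ball[OF that] by (intro tendsto_intros lim E) auto
      then show ?thesis
        by (rule LIMSEQ_le_const2) (use est[OF that] in auto)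
    qed
    have "(f has_derivative E) (at p)"
      unfolding has_derivative_at_alt
    proof (intro conjI allI impI)
      show "bounded_linear E"
        using \<open>linear E\<close> by (simp add: linear_conv_bounded_linear)
      fix e :: real assume e: "0 < e"
      have "norm (f y - f p - E (y - p)) \<le> e * norm (y - p)"
        if y: "norm (y - p) < min r (e / (C + 1))" for y
      proof -
        have "norm (f y - f p - E (y - p)) \<le> (C * norm (y - p)) * norm (y - p)"
          using E_est[of "y - p"] y by (simp add: power2_eq_square)
        also have "\<dots> \<le> e * norm (y - p)"
        proof (rule mult_right_mono)
          have "C * norm (y - p) \<le> (C + 1) * (e / (C + 1))"
            using C e y by (intro mult_mono) auto
          then show "C * norm (y - p) \<le> e" using C by simp
        qed simp
        finally show ?thesis .
      qed
      then show "\<exists>d>0. \<forall>y. norm (y - p) < d \<longrightarrow> norm (f y - f p - E (y - p)) \<le> e * norm (y - p)"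
        using r e C by (intro exI[of _ "min r (e / (C + 1))"]) auto
    qed
    with E_scale show "\<exists>D. (f has_derivative D) (at p) \<and> (\<forall>c v. D (c *s v) = c * D v)"
      by blast
  qed
qed

text \<open>Montel's theorem in the form needed here. The weighted values are bounded by \<open>M\<close>, so a diagonal argument
gives convergence on a countable dense set; equicontinuity extends it to all points.\<close>

lemma pointwise_convergent_subsequence:
  fixes F :: "nat \<Rightarrow> complex ^ 'n \<Rightarrow> complex"
  assumes F: "\<And>k. holomorphic_sv (F k) (ball 0 1)" "\<And>k. weighted_bound \<gamma> M (F k)"
    and \<gamma>: "0 < \<gamma>" and M: "0 \<le> M"
  obtains s f where "strict_mono (s :: nat \<Rightarrow> nat)"
    "\<And>z. z \<in> ball 0 1 \<Longrightarrow> (\<lambda>k. F (s k) z) \<longlonglongrightarrow> f z"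
proof -
  obtain S :: "(complex ^ 'n) set" where S: "countable S" "S \<subseteq> ball 0 1" "ball 0 1 \<subseteq> closure S"
    using separable by metis
  have "\<And>n x. x \<in> S \<Longrightarrow> norm (of_real ((1 - (norm x)\<^sup>2) powr \<gamma>) * F n x) \<le> M"
    using F(2) S(2) unfolding weighted_bound_def by (auto simp: norm_mult)
  then obtain s :: "nat \<Rightarrow> nat" where s: "strict_mono s"
    "\<And>x. x \<in> S \<Longrightarrow> \<exists>l. (\<lambda>n. of_real ((1 - (norm x)\<^sup>2) powr \<gamma>) * F (s n) x) \<longlonglongrightarrow> l"
    using function_convergent_subsequence[OF S(1), of "\<lambda>n x. of_real ((1 - (norm x)\<^sup>2) powr \<gamma>) * F n x" M]
    by metis
  have conv: "convergent (\<lambda>k. F (s k) x)" if x: "x \<in> S" for x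
  proof -
    obtain l where l: "(\<lambda>n. of_real ((1 - (norm x)\<^sup>2) powr \<gamma>) * F (s n) x) \<longlonglongrightarrow> l"
      using s(2)[OF x] by blast
    have "(1 - (norm x)\<^sup>2) powr \<gamma> \<noteq> 0"
      using S(2) x one_minus_norm_square_pos[of x] by auto
    then have "(\<lambda>n. F (s n) x) \<longlonglongrightarrow> l / of_real ((1 - (norm x)\<^sup>2) powr \<gamma>)"
      using tendsto_divide[OF l tendsto_const[of "of_real ((1 - (norm x)\<^sup>2) powr \<gamma>)"]] by simp
    then show ?thesis by (rule convergentI)
  qed
  have "convergent (\<lambda>k. F (s k) z)" if z: "z \<in> ball 0 1" for z
  proof (rule convergent_if_approximable)
    fix e :: real assume e: "0 < e"
    obtain r C where r: "0 < r" and C: "0 \<le> C"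
      and rC: "\<And>f d. holomorphic_sv f (ball 0 1) \<Longrightarrow> weighted_bound \<gamma> M f \<Longrightarrow> norm d \<le> r \<Longrightarrow>
      norm (f (z + d) - f z) \<le> C * norm d"
      using local_increment_bounds[OF z \<gamma> M] by metis
    have "0 < min r (e / (C + 1))" using r e C by simp
    moreover have "z \<in> closure S" using S z by blast
    ultimately obtain x where x: "x \<in> S" "dist x z < min r (e / (C + 1))"
      by (meson closure_approachable)
    have "norm (F (s k) z - F (s k) x) \<le> e" for k
    proof -
      have "norm (F (s k) (z + (x - z)) - F (s k) z) \<le> C * norm (x - z)"
        using x F by (intro rC) (auto simp: dist_norm)
      also have "\<dots> \<le> (C + 1) * (e / (C + 1))"
        using x C e by (intro mult_mono) (auto simp: dist_norm)
      finally show ?thesis using C by (simp add: norm_minus_commute)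
    qed
    then show "\<exists>c. convergent c \<and> (\<forall>k. norm (F (s k) z - c k) \<le> e)"
      using conv[OF x(1)] by blast
  qed
  then have "\<And>z. z \<in> ball 0 1 \<Longrightarrow> (\<lambda>k. F (s k) z) \<longlonglongrightarrow> lim (\<lambda>k. F (s k) z)"
    using convergent_LIMSEQ_iff by blast
  then show ?thesis by (rule that[OF s(1)])
qed

lemma tendsto_0_along_interior_points:
  fixes F :: "nat \<Rightarrow> complex ^ 'n \<Rightarrow> complex"
  assumes F: "\<And>k. holomorphic_sv (F k) (ball 0 1)" "\<And>k. weighted_bound \<gamma> M (F k)"
    and \<gamma>: "0 < \<gamma>" and M: "0 \<le> M"
    and lim: "\<And>z. z \<in> ball 0 1 \<Longrightarrow> (\<lambda>k. F k z) \<longlonglongrightarrow> 0"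
    and z: "z \<longlonglongrightarrow> p" "p \<in> ball 0 1"
  shows "(\<lambda>k. F k (z k)) \<longlonglongrightarrow> 0"
proof -
  obtain r C where r: "0 < r" and C: "0 \<le> C"
    and rC: "\<And>f d. holomorphic_sv f (ball 0 1) \<Longrightarrow> weighted_bound \<gamma> M f \<Longrightarrow> norm d \<le> r \<Longrightarrow>
      norm (f (p + d) - f p) \<le> C * norm d"
    using local_increment_bounds[OF z(2) \<gamma> M] by metis
  have d: "(\<lambda>k. norm (z k - p)) \<longlonglongrightarrow> 0"
    using z(1) by (simp add: LIM_zero tendsto_norm_zero)
  have "\<forall>\<^sub>F k in sequentially. norm (z k - p) < r"
    using order_tendstoD(2)[OF d r] .
  then have "\<forall>\<^sub>F k in sequentially. norm (F k (z k)) \<le> norm (F k p) + C * norm (z k - p)"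
  proof eventually_elim
    case (elim k)
    have "norm (F k (p + (z k - p)) - F k p) \<le> C * norm (z k - p)"
      using elim F by (intro rC) auto
    then show ?case using norm_triangle_ineq2[of "F k (z k)" "F k p"] by simp
  qed
  moreover have "(\<lambda>k. norm (F k p) + C * norm (z k - p)) \<longlonglongrightarrow> 0 + C * 0"
    by (intro tendsto_intros d tendsto_norm_zero lim z(2))
  ultimately show ?thesis
    by (auto intro: Lim_null_comparison)
qed

section \<open>The pseudohyperbolic distance and kernel tests\<close>

text \<open>The right-hand side measures the displacement \<open>q - p\<close> in its component along \<open>p\<close> and in full length,
the latter with the smaller weight. It shows which quantities have to be small compared with
\<open>1 - <q,p>\<close> for \<open>p\<close> and \<open>q\<close> to be close in the pseudohyperbolic distance.\<close>

lemma norm_one_minus_hinner_square: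
  "(norm (1 - hinner q p))\<^sup>2 - (1 - (norm p)\<^sup>2) * (1 - (norm q)\<^sup>2) =
    (norm (hinner (q - p) p))\<^sup>2 + (1 - (norm p)\<^sup>2) * (norm (q - p))\<^sup>2"
proof -
  have d: "(norm (q - p))\<^sup>2 = (norm q)\<^sup>2 - 2 * Re (hinner q p) + (norm p)\<^sup>2"
    using norm_add_square[of "q - p" p]
    by (simp add: hinner_diff_left norm_square_eq[of p])
  have h: "(norm (1 - h))\<^sup>2 = 1 - 2 * Re h + (norm h)\<^sup>2"
    "(norm (h - of_real c))\<^sup>2 = (norm h)\<^sup>2 - 2 * c * Re h + c\<^sup>2" for h :: complex and c :: real
    unfolding cmod_power2 by (simp_all add: power2_eq_square algebra_simps)
  show ?thesis
    unfolding hinner_diff_left hinner_self h d by (simp add: algebra_simps power2_eq_square)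
qed

lemma norm_one_minus_hinner_pos:
  assumes "p \<in> ball 0 1" "q \<in> ball 0 1"
  shows "0 < norm (1 - hinner q p)"
proof -
  have "norm (hinner q p) \<le> norm q * norm p" by (rule norm_hinner_le)
  also have "\<dots> \<le> norm p" using assms by (simp add: mult_left_le_one_le)
  also have "\<dots> < 1" using assms by simp
  finally show ?thesis by auto
qed

text \<open>This is the squared norm of \<open>ball_aut p q\<close>, the pseudohyperbolic distance of \<open>p\<close> and \<open>q\<close> squared.\<close>

definition pseudo_dist_sq :: "complex ^ 'n \<Rightarrow> complex ^ 'n \<Rightarrow> real"
  where "pseudo_dist_sq p q =
    1 - (1 - (norm p)\<^sup>2) * (1 - (norm q)\<^sup>2) / (norm (1 - hinner q p))\<^sup>2"

lemma norm_one_minus_hinner_commute: "norm (1 - hinner q p) = norm (1 - hinner p q)"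
proof -
  have "1 - hinner q p = cnj (1 - hinner p q)"
    by (subst hinner_commute) simp
  then show ?thesis by (simp only: complex_mod_cnj)
qed

lemma pseudo_dist_sq_commute: "pseudo_dist_sq p q = pseudo_dist_sq q p"
  by (simp add: pseudo_dist_sq_def norm_one_minus_hinner_commute[of q p] mult.commute)

lemma pseudo_dist_sq_eq:
  assumes "p \<in> ball 0 1" "q \<in> ball 0 1"
  shows "pseudo_dist_sq p q =
    (norm (hinner (q - p) p) / norm (1 - hinner q p))\<^sup>2 +
    (sqrt (1 - (norm p)\<^sup>2) * norm (q - p) / norm (1 - hinner q p))\<^sup>2"
proof -
  have D: "norm (1 - hinner q p) \<noteq> 0" using norm_one_minus_hinner_pos[OF assms] by simp
  have A: "0 \<le> 1 - (norm p)\<^sup>2" using one_minus_norm_square_pos[OF assms(1)] by simp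
  have "pseudo_dist_sq p q = ((norm (1 - hinner q p))\<^sup>2 - (1 - (norm p)\<^sup>2) * (1 - (norm q)\<^sup>2))
     / (norm (1 - hinner q p))\<^sup>2"
    using D by (simp add: pseudo_dist_sq_def diff_divide_distrib)
  also have "\<dots> = ((norm (hinner (q - p) p))\<^sup>2 + (1 - (norm p)\<^sup>2) * (norm (q - p))\<^sup>2) / (norm (1 - hinner q p))\<^sup>2"
    by (simp only: norm_one_minus_hinner_square)
  finally show ?thesis
    using A by (simp add: power_divide power_mult_distrib add_divide_distrib)
qed

lemma pseudo_dist_sq_bounds:
  assumes "p \<in> ball 0 1" "q \<in> ball 0 1"
  shows "0 \<le> pseudo_dist_sq p q" "pseudo_dist_sq p q \<le> 1"
proof -
  show "0 \<le> pseudo_dist_sq p q" unfolding pseudo_dist_sq_eq[OF assms] by simp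
  have "0 \<le> (1 - (norm p)\<^sup>2) * (1 - (norm q)\<^sup>2)"
    using assms[THEN one_minus_norm_square_pos] by simp
  then show "pseudo_dist_sq p q \<le> 1"
    unfolding pseudo_dist_sq_def by simp
qed

text \<open>The kernel at the point \<open>w = p\<close> itself, for which \<open>1 - <p,w>\<close> is the real number \<open>1 - |p|^2\<close>. Only the unit
vector \<open>\<eta>\<close> in the direction of \<open>p\<close> enters, and \<open>|p|\<close> plays the part of \<open>x\<close> in the power series bound.\<close>

lemma kernel_test:
  fixes \<kappa> :: real
  assumes "\<kappa> \<le> real n"
  obtains C where "0 \<le> C"
    "\<And>(p :: complex ^ 'n) q u v e M. p \<in> ball 0 1 \<Longrightarrow> 1 / 2 \<le> norm p \<Longrightarrow> q \<in> ball 0 1 \<Longrightarrow>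
      (\<And>j. 0 \<le> e j) \<Longrightarrow> (\<And>j. e j \<le> M) \<Longrightarrow>
      (\<And>\<eta> j. norm \<eta> = 1 \<Longrightarrow> p = of_real (norm p) *s \<eta> \<Longrightarrow> norm (u * hinner p \<eta> ^ j - v * hinner q \<eta> ^ j) \<le> e j * real (Suc j) powr - \<kappa>) \<Longrightarrow>
      (1 - (norm p)\<^sup>2) powr (real n - \<kappa> + 1) *
        norm (u / of_real (1 - (norm p)\<^sup>2) ^ Suc n - v / (1 - hinner q p) ^ Suc n)
        \<le> C * abel_mean e (sqrt (norm p))"
proof -
  obtain C where C: "0 \<le> C" and C':
    "\<And>x (P :: complex) Q u v e M. 0 < x \<Longrightarrow> x < 1 \<Longrightarrow> norm P < 1 \<Longrightarrow> norm Q < 1 \<Longrightarrow>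
      (\<And>j. 0 \<le> e j) \<Longrightarrow> (\<And>j. e j \<le> M) \<Longrightarrow>
      (\<And>j. norm (u * P ^ j - v * Q ^ j) \<le> e j * x ^ j * real (Suc j) powr - \<kappa>) \<Longrightarrow>
      (1 - x\<^sup>2) powr (real n - \<kappa> + 1) * norm (u / (1 - P) ^ Suc n - v / (1 - Q) ^ Suc n)
        \<le> C * abel_mean e (sqrt x)"
    using kernel_difference_bound[OF assms] by metis
  have "(1 - (norm p)\<^sup>2) powr (real n - \<kappa> + 1) *
        norm (u / of_real (1 - (norm p)\<^sup>2) ^ Suc n - v / (1 - hinner q p) ^ Suc n)
        \<le> C * abel_mean e (sqrt (norm p))"
    if p: "p \<in> ball 0 1" "1 / 2 \<le> norm p" and q: "q \<in> ball 0 1" and e: "\<And>j. 0 \<le> e j" "\<And>j. e j \<le> M"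
      and H: "\<And>\<eta> j. norm \<eta> = 1 \<Longrightarrow> p = of_real (norm p) *s \<eta> \<Longrightarrow>
        norm (u * hinner p \<eta> ^ j - v * hinner q \<eta> ^ j) \<le> e j * real (Suc j) powr - \<kappa>"
    for p q :: "complex ^ 'n" and u v e M
  proof -
    define x where "x = norm p"
    have x: "0 < x" "x < 1" using p by (auto simp: x_def)
    define \<eta> where "\<eta> = (1 / of_real x) *s p"
    have \<eta>: "norm \<eta> = 1" "p = of_real (norm p) *s \<eta>"
      using x unfolding \<eta>_def by (simp_all add: norm_complex_scale norm_divide x_def vec_eq_iff)
    have h: "hinner z p = of_real x * hinner z \<eta>" for z
      using x by (simp add: \<eta>_def hinner_scale_right)
    have "norm (hinner q p) \<le> norm q * norm p" by (rule norm_hinner_le)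
    also have "\<dots> \<le> norm q * 1" using p by (intro mult_left_mono) auto
    also have "\<dots> < 1" using q by simp
    finally have Q: "norm (hinner q p) < 1" .
    have uv: "norm (u * hinner p p ^ j - v * hinner q p ^ j) \<le> e j * x ^ j * real (Suc j) powr - \<kappa>" for j
    proof -
      have "u * hinner p p ^ j - v * hinner q p ^ j = of_real (x ^ j) * (u * hinner p \<eta> ^ j - v * hinner q \<eta> ^ j)"
        unfolding h by (simp add: power_mult_distrib algebra_simps)
      then have "norm (u * hinner p p ^ j - v * hinner q p ^ j) = x ^ j * norm (u * hinner p \<eta> ^ j - v * hinner q \<eta> ^ j)"
        using x by (simp add: norm_mult norm_power)
      also have "\<dots> \<le> x ^ j * (e j * real (Suc j) powr - \<kappa>)"
        using x by (intro mult_left_mono H \<eta>) auto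
      finally show ?thesis by (simp add: mult_ac)
    qed
    have P: "norm (hinner p p) < 1"
      using x by (simp add: hinner_self norm_power x_def power_less_one_iff)
    have "(1 - x\<^sup>2) powr (real n - \<kappa> + 1) * norm (u / (1 - hinner p p) ^ Suc n - v / (1 - hinner q p) ^ Suc n)
        \<le> C * abel_mean e (sqrt x)"
      by (rule C'[OF x P Q e uv])
    then show ?thesis by (simp add: x_def hinner_self)
  qed
  then show ?thesis using that C by blast
qed

text \<open>The hypothesis on powers of linear forms at a single pair of points: \<open>u\<close> and \<open>v\<close> are numbers, the
weights at some point of the ball, and \<open>p\<close> and \<open>q\<close> are the images of that point. The powers of \<open>j\<close> are
the orders of the norms of the test functions.\<close>

definition power_tests ::
    "real \<Rightarrow> (nat \<Rightarrow> real) \<Rightarrow> complex ^ 'n \<Rightarrow> complex ^ 'n \<Rightarrow> complex \<Rightarrow> complex \<Rightarrow> bool"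
  where "power_tests \<alpha> e p q u v \<longleftrightarrow>
    (\<forall>\<eta> j. norm \<eta> = 1 \<longrightarrow>
      norm (u * hinner p \<eta> ^ j - v * hinner q \<eta> ^ j) \<le> e j * real (Suc j) powr - \<alpha>) \<and>
    (\<forall>\<eta> \<eta>' j. norm \<eta> = 1 \<longrightarrow> norm \<eta>' = 1 \<longrightarrow> hinner \<eta> \<eta>' = 0 \<longrightarrow>
      norm (u * hinner p \<eta> ^ j * hinner p \<eta>' - v * hinner q \<eta> ^ j * hinner q \<eta>')
        \<le> e j * real (Suc j) powr - (\<alpha> + 1 / 2))"

lemma power_tests_commute: "power_tests \<alpha> e p q u v \<longleftrightarrow> power_tests \<alpha> e q p v u"
  by (simp add: power_tests_def norm_minus_commute)

text \<open>The first bound is the kernel test with exponent \<open>n + 1\<close>. Comparing it with the test with exponent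
\<open>n + 2\<close> eliminates \<open>u\<close> and leaves a bound for \<open>v\<close> times \<open><q - p,p>\<close>. The test with a factor \<open><z,\<eta>'>\<close>, where
\<open>\<eta>'\<close> is orthogonal to \<open>p\<close>, does not see \<open>u\<close> at all and gives a bound for \<open>v\<close> times the part of \<open>q\<close>
orthogonal to \<open>p\<close>. These two components of \<open>q - p\<close> make up the pseudohyperbolic distance.\<close>

lemma kernel_test_pair:
  fixes \<alpha> :: real
  assumes "0 < \<alpha>" "\<alpha> \<le> real n"
  obtains C where "0 \<le> C"
    "\<And>(p :: complex ^ 'n) q u v e M. p \<in> ball 0 1 \<Longrightarrow> 1 / 2 \<le> norm p \<Longrightarrow> q \<in> ball 0 1 \<Longrightarrow>
      (\<And>j. 0 \<le> e j) \<Longrightarrow> (\<And>j. e j \<le> M) \<Longrightarrow>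
      power_tests \<alpha> e p q u v \<Longrightarrow>
      (1 - (norm p)\<^sup>2) powr (real (Suc n) - \<alpha>) *
        norm (u / of_real (1 - (norm p)\<^sup>2) ^ Suc n - v / (1 - hinner q p) ^ Suc n)
        \<le> C * abel_mean e (sqrt (norm p)) \<and>
      (1 - (norm p)\<^sup>2) powr (real (Suc n) - \<alpha>) * norm (v / (1 - hinner q p) ^ Suc n) * pseudo_dist_sq p q
        \<le> C * abel_mean e (sqrt (norm p))"
proof -
  have le: "\<alpha> \<le> real n" "\<alpha> \<le> real (Suc n)" "\<alpha> + 1 / 2 \<le> real (Suc n)" using assms by auto
  note T = kernel_test[where ?'n = 'n]
  obtain C1 where C1: "0 \<le> C1" and T1:
    "\<And>(p :: complex ^ 'n) q u v e M. p \<in> ball 0 1 \<Longrightarrow> 1 / 2 \<le> norm p \<Longrightarrow> q \<in> ball 0 1 \<Longrightarrow>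
      (\<And>j. 0 \<le> e j) \<Longrightarrow> (\<And>j. e j \<le> M) \<Longrightarrow>
      (\<And>\<eta> j. norm \<eta> = 1 \<Longrightarrow> p = of_real (norm p) *s \<eta> \<Longrightarrow> norm (u * hinner p \<eta> ^ j - v * hinner q \<eta> ^ j) \<le> e j * real (Suc j) powr - \<alpha>) \<Longrightarrow>
      (1 - (norm p)\<^sup>2) powr (real n - \<alpha> + 1) *
        norm (u / of_real (1 - (norm p)\<^sup>2) ^ Suc n - v / (1 - hinner q p) ^ Suc n)
        \<le> C1 * abel_mean e (sqrt (norm p))"
    using T[OF le(1)] by blast
  obtain C2 where C2: "0 \<le> C2" and T2:
    "\<And>(p :: complex ^ 'n) q u v e M. p \<in> ball 0 1 \<Longrightarrow> 1 / 2 \<le> norm p \<Longrightarrow> q \<in> ball 0 1 \<Longrightarrow>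
      (\<And>j. 0 \<le> e j) \<Longrightarrow> (\<And>j. e j \<le> M) \<Longrightarrow>
      (\<And>\<eta> j. norm \<eta> = 1 \<Longrightarrow> p = of_real (norm p) *s \<eta> \<Longrightarrow> norm (u * hinner p \<eta> ^ j - v * hinner q \<eta> ^ j) \<le> e j * real (Suc j) powr - \<alpha>) \<Longrightarrow>
      (1 - (norm p)\<^sup>2) powr (real (Suc n) - \<alpha> + 1) *
        norm (u / of_real (1 - (norm p)\<^sup>2) ^ Suc (Suc n) - v / (1 - hinner q p) ^ Suc (Suc n))
        \<le> C2 * abel_mean e (sqrt (norm p))"
    using T[OF le(2)] by blast
  obtain C3 where C3: "0 \<le> C3" and T3:
    "\<And>(p :: complex ^ 'n) q u v e M. p \<in> ball 0 1 \<Longrightarrow> 1 / 2 \<le> norm p \<Longrightarrow> q \<in> ball 0 1 \<Longrightarrow>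
      (\<And>j. 0 \<le> e j) \<Longrightarrow> (\<And>j. e j \<le> M) \<Longrightarrow>
      (\<And>\<eta> j. norm \<eta> = 1 \<Longrightarrow> p = of_real (norm p) *s \<eta> \<Longrightarrow> norm (u * hinner p \<eta> ^ j - v * hinner q \<eta> ^ j) \<le> e j * real (Suc j) powr - (\<alpha> + 1 / 2)) \<Longrightarrow>
      (1 - (norm p)\<^sup>2) powr (real (Suc n) - (\<alpha> + 1 / 2) + 1) *
        norm (u / of_real (1 - (norm p)\<^sup>2) ^ Suc (Suc n) - v / (1 - hinner q p) ^ Suc (Suc n))
        \<le> C3 * abel_mean e (sqrt (norm p))"
    using T[OF le(3)] by blast
  define C where "C = 3 * (C1 + C2) + C3"
  have "(1 - (norm p)\<^sup>2) powr (real (Suc n) - \<alpha>) *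
        norm (u / of_real (1 - (norm p)\<^sup>2) ^ Suc n - v / (1 - hinner q p) ^ Suc n)
        \<le> C * abel_mean e (sqrt (norm p)) \<and>
      (1 - (norm p)\<^sup>2) powr (real (Suc n) - \<alpha>) * norm (v / (1 - hinner q p) ^ Suc n) * pseudo_dist_sq p q
        \<le> C * abel_mean e (sqrt (norm p))"
    if p: "p \<in> ball 0 1" "1 / 2 \<le> norm p" and q: "q \<in> ball 0 1" and e: "\<And>j. 0 \<le> e j" "\<And>j. e j \<le> M"
      and H: "power_tests \<alpha> e p q u v"
    for p q :: "complex ^ 'n" and u v e M
  proof -
    have H1: "norm (u * hinner p \<eta> ^ j - v * hinner q \<eta> ^ j) \<le> e j * real (Suc j) powr - \<alpha>"
      if "norm \<eta> = 1" for \<eta> j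
      using H that unfolding power_tests_def by blast
    have H2: "norm (u * hinner p \<eta> ^ j * hinner p \<eta>' - v * hinner q \<eta> ^ j * hinner q \<eta>')
          \<le> e j * real (Suc j) powr - (\<alpha> + 1 / 2)"
      if "norm \<eta> = 1" "norm \<eta>' = 1" "hinner \<eta> \<eta>' = 0" for \<eta> \<eta>' j
      using H that unfolding power_tests_def by blast
    define S where "S = abel_mean e (sqrt (norm p))"
    define A where "A = 1 - (norm p)\<^sup>2"
    define D where "D = 1 - hinner q p"
    define b where "b = real (Suc n) - \<alpha>"
    define m where "m = norm (hinner (q - p) p) / norm D"
    define l where "l = sqrt A * norm (q - p) / norm D"
    \<comment> \<open>\<open>m\<close> and \<open>l\<close> are the two components of the distance, and \<open>w\<close> is the part of \<open>q\<close> orthogonal to \<open>p\<close>.\<close>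
    define w where "w = q - (hinner q p / of_real ((norm p)\<^sup>2)) *s p"
    have A: "0 < A" "A \<le> 1" using one_minus_norm_square_pos[OF p(1)] by (auto simp: A_def)
    have D: "0 < norm D" "D \<noteq> 0" using norm_one_minus_hinner_pos[OF p(1) q] by (auto simp: D_def)
    have p0: "norm p \<noteq> 0" using p by auto
    have S: "0 \<le> S"
      unfolding S_def abel_mean_def using p e 
      by (intro mult_nonneg_nonneg suminf_nonneg summable_bounded_times_power[where M = M]) auto
    have powA: "A powr (b + 1) = A powr b * A" "A powr (b + 1 / 2) = A powr b * sqrt A"
      using A by (simp_all add: powr_add powr_half_sqrt)
    have t1: "A powr b * norm (u / of_real A ^ Suc n - v / D ^ Suc n) \<le> C1 * S"
      using T1[OF p q e H1] by (simp add: A_def D_def b_def S_def algebra_simps)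
    have t2: "A powr (b + 1) * norm (u / of_real A ^ Suc (Suc n) - v / D ^ Suc (Suc n)) \<le> C2 * S"
      using T2[OF p q e H1] by (simp add: A_def D_def b_def S_def del: of_nat_Suc power_Suc)
    have t2': "A powr b * norm (u / of_real A ^ Suc n - of_real A * v / D ^ Suc (Suc n)) \<le> C2 * S"
    proof -
      have "u / of_real A ^ Suc n - of_real A * v / D ^ Suc (Suc n) =
          of_real A * (u / of_real A ^ Suc (Suc n) - v / D ^ Suc (Suc n))"
        using A by (simp add: right_diff_distrib)
      then show ?thesis using t2 A by (simp add: powA norm_mult mult_ac del: power_Suc)
    qed
    have t3: "A powr (b + 1 / 2) * norm (v * of_real (norm w) / D ^ Suc (Suc n)) \<le> C3 * S"
    proof (cases "w = 0")
      case False
      define \<eta>' where "\<eta>' = (1 / of_real (norm w)) *s w"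
      have \<eta>': "norm \<eta>' = 1" using False by (simp add: \<eta>'_def norm_complex_scale norm_divide)
      have pw: "hinner p w = 0" "hinner w p = 0"
      proof -
        show "hinner w p = 0"
          using p0 unfolding w_def hinner_diff_left hinner_scale_left hinner_self by simp
        then show "hinner p w = 0" by (subst hinner_commute) simp
      qed
      have qw: "hinner q w = of_real ((norm w)\<^sup>2)"
      proof -
        have "hinner w w = hinner q w - (hinner q p / of_real ((norm p)\<^sup>2)) * hinner p w"
          by (subst (1) w_def) (simp only: hinner_diff_left hinner_scale_left)
        then show ?thesis using pw by (simp add: hinner_self)
      qed
      have q': "hinner q \<eta>' = of_real (norm w)" "hinner p \<eta>' = 0"
        using False by (simp_all add: \<eta>'_def hinner_scale_right qw pw power2_eq_square)
      have "norm (0 * hinner p \<eta> ^ j - (v * of_real (norm w)) * hinner q \<eta> ^ j)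
          \<le> e j * real (Suc j) powr - (\<alpha> + 1 / 2)"
        if \<eta>: "norm \<eta> = 1" "p = of_real (norm p) *s \<eta>" for \<eta> j
      proof -
        have "hinner p \<eta>' = of_real (norm p) * hinner \<eta> \<eta>'"
          by (subst \<eta>(2)) (rule hinner_scale_left)
        then have "hinner \<eta> \<eta>' = 0" using q' p0 by auto
        from H2[OF \<eta>(1) \<eta>' this, of j] show ?thesis
          by (simp add: q' mult_ac)
      qed
      from T3[OF p q e this]
      show ?thesis
        by (simp add: A_def D_def b_def S_def add.commute norm_mult norm_divide del: power_Suc)
    qed (use S C3 in simp)
    let ?K = "A powr b * norm (v / D ^ Suc n)"
    have m: "?K * m \<le> (C1 + C2) * S"
    proof -
      have "hinner (q - p) p = of_real A - D"
        unfolding hinner_diff_left hinner_self A_def D_def by simp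
      then have "?K * m = A powr b * norm (v / D ^ Suc n * ((of_real A - D) / D))"
        by (simp add: m_def norm_mult norm_divide)
      also have "v / D ^ Suc n * ((of_real A - D) / D) =
          (u / of_real A ^ Suc n - v / D ^ Suc n) - (u / of_real A ^ Suc n - of_real A * v / D ^ Suc (Suc n))"
        using D by (simp add: field_simps)
      also have "A powr b * norm \<dots> \<le> A powr b * (norm (u / of_real A ^ Suc n - v / D ^ Suc n)
          + norm (u / of_real A ^ Suc n - of_real A * v / D ^ Suc (Suc n)))"
        by (intro mult_left_mono norm_triangle_ineq4) auto
      also have "\<dots> \<le> C1 * S + C2 * S"
        using t1 t2' by (simp add: distrib_left del: power_Suc)
      finally show ?thesis by (simp add: algebra_simps)
    qed
    have w: "?K * (sqrt A * norm w / norm D) \<le> C3 * S"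
      using t3 by (simp add: powA norm_mult norm_divide mult_ac)
    have l: "l \<le> 2 * m + sqrt A * norm w / norm D"
    proof -
      have "q - p = (hinner (q - p) p / of_real ((norm p)\<^sup>2)) *s p + w"
        using p0 by (simp add: w_def hinner_diff_left hinner_self diff_divide_distrib vec_eq_iff algebra_simps)
      then have "norm (q - p) \<le> norm (hinner (q - p) p) / norm p + norm w"
        using norm_triangle_ineq[of "(hinner (q - p) p / of_real ((norm p)\<^sup>2)) *s p" w] p0
        by (simp add: norm_complex_scale norm_divide norm_mult power2_eq_square)
      also have "norm (hinner (q - p) p) / norm p \<le> 2 * norm (hinner (q - p) p)"
        using p0 p mult_right_mono[OF p(2), of "norm (hinner (q - p) p)"] by (simp add: field_simps)
      finally have "sqrt A * norm (q - p) \<le> sqrt A * (2 * norm (hinner (q - p) p) + norm w)"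
        using A by (intro mult_left_mono) auto
      also have "\<dots> \<le> 2 * norm (hinner (q - p) p) + sqrt A * norm w"
        using A mult_right_mono[of "sqrt A" 1 "2 * norm (hinner (q - p) p)"] by (simp add: distrib_left)
      finally show ?thesis
        using D by (simp add: l_def m_def divide_simps)
    qed
    have rho: "pseudo_dist_sq p q = m\<^sup>2 + l\<^sup>2"
      unfolding m_def l_def A_def D_def by (rule pseudo_dist_sq_eq[OF p(1) q])
    have "m \<ge> 0" "l \<ge> 0" using A by (auto simp: m_def l_def)
    moreover have "m\<^sup>2 \<le> 1" "l\<^sup>2 \<le> 1"
      using rho pseudo_dist_sq_bounds(2)[OF p(1) q] zero_le_power2[of m] zero_le_power2[of l] by linarith+
    ultimately have "m\<^sup>2 \<le> m" "l\<^sup>2 \<le> l"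
      by (simp_all add: power2_eq_square abs_square_le_1[unfolded power2_eq_square] mult_left_le)
    then have rho_le: "pseudo_dist_sq p q \<le> 3 * m + sqrt A * norm w / norm D"
      using rho l by linarith
    have "?K * pseudo_dist_sq p q \<le> ?K * (3 * m + sqrt A * norm w / norm D)"
      using rho_le by (intro mult_left_mono) auto
    also have "\<dots> = 3 * (?K * m) + ?K * (sqrt A * norm w / norm D)"
      by (simp only: distrib_left mult_ac)
    also have "\<dots> \<le> C * S"
      using m w by (simp add: C_def distrib_right)
    finally have 2: "?K * pseudo_dist_sq p q \<le> C * S" .
    have "C1 * S \<le> C * S" using C1 C2 C3 S by (intro mult_right_mono) (auto simp: C_def)
    with t1 have "A powr b * norm (u / of_real A ^ Suc n - v / D ^ Suc n) \<le> C * S" by linarith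
    with 2 show ?thesis by (simp only: A_def D_def b_def S_def)
  qed
  moreover have "0 \<le> C" using C1 C2 C3 by (simp add: C_def)
  ultimately show ?thesis using that by blast
qed

section \<open>Two-point expressions along sequences\<close>

text \<open>If the displacement \<open>d\<close> has size \<open>t\<close> relative to \<open>1 - |p|^2\<close>, then \<open>p + c d\<close> stays in the ball, with
\<open>1 - |p + c d|^2\<close> at least a quarter of \<open>1 - |p|^2\<close>, for all \<open>|c| < 1 / (4 t)\<close>. On this large disc \<open>f\<close> is
bounded by a multiple of \<open>M (1 - |p|^2)^(-\<alpha>)\<close>.\<close>

lemma hyperbolic_lipschitz:
  fixes p d :: "complex ^ 'n"
  assumes f: "holomorphic_sv f (ball 0 1)" "weighted_bound \<alpha> M f" and \<alpha>: "0 < \<alpha>" and M: "0 \<le> M"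
    and p: "p \<in> ball 0 1" and A: "A = 1 - (norm p)\<^sup>2"
    and t: "norm (hinner d p) / A + norm d / sqrt A \<le> t" "t \<le> 1 / 8"
  shows "A powr \<alpha> * norm (f (p + d) - f p) \<le> 16 * 4 powr \<alpha> * M * t"
proof (cases "d = 0")
  case True
  then show ?thesis using M t by simp
next
  case False
  have A0: "0 < A" using one_minus_norm_square_pos[OF p] by (simp add: A)
  have t0: "0 < t"
  proof -
    have "0 < norm d / sqrt A" using False A0 by simp
    moreover have "0 \<le> norm (hinner d p) / A" using A0 by simp
    ultimately show ?thesis using t(1) by linarith
  qed
  have nonneg: "0 \<le> norm d / sqrt A" "0 \<le> norm (hinner d p) / A" using A0 by simp_all
  then have "norm (hinner d p) / A \<le> t"
    using t(1) by linarith
  then have d1: "norm (hinner d p) \<le> t * A" using A0 by (simp add: field_simps)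
  have "norm d / sqrt A \<le> t"
    using t(1) nonneg by linarith
  then have "norm d \<le> t * sqrt A" using A0 by (simp add: field_simps)
  then have "(norm d)\<^sup>2 \<le> (t * sqrt A)\<^sup>2" by (intro power_mono) auto
  then have d2: "(norm d)\<^sup>2 \<le> t\<^sup>2 * A" using A0 by (simp add: power_mult_distrib)
  define L where "L = M / (A / 4) powr \<alpha>"
  have disc: "p + c *s d \<in> ball 0 1 \<and> norm (f (p + c *s d)) \<le> L" if c: "norm c < 1 / (4 * t)" for c
  proof -
    have ct: "norm c * t \<le> 1 / 4" using c t0 by (simp add: field_simps)
    have "Re (hinner p (c *s d)) \<le> norm c * norm (hinner d p)"
    proof -
      have "Re (hinner p (c *s d)) \<le> norm (hinner p (c *s d))" by (rule complex_Re_le_cmod)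
      also have "\<dots> = norm c * norm (hinner d p)"
        by (subst hinner_commute) (simp add: hinner_scale_left norm_mult)
      finally show ?thesis .
    qed
    also have "\<dots> \<le> norm c * (t * A)" using d1 by (intro mult_left_mono) auto
    also have "\<dots> = (norm c * t) * A" by simp
    also have "\<dots> \<le> 1 / 4 * A" using ct A0 by (intro mult_right_mono) auto
    finally have 1: "Re (hinner p (c *s d)) \<le> 1 / 4 * A" .
    have "(norm (c *s d))\<^sup>2 \<le> (norm c)\<^sup>2 * (t\<^sup>2 * A)"
      unfolding norm_complex_scale power_mult_distrib using d2 by (intro mult_left_mono) auto
    also have "\<dots> = (norm c * t)\<^sup>2 * A" by (simp add: power_mult_distrib)
    also have "\<dots> \<le> (1 / 4)\<^sup>2 * A" using ct A0 t0 by (intro mult_right_mono power_mono) auto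
    finally have 2: "(norm (c *s d))\<^sup>2 \<le> 1 / 16 * A" by (simp add: power2_eq_square)
    have A4: "A / 4 \<le> 1 - (norm (p + c *s d))\<^sup>2"
      using 1 2 A A0 by (simp add: norm_add_square)
    then have "(norm (p + c *s d))\<^sup>2 < 1" using A0 by linarith
    then have ball: "p + c *s d \<in> ball 0 1" by (simp add: abs_square_less_1)
    have "(A / 4) powr \<alpha> * norm (f (p + c *s d)) \<le> (1 - (norm (p + c *s d))\<^sup>2) powr \<alpha> * norm (f (p + c *s d))"
      using A4 A0 \<alpha> by (intro mult_right_mono powr_mono2) auto
    also have "\<dots> \<le> M" using f(2) ball unfolding weighted_bound_def by blast
    finally have "norm (f (p + c *s d)) \<le> L" using A0 by (simp add: L_def field_simps)
    with ball show ?thesis by blast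
  qed
  have "norm (f (p + d) - f p) \<le> 4 * L / (1 / (4 * t))"
    by (rule line_increment_bounds(1)[OF f(1)]) (use disc t t0 in \<open>auto simp: field_simps\<close>)
  then have "A powr \<alpha> * norm (f (p + d) - f p) \<le> A powr \<alpha> * (16 * L * t)"
    by (intro mult_left_mono) auto
  also have "\<dots> = 16 * 4 powr \<alpha> * M * t"
    using A0 by (simp add: L_def powr_divide)
  finally show ?thesis .
qed

context
  fixes \<alpha> M K :: real and u v :: "nat \<Rightarrow> complex" and p q :: "nat \<Rightarrow> complex ^ 'n"
    and F :: "nat \<Rightarrow> complex ^ 'n \<Rightarrow> complex" and e :: "nat \<Rightarrow> real"
  assumes \<alpha>: "0 < \<alpha>" and M: "0 \<le> M"
    and F: "\<And>k. holomorphic_sv (F k) (ball 0 1)" "\<And>k. weighted_bound \<alpha> M (F k)"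
    and F0: "\<And>z. z \<in> ball 0 1 \<Longrightarrow> (\<lambda>k. F k z) \<longlonglongrightarrow> 0"
    and e: "\<And>j. 0 \<le> e j" "e \<longlonglongrightarrow> 0"
begin

text \<open>The bounds of the kernel tests are Abel means of a null sequence, so they tend to 0 when \<open>|p k|\<close> tends
to 1.\<close>

lemma tests_tendsto_0:
  assumes p: "\<And>k. p k \<in> ball 0 1" and q: "\<And>k. q k \<in> ball 0 1"
    and H: "\<And>k. power_tests \<alpha> e (p k) (q k) (u k) (v k)"
    and p1: "(\<lambda>k. norm (p k)) \<longlonglongrightarrow> 1" and n: "\<alpha> \<le> real n"
  obtains E where "E \<longlonglongrightarrow> 0"
    "\<forall>\<^sub>F k in sequentially.
      (1 - (norm (p k))\<^sup>2) powr (real (Suc n) - \<alpha>) *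
        norm (u k / of_real (1 - (norm (p k))\<^sup>2) ^ Suc n - v k / (1 - hinner (q k) (p k)) ^ Suc n) \<le> E k \<and>
      (1 - (norm (p k))\<^sup>2) powr (real (Suc n) - \<alpha>) * norm (v k / (1 - hinner (q k) (p k)) ^ Suc n)
        * pseudo_dist_sq (p k) (q k) \<le> E k"
proof -
  obtain B where B: "\<And>j. \<bar>e j\<bar> \<le> B"
    using e(2) by (metis convergent_imp_Bseq Bseq_def convergentI real_norm_def)
  then have B': "\<And>j. e j \<le> B" by (meson abs_le_D1)
  obtain C where C: "0 \<le> C" "\<And>(p :: complex ^ 'n) q u v e M. p \<in> ball 0 1 \<Longrightarrow> 1 / 2 \<le> norm p \<Longrightarrow> q \<in> ball 0 1 \<Longrightarrow>
      (\<And>j. 0 \<le> e j) \<Longrightarrow> (\<And>j. e j \<le> M) \<Longrightarrow>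
      power_tests \<alpha> e p q u v \<Longrightarrow>
      (1 - (norm p)\<^sup>2) powr (real (Suc n) - \<alpha>) *
        norm (u / of_real (1 - (norm p)\<^sup>2) ^ Suc n - v / (1 - hinner q p) ^ Suc n)
        \<le> C * abel_mean e (sqrt (norm p)) \<and>
      (1 - (norm p)\<^sup>2) powr (real (Suc n) - \<alpha>) * norm (v / (1 - hinner q p) ^ Suc n) * pseudo_dist_sq p q
        \<le> C * abel_mean e (sqrt (norm p))"
    using kernel_test_pair[OF \<alpha> n, where ?'n = 'n] by blast
  define E where "E k = C * abel_mean e (sqrt (norm (p k)))" for k
  have "(\<lambda>k. sqrt (norm (p k))) \<longlonglongrightarrow> sqrt 1"
    by (intro tendsto_intros p1)
  then have "(\<lambda>k. abel_mean e (sqrt (norm (p k)))) \<longlonglongrightarrow> 0"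
    using p by (intro abel_mean_tendsto_0 e) auto
  from tendsto_mult[OF tendsto_const[of C] this] have "E \<longlonglongrightarrow> 0"
    by (simp add: E_def[abs_def])
  moreover have "\<forall>\<^sub>F k in sequentially. 1 / 2 < norm (p k)"
    by (rule order_tendstoD(1)[OF p1]) simp
  then have "\<forall>\<^sub>F k in sequentially.
      (1 - (norm (p k))\<^sup>2) powr (real (Suc n) - \<alpha>) *
        norm (u k / of_real (1 - (norm (p k))\<^sup>2) ^ Suc n - v k / (1 - hinner (q k) (p k)) ^ Suc n) \<le> E k \<and>
      (1 - (norm (p k))\<^sup>2) powr (real (Suc n) - \<alpha>) * norm (v k / (1 - hinner (q k) (p k)) ^ Suc n)
        * pseudo_dist_sq (p k) (q k) \<le> E k"
  proof eventually_elim
    case (elim k)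
    show ?case
      unfolding E_def by (rule C(2)[OF p _ q e(1) B' H]) (use elim in auto)
  qed
  ultimately show ?thesis by (rule that)
qed

text \<open>If \<open>p k\<close> converges to an interior point, \<open>F k (p k)\<close> itself tends to 0. Otherwise the pseudohyperbolic
distance is bounded away from 0, so the second kernel test makes the kernel value with the factor \<open>v k\<close>
small, and then the first one does the same for the factor \<open>u k\<close>.\<close>

lemma separated_term_tendsto_0:
  assumes p: "\<And>k. p k \<in> ball 0 1" and q: "\<And>k. q k \<in> ball 0 1"
    and H: "\<And>k. power_tests \<alpha> e (p k) (q k) (u k) (v k)"
    and u: "\<And>k. norm (u k) \<le> K"
    and lim: "p \<longlonglongrightarrow> p'" "(\<lambda>k. pseudo_dist_sq (p k) (q k)) \<longlonglongrightarrow> s" and s: "0 < s \<or> norm p' < 1"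
  shows "(\<lambda>k. u k * F k (p k)) \<longlonglongrightarrow> 0"
proof (cases "norm p' < 1")
  case True
  have "(\<lambda>k. F k (p k)) \<longlonglongrightarrow> 0"
    using True by (intro tendsto_0_along_interior_points[OF F \<alpha> M F0 lim(1)]) auto
  then have lim0: "(\<lambda>k. K * norm (F k (p k))) \<longlonglongrightarrow> 0"
    by (intro tendsto_mult_right_zero tendsto_norm_zero)
  have "\<forall>\<^sub>F k in sequentially. norm (u k * F k (p k)) \<le> K * norm (F k (p k))"
    unfolding norm_mult by (intro always_eventually allI mult_right_mono u norm_ge_zero)
  then show ?thesis by (rule Lim_null_comparison[OF _ lim0])
next
  case False
  have np: "(\<lambda>k. norm (p k)) \<longlonglongrightarrow> norm p'" by (intro tendsto_intros lim)
  have "norm p' \<le> 1"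
    by (rule LIMSEQ_le_const2[OF np]) (use p in \<open>auto intro: less_imp_le\<close>)
  then have p1: "(\<lambda>k. norm (p k)) \<longlonglongrightarrow> 1" using np False by simp
  have s: "0 < s" using s False by simp
  obtain n where n: "\<alpha> \<le> real n" using real_arch_simple by blast
  obtain E where E: "E \<longlonglongrightarrow> 0"
    "\<forall>\<^sub>F k in sequentially.
      (1 - (norm (p k))\<^sup>2) powr (real (Suc n) - \<alpha>) *
        norm (u k / of_real (1 - (norm (p k))\<^sup>2) ^ Suc n - v k / (1 - hinner (q k) (p k)) ^ Suc n) \<le> E k \<and>
      (1 - (norm (p k))\<^sup>2) powr (real (Suc n) - \<alpha>) * norm (v k / (1 - hinner (q k) (p k)) ^ Suc n)
        * pseudo_dist_sq (p k) (q k) \<le> E k"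
    using tests_tendsto_0[OF p q H p1 n] by blast
  have "\<forall>\<^sub>F k in sequentially. s / 2 < pseudo_dist_sq (p k) (q k)"
    by (rule order_tendstoD(1)[OF lim(2)]) (use s in simp)
  with E(2) have "\<forall>\<^sub>F k in sequentially. norm (u k * F k (p k)) \<le> M * (E k + E k / (s / 2))"
  proof eventually_elim
    case (elim k)
    define A where "A = 1 - (norm (p k))\<^sup>2"
    define D where "D = 1 - hinner (q k) (p k)"
    define b where "b = real (Suc n) - \<alpha>"
    have A: "0 < A" using one_minus_norm_square_pos[OF p] by (simp add: A_def)
    have 1: "A powr b * norm (u k / of_real A ^ Suc n - v k / D ^ Suc n) \<le> E k"
      and 2: "A powr b * norm (v k / D ^ Suc n) * pseudo_dist_sq (p k) (q k) \<le> E k"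
      using elim(1) by (simp_all only: A_def D_def b_def)
    have "A powr b * norm (v k / D ^ Suc n) * (s / 2) \<le> A powr b * norm (v k / D ^ Suc n) * pseudo_dist_sq (p k) (q k)"
      using elim(2) by (intro mult_left_mono) auto
    with 2 have "A powr b * norm (v k / D ^ Suc n) * (s / 2) \<le> E k" by linarith
    then have 3: "A powr b * norm (v k / D ^ Suc n) \<le> E k / (s / 2)"
      using s by (simp add: field_simps)
    have "A powr b * norm (u k / of_real A ^ Suc n) \<le>
        A powr b * (norm (u k / of_real A ^ Suc n - v k / D ^ Suc n) + norm (v k / D ^ Suc n))"
      using norm_triangle_ineq[of "u k / of_real A ^ Suc n - v k / D ^ Suc n" "v k / D ^ Suc n"]
      by (intro mult_left_mono) auto
    also have "\<dots> \<le> E k + E k / (s / 2)" using 1 3 by (simp only: distrib_left)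
    finally have "A powr b * norm (u k / of_real A ^ Suc n) \<le> E k + E k / (s / 2)" .
    moreover have "A powr b * norm (u k / of_real A ^ Suc n) = norm (u k) / A powr \<alpha>"
      using A by (simp add: norm_divide norm_mult norm_power b_def powr_diff powr_realpow[symmetric] powr_add del: of_nat_Suc power_Suc)
    ultimately have uk: "norm (u k) / A powr \<alpha> \<le> E k + E k / (s / 2)" by simp
    have "A powr \<alpha> * norm (F k (p k)) \<le> M"
      using F(2)[of k] p unfolding weighted_bound_def A_def by blast
    then have "(A powr \<alpha> * norm (F k (p k))) * (norm (u k) / A powr \<alpha>) \<le> M * (E k + E k / (s / 2))"
      using uk M A by (intro mult_mono) auto
    then show ?case using A by (simp add: norm_mult mult_ac)
  qed
  moreover have "(\<lambda>k. M * (E k + E k / (s / 2))) \<longlonglongrightarrow> M * (0 + 0 / (s / 2))"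
    using s by (intro tendsto_intros E) auto
  then have "(\<lambda>k. M * (E k + E k / (s / 2))) \<longlonglongrightarrow> 0" by simp
  ultimately show ?thesis by (rule Lim_null_comparison)
qed

text \<open>When the pseudohyperbolic distance tends to 0, the three quantities \<open>1 - |p|^2\<close>, \<open>1 - |q|^2\<close> and
\<open>1 - <q,p>\<close> are asymptotically equal. Replacing the last by the first in the kernel test compares \<open>u\<close>
with \<open>v\<close>, and the Lipschitz estimate compares \<open>F k (p k)\<close> with \<open>F k (q k)\<close>.\<close>

lemma close_terms_tendsto_0:
  assumes p: "\<And>k. p k \<in> ball 0 1" and q: "\<And>k. q k \<in> ball 0 1"
    and H: "\<And>k. power_tests \<alpha> e (p k) (q k) (u k) (v k)"
    and v: "\<And>k. norm (v k) \<le> K * (1 - (norm (q k))\<^sup>2) powr \<alpha>"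
    and p1: "(\<lambda>k. norm (p k)) \<longlonglongrightarrow> 1" and s: "(\<lambda>k. pseudo_dist_sq (p k) (q k)) \<longlonglongrightarrow> 0"
  shows "(\<lambda>k. u k * F k (p k) - v k * F k (q k)) \<longlonglongrightarrow> 0"
proof -
  define A where "A k = 1 - (norm (p k))\<^sup>2" for k
  define B where "B k = 1 - (norm (q k))\<^sup>2" for k
  define D where "D k = 1 - hinner (q k) (p k)" for k
  define m where "m k = norm (hinner (q k - p k) (p k)) / norm (D k)" for k
  define l where "l k = sqrt (A k) * norm (q k - p k) / norm (D k)" for k
  have A: "0 < A k" and B: "0 < B k" and D: "0 < norm (D k)" "D k \<noteq> 0" for k
    using one_minus_norm_square_pos[OF p] one_minus_norm_square_pos[OF q] norm_one_minus_hinner_pos[OF p q, of k k]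
    by (simp_all add: A_def B_def D_def)
  have rho: "pseudo_dist_sq (p k) (q k) = (m k)\<^sup>2 + (l k)\<^sup>2" for k
    unfolding m_def l_def A_def D_def by (rule pseudo_dist_sq_eq[OF p q])
  have sq: "x \<longlonglongrightarrow> 0" if "\<And>k. 0 \<le> x k" "\<And>k. (x k)\<^sup>2 \<le> pseudo_dist_sq (p k) (q k)" for x :: "nat \<Rightarrow> real"
  proof -
    have "(\<lambda>k. sqrt (pseudo_dist_sq (p k) (q k))) \<longlonglongrightarrow> sqrt 0"
      by (intro tendsto_intros s)
    moreover have "norm (x k) \<le> sqrt (pseudo_dist_sq (p k) (q k))" for k
      using that[of k] real_le_rsqrt by auto
    ultimately show ?thesis by (intro Lim_null_comparison[of x]) auto
  qed
  have m: "m \<longlonglongrightarrow> 0" and l: "l \<longlonglongrightarrow> 0"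
    by (intro sq; simp add: rho m_def l_def less_imp_le[OF A])+
  have AD: "(\<lambda>k. of_real (A k) / D k) \<longlonglongrightarrow> 1"
  proof -
    have "of_real (A k) / D k - 1 = hinner (q k - p k) (p k) / D k" for k
      using D(2)[of k] by (simp add: field_simps A_def D_def hinner_diff_left hinner_self)
    then have "norm (of_real (A k) / D k - 1) \<le> m k" for k
      by (simp add: m_def norm_divide)
    with m have "(\<lambda>k. of_real (A k) / D k - 1) \<longlonglongrightarrow> 0"
      by (intro Lim_null_comparison[of "\<lambda>k. of_real (A k) / D k - 1" m]) auto
    then show ?thesis by (simp add: LIM_zero_iff)
  qed
  have AnD: "(\<lambda>k. A k / norm (D k)) \<longlonglongrightarrow> 1"
    using tendsto_norm[OF AD] A by (simp add: norm_divide less_imp_le)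
  have BA: "(\<lambda>k. B k / A k) \<longlonglongrightarrow> 1"
  proof -
    have "(\<lambda>k. (1 - pseudo_dist_sq (p k) (q k)) / (A k / norm (D k))\<^sup>2) \<longlonglongrightarrow> (1 - 0) / 1\<^sup>2"
      by (intro tendsto_intros s AnD) auto
    moreover have "(1 - pseudo_dist_sq (p k) (q k)) / (A k / norm (D k))\<^sup>2 = B k / A k" for k
      using A[of k] D[of k] unfolding pseudo_dist_sq_def A_def[symmetric] B_def[symmetric] D_def[symmetric]
      by (simp add: power2_eq_square)
    ultimately show ?thesis by simp
  qed
  define t where "t k = norm (hinner (q k - p k) (p k)) / A k + norm (q k - p k) / sqrt (A k)" for k
  have t: "t \<longlonglongrightarrow> 0"
  proof -
    have "(\<lambda>k. m k / (A k / norm (D k)) + l k / (A k / norm (D k))) \<longlonglongrightarrow> 0 / 1 + 0 / 1"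
      by (intro tendsto_intros m l AnD) auto
    moreover have "m k / (A k / norm (D k)) + l k / (A k / norm (D k)) = t k" for k
    proof -
      have "sqrt (A k) / A k = 1 / sqrt (A k)"
        using A[of k] by (simp add: field_simps)
      then show ?thesis using A[of k] D[of k] by (simp add: m_def l_def t_def field_simps)
    qed
    ultimately show ?thesis by simp
  qed
  obtain n where n: "\<alpha> \<le> real n" using real_arch_simple by blast
  obtain E where E: "E \<longlonglongrightarrow> 0"
    "\<forall>\<^sub>F k in sequentially.
      (1 - (norm (p k))\<^sup>2) powr (real (Suc n) - \<alpha>) *
        norm (u k / of_real (1 - (norm (p k))\<^sup>2) ^ Suc n - v k / (1 - hinner (q k) (p k)) ^ Suc n) \<le> E k \<and>
      (1 - (norm (p k))\<^sup>2) powr (real (Suc n) - \<alpha>) * norm (v k / (1 - hinner (q k) (p k)) ^ Suc n)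
        * pseudo_dist_sq (p k) (q k) \<le> E k"
    using tests_tendsto_0[OF p q H p1 n] by blast
  \<comment> \<open>One summand for each term of the splitting below: the kernel test, the ratio \<open>A / D\<close>, and the Lipschitz estimate.\<close>
  define G where "G k = E k * M + K * (B k / A k) powr \<alpha> * norm ((of_real (A k) / D k) ^ Suc n - 1) * M
    + K * (B k / A k) powr \<alpha> * (16 * 4 powr \<alpha> * M * t k)" for k
  have "\<forall>\<^sub>F k in sequentially. t k < 1 / 8"
    by (rule order_tendstoD(2)[OF t]) simp
  with E(2) have "\<forall>\<^sub>F k in sequentially. norm (u k * F k (p k) - v k * F k (q k)) \<le> G k"
  proof eventually_elim
    case (elim k)
    define b where "b = real (Suc n) - \<alpha>"
    let ?w = "of_real (A k) / D k"
    have Fp: "A k powr \<alpha> * norm (F k (p k)) \<le> M"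
      using F(2)[of k] p unfolding weighted_bound_def A_def by blast
    have vk: "norm (v k) = (norm (v k) / A k powr \<alpha>) * A k powr \<alpha>" using A[of k] by simp
    have "norm (v k) / A k powr \<alpha> \<le> K * B k powr \<alpha> / A k powr \<alpha>"
      using v[of k] by (intro divide_right_mono) (auto simp: B_def)
    then have vA: "norm (v k) / A k powr \<alpha> \<le> K * (B k / A k) powr \<alpha>"
      using A[of k] B[of k] by (simp add: powr_divide)
    have KB: "0 \<le> K * (B k / A k) powr \<alpha>"
      by (rule order_trans[OF _ vA]) simp
    have split: "u k * F k (p k) - v k * F k (q k) =
       (u k - v k * ?w ^ Suc n) * F k (p k) + v k * (?w ^ Suc n - 1) * F k (p k)
        - v k * (F k (q k) - F k (p k))"
      by (simp add: algebra_simps)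
    have "norm (u k * F k (p k) - v k * F k (q k)) \<le> norm (u k - v k * ?w ^ Suc n) * norm (F k (p k))
        + norm (v k) * norm (?w ^ Suc n - 1) * norm (F k (p k)) + norm (v k) * norm (F k (q k) - F k (p k))"
      using norm_triangle_ineq4[of "(u k - v k * ?w ^ Suc n) * F k (p k) + v k * (?w ^ Suc n - 1) * F k (p k)"
          "v k * (F k (q k) - F k (p k))"]
        norm_triangle_ineq[of "(u k - v k * ?w ^ Suc n) * F k (p k)" "v k * (?w ^ Suc n - 1) * F k (p k)"]
      unfolding split norm_mult by linarith
    also have "\<dots> \<le> G k"
      unfolding G_def
    proof (intro add_mono)
      have "norm (u k - v k * ?w ^ Suc n) = A k ^ Suc n * norm (u k / of_real (A k) ^ Suc n - v k / D k ^ Suc n)"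
      proof -
        have "u k - v k * ?w ^ Suc n = of_real (A k) ^ Suc n * (u k / of_real (A k) ^ Suc n - v k / D k ^ Suc n)"
          using A[of k] by (simp add: right_diff_distrib power_divide del: power_Suc)
        then show ?thesis using A[of k] by (simp add: norm_mult norm_power del: power_Suc)
      qed
      also have "A k ^ Suc n = A k powr \<alpha> * A k powr b"
        using A[of k] by (simp add: b_def powr_add[symmetric] powr_realpow[symmetric] del: of_nat_Suc power_Suc)
      finally have "norm (u k - v k * ?w ^ Suc n) * norm (F k (p k)) =
         (A k powr b * norm (u k / of_real (A k) ^ Suc n - v k / D k ^ Suc n)) * (A k powr \<alpha> * norm (F k (p k)))"
        by (simp only: mult_ac)
      also have "\<dots> \<le> E k * M"
      proof (intro mult_mono Fp)
        show 1: "A k powr b * norm (u k / of_real (A k) ^ Suc n - v k / D k ^ Suc n) \<le> E k"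
          using elim(1) by (simp only: A_def D_def b_def)
        show "0 \<le> E k" by (rule order_trans[OF _ 1]) simp
      qed auto
      finally show "norm (u k - v k * ?w ^ Suc n) * norm (F k (p k)) \<le> E k * M" .
      have "norm (v k) * norm (?w ^ Suc n - 1) * norm (F k (p k)) =
          (norm (v k) / A k powr \<alpha>) * norm (?w ^ Suc n - 1) * (A k powr \<alpha> * norm (F k (p k)))"
        by (subst vk) (simp only: mult_ac)
      also have "\<dots> \<le> (K * (B k / A k) powr \<alpha>) * norm (?w ^ Suc n - 1) * M"
        by (intro mult_mono Fp vA order_refl KB mult_nonneg_nonneg[OF KB norm_ge_zero]) auto
      finally show "norm (v k) * norm (?w ^ Suc n - 1) * norm (F k (p k)) \<le> \<dots>" .
      have "norm (v k) * norm (F k (q k) - F k (p k)) =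
          (norm (v k) / A k powr \<alpha>) * (A k powr \<alpha> * norm (F k (p k + (q k - p k)) - F k (p k)))"
        by (subst vk) (simp add: mult_ac)
      also have "\<dots> \<le> (K * (B k / A k) powr \<alpha>) * (16 * 4 powr \<alpha> * M * t k)"
        using elim(2)
        by (intro mult_mono vA KB hyperbolic_lipschitz[OF F \<alpha> M p]) (auto simp: A_def t_def)
      finally show "norm (v k) * norm (F k (q k) - F k (p k)) \<le> \<dots>" .
    qed
    finally show ?case .
  qed
  moreover have "G \<longlonglongrightarrow> 0 * M + K * 1 powr \<alpha> * norm ((1 :: complex) ^ Suc n - 1) * M + K * 1 powr \<alpha> * (16 * 4 powr \<alpha> * M * 0)"
    unfolding G_def by (intro tendsto_intros E BA AD t) auto
  then have "G \<longlonglongrightarrow> 0" by simp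
  ultimately show ?thesis by (rule Lim_null_comparison)
qed

end

text \<open>By compactness it suffices to treat subsequences along which both points and their distance converge.
If the distance tends to 0 and \<open>|p k|\<close> to 1, the preceding lemma applies. Otherwise both terms are
negligible separately: if the limit of \<open>p k\<close> is an interior point and the distance tends to 0, then
the limit of \<open>q k\<close> is an interior point too, since interior and boundary points have distance 1.\<close>

lemma weighted_difference_tendsto_0:
  fixes \<alpha> M K K' :: real and u v :: "nat \<Rightarrow> complex" and p q :: "nat \<Rightarrow> complex ^ 'n"
    and F :: "nat \<Rightarrow> complex ^ 'n \<Rightarrow> complex" and e :: "nat \<Rightarrow> real"
  assumes \<alpha>: "0 < \<alpha>" and M: "0 \<le> M"
    and F: "\<And>k. holomorphic_sv (F k) (ball 0 1)" "\<And>k. weighted_bound \<alpha> M (F k)"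
    and F0: "\<And>z. z \<in> ball 0 1 \<Longrightarrow> (\<lambda>k. F k z) \<longlonglongrightarrow> 0"
    and e: "\<And>j. 0 \<le> e j" "e \<longlonglongrightarrow> 0"
    and p: "\<And>k. p k \<in> ball 0 1" and q: "\<And>k. q k \<in> ball 0 1"
    and H: "\<And>k. power_tests \<alpha> e (p k) (q k) (u k) (v k)"
    and u: "\<And>k. norm (u k) \<le> K" and v: "\<And>k. norm (v k) \<le> K"
    and v': "\<And>k. norm (v k) \<le> K' * (1 - (norm (q k))\<^sup>2) powr \<alpha>"
  shows "(\<lambda>k. u k * F k (p k) - v k * F k (q k)) \<longlonglongrightarrow> 0"
proof (rule ccontr)
  define x where "x k = u k * F k (p k) - v k * F k (q k)" for k
  assume "\<not> ?thesis"
  then have "\<not> x \<longlonglongrightarrow> 0" by (simp add: x_def[abs_def])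
  then obtain \<delta> where \<delta>: "0 < \<delta>" "\<exists>\<^sub>\<infinity>k. \<delta> \<le> norm (x k)"
    unfolding lim_sequentially INFM_nat_le by (auto simp: not_less)
  then obtain s1 :: "nat \<Rightarrow> nat" where s1: "strict_mono s1" "\<And>k. \<delta> \<le> norm (x (s1 k))"
    using infinite_enumerate[of "{k. \<delta> \<le> norm (x k)}"] by (auto simp: INFM_iff_infinite)
  define X where "X k = (p (s1 k), q (s1 k), pseudo_dist_sq (p (s1 k)) (q (s1 k)))" for k
  have "compact (cball 0 1 \<times> cball 0 1 \<times> {0..1} :: ((complex ^ 'n) \<times> (complex ^ 'n) \<times> real) set)"
    by (intro compact_Times compact_cball compact_Icc)
  moreover have "\<And>k. X k \<in> cball 0 1 \<times> cball 0 1 \<times> {0..1}"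
    using p q pseudo_dist_sq_bounds[OF p q] by (auto simp: X_def less_imp_le)
  ultimately obtain l s2 where s2: "strict_mono (s2 :: nat \<Rightarrow> nat)" "(X \<circ> s2) \<longlonglongrightarrow> l"
    and l: "l \<in> cball 0 1 \<times> cball 0 1 \<times> {0..1}"
    unfolding compact_def by meson
  obtain p' q' \<sigma> where pq': "l = (p', q', \<sigma>)" by (cases l) auto
  have cball: "norm p' \<le> 1" "norm q' \<le> 1" "0 \<le> \<sigma>" using l by (auto simp: pq')
  define t where "t = s1 \<circ> s2"
  have t: "strict_mono t" unfolding t_def using s1(1) s2(1) by (rule strict_mono_o)
  have limp: "(\<lambda>k. p (t k)) \<longlonglongrightarrow> p'"
    using tendsto_fst[OF s2(2)] by (simp add: pq' X_def t_def o_def)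
  have limq: "(\<lambda>k. q (t k)) \<longlonglongrightarrow> q'"
    using tendsto_fst[OF tendsto_snd[OF s2(2)]] by (simp add: pq' X_def t_def o_def)
  have lims: "(\<lambda>k. pseudo_dist_sq (p (t k)) (q (t k))) \<longlonglongrightarrow> \<sigma>"
    using tendsto_snd[OF tendsto_snd[OF s2(2)]] by (simp add: pq' X_def t_def o_def)
  have Ft0: "(\<lambda>k. F (t k) z) \<longlonglongrightarrow> 0" if "z \<in> ball 0 1" for z
    using LIMSEQ_subseq_LIMSEQ[OF F0[OF that] t] by (simp add: o_def)
  have H': "power_tests \<alpha> e (q k) (p k) (v k) (u k)" for k
    using H[of k] by (subst power_tests_commute)
  have lims': "(\<lambda>k. pseudo_dist_sq (q (t k)) (p (t k))) \<longlonglongrightarrow> \<sigma>"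
    using lims by (simp add: pseudo_dist_sq_commute[of "q _"])
  have P: "(\<lambda>k. u (t k) * F (t k) (p (t k))) \<longlonglongrightarrow> 0" if "0 < \<sigma> \<or> norm p' < 1"
    by (rule separated_term_tendsto_0[OF \<alpha> M F Ft0 e p q H u limp lims that])
  have Q: "(\<lambda>k. v (t k) * F (t k) (q (t k))) \<longlonglongrightarrow> 0" if "0 < \<sigma> \<or> norm q' < 1"
    by (rule separated_term_tendsto_0[OF \<alpha> M F Ft0 e q p H' v limq lims' that])
  have xt: "(\<lambda>k. x (t k)) \<longlonglongrightarrow> 0"
  proof (cases "0 < \<sigma> \<or> norm p' < 1")
    case True
    have "0 < \<sigma> \<or> norm q' < 1"
    proof (rule ccontr)
      assume neg: "\<not> ?thesis"
      then have "norm p' < 1" "norm q' = 1" "\<sigma> = 0" using True cball by auto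
      have D: "(\<lambda>k. (norm (1 - hinner (q (t k)) (p (t k))))\<^sup>2) \<longlonglongrightarrow> (norm (1 - hinner q' p'))\<^sup>2"
        unfolding hinner_def by (intro tendsto_intros tendsto_vec_nth limp limq)
      have "norm (hinner q' p') < 1"
        using norm_hinner_le[of q' p'] \<open>norm q' = 1\<close> \<open>norm p' < 1\<close> by simp
      then have D0: "(norm (1 - hinner q' p'))\<^sup>2 \<noteq> 0" by auto
      have "(\<lambda>k. 1 - (1 - (norm (p (t k)))\<^sup>2) * (1 - (norm (q (t k)))\<^sup>2) / (norm (1 - hinner (q (t k)) (p (t k))))\<^sup>2)
         \<longlonglongrightarrow> 1 - (1 - (norm p')\<^sup>2) * (1 - (norm q')\<^sup>2) / (norm (1 - hinner q' p'))\<^sup>2"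
        by (intro tendsto_intros limp limq D D0)
      then have "(\<lambda>k. pseudo_dist_sq (p (t k)) (q (t k))) \<longlonglongrightarrow> 1"
        by (simp add: pseudo_dist_sq_def \<open>norm q' = 1\<close>)
      with lims have "\<sigma> = 1" using LIMSEQ_unique by blast
      with \<open>\<sigma> = 0\<close> show False by simp
    qed
    from tendsto_diff[OF P[OF True] Q[OF this]] show ?thesis by (simp add: x_def)
  next
    case False
    then have "norm p' = 1" "\<sigma> = 0" using cball by auto
    then have p1: "(\<lambda>k. norm (p (t k))) \<longlonglongrightarrow> 1" and s0: "(\<lambda>k. pseudo_dist_sq (p (t k)) (q (t k))) \<longlonglongrightarrow> 0"
      using tendsto_norm[OF limp] lims by simp_all
    show ?thesis
      unfolding x_def by (rule close_terms_tendsto_0[OF \<alpha> M F Ft0 e p q H v' p1 s0])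
  qed
  obtain N where "norm (x (t N)) < \<delta>"
    using LIMSEQ_D[OF xt \<delta>(1)] by auto
  then show False using s1(2)[of "s2 N"] by (simp add: t_def)
qed

section \<open>Weighted norms of powers of linear forms\<close>

lemma holomorphic_sv_mult:
  assumes "holomorphic_sv f S" "holomorphic_sv g S"
  shows "holomorphic_sv (\<lambda>z. f z * g z) S"
  unfolding holomorphic_sv_def
proof
  fix z assume "z \<in> S"
  then obtain D E where "(f has_derivative D) (at z)" "\<And>c v. D (c *s v) = c * D v"
    "(g has_derivative E) (at z)" "\<And>c v. E (c *s v) = c * E v"
    using assms unfolding holomorphic_sv_def by metis
  then show "\<exists>D. ((\<lambda>z. f z * g z) has_derivative D) (at z) \<and> (\<forall>c v. D (c *s v) = c * D v)"
    by (intro exI[of _ "\<lambda>h. f z * E h + D h * g z"] conjI has_derivative_mult) (auto simp: algebra_simps)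
qed

lemma holomorphic_sv_diff:
  assumes "holomorphic_sv f S" "holomorphic_sv g S"
  shows "holomorphic_sv (\<lambda>z. f z - g z) S"
  unfolding holomorphic_sv_def
proof
  fix z assume "z \<in> S"
  then obtain D E where "(f has_derivative D) (at z)" "\<And>c v. D (c *s v) = c * D v"
    "(g has_derivative E) (at z)" "\<And>c v. E (c *s v) = c * E v"
    using assms unfolding holomorphic_sv_def by metis
  then show "\<exists>D. ((\<lambda>z. f z - g z) has_derivative D) (at z) \<and> (\<forall>c v. D (c *s v) = c * D v)"
    by (intro exI[of _ "\<lambda>h. D h - E h"] conjI has_derivative_diff) (auto simp: algebra_simps)
qed

lemma holomorphic_sv_const: "holomorphic_sv (\<lambda>_. c) S"
  unfolding holomorphic_sv_def by (auto intro!: exI[of _ "\<lambda>_. 0"])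

lemma holomorphic_sv_hinner: "holomorphic_sv (\<lambda>z. hinner z w) S"
  unfolding holomorphic_sv_def
  by (auto intro!: exI[of _ "\<lambda>z. hinner z w"] bounded_linear_imp_has_derivative
      bounded_linear_hinner simp: hinner_scale_left)

lemma holomorphic_sv_power: "holomorphic_sv f S \<Longrightarrow> holomorphic_sv (\<lambda>z. f z ^ j) S"
  by (induction j) (simp_all add: holomorphic_sv_const holomorphic_sv_mult)

text \<open>Elements of \<open>Hinf \<gamma>\<close> vanish outside the ball, so test functions that are given by formulas have to be
cut off there.\<close>

definition extend_0 :: "(complex ^ 'n \<Rightarrow> complex) \<Rightarrow> complex ^ 'n \<Rightarrow> complex"
  where "extend_0 f = (\<lambda>z. if z \<in> ball 0 1 then f z else 0)"

lemma holomorphic_sv_cong_open: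
  assumes "holomorphic_sv f S" "open S" "\<And>z. z \<in> S \<Longrightarrow> f z = g z"
  shows "holomorphic_sv g S"
  using assms unfolding holomorphic_sv_def by (metis has_derivative_transform_within_open)

lemma wnorm_cong: "(\<And>z. z \<in> ball 0 1 \<Longrightarrow> f z = g z) \<Longrightarrow> wnorm \<gamma> f = wnorm \<gamma> g"
  unfolding wnorm_def by (intro SUP_cong) auto

lemma extend_0_in_Hinf:
  assumes "holomorphic_sv f (ball 0 1)" "wnorm \<gamma> f < \<infinity>"
  shows "extend_0 f \<in> Hinf \<gamma>"
proof -
  have "wnorm \<gamma> (extend_0 f) = wnorm \<gamma> f"
    by (rule wnorm_cong) (simp add: extend_0_def)
  moreover have "holomorphic_sv (extend_0 f) (ball 0 1)"
    by (rule holomorphic_sv_cong_open[OF assms(1)]) (auto simp: extend_0_def)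
  ultimately show ?thesis
    using assms by (simp add: Hinf_def extend_0_def)
qed

lemma Hinf_diff:
  assumes "f \<in> Hinf \<gamma>" "g \<in> Hinf \<gamma>"
  shows "(\<lambda>z. f z - g z) \<in> Hinf \<gamma>"
  using assms wnorm_diff_finite[OF assms] by (auto simp: Hinf_def holomorphic_sv_diff)

lemma wnorm_scale: "wnorm \<gamma> (\<lambda>z. c * f z) = ennreal (norm c) * wnorm \<gamma> f"
proof -
  have "ennreal ((1 - (norm z)\<^sup>2) powr \<gamma> * norm (c * f z)) =
      ennreal (norm c) * ennreal ((1 - (norm z)\<^sup>2) powr \<gamma> * norm (f z))" for z
    by (simp add: norm_mult ennreal_mult[symmetric] mult_ac)
  then show ?thesis
    unfolding wnorm_def by (simp add: SUP_mult_left_ennreal)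
qed

lemma Hinf_weighted_bound:
  assumes "f \<in> Hinf \<gamma>"
  shows "weighted_bound \<gamma> (enn2real (wnorm \<gamma> f)) f"
  using assms by (subst wnorm_le_iff[symmetric]) (auto simp: Hinf_def ennreal_enn2real_if)

lemma wdist_pointwise:
  assumes "f \<in> Hinf \<gamma>" "g \<in> Hinf \<gamma>" "z \<in> ball 0 1"
  shows "(1 - (norm z)\<^sup>2) powr \<gamma> * norm (f z - g z) \<le> wdist \<gamma> f g"
  using Hinf_weighted_bound[OF Hinf_diff[OF assms(1,2)]] assms(3)
  by (simp add: weighted_bound_def wdist_def)

text \<open>This turns convergence of weighted norms into convergence along sequences of points.\<close>

lemma wnorm_nearly_attained:
  assumes "wnorm \<gamma> f < \<infinity>"
  obtains a where "a \<in> ball 0 1" "enn2real (wnorm \<gamma> f) \<le> 2 * ((1 - (norm a)\<^sup>2) powr \<gamma> * norm (f a))"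
proof (cases "enn2real (wnorm \<gamma> f) = 0")
  case True
  then show ?thesis using that[of 0] by simp
next
  case False
  define s where "s = enn2real (wnorm \<gamma> f)"
  have s: "0 < s" using False by (simp add: s_def less_le)
  have eq: "wnorm \<gamma> f = ennreal s" using assms by (simp add: s_def ennreal_enn2real_if)
  have "\<not> wnorm \<gamma> f \<le> ennreal (s / 2)" unfolding eq using s by (simp add: ennreal_le_iff)
  then have "\<not> weighted_bound \<gamma> (s / 2) f" using s by (simp add: wnorm_le_iff)
  then obtain a where "a \<in> ball 0 1" "s / 2 < (1 - (norm a)\<^sup>2) powr \<gamma> * norm (f a)"
    unfolding weighted_bound_def by (auto simp: not_le)
  then show ?thesis by (intro that[of a]) (auto simp: s_def)
qed

lemma (in Metric_space) compactin_closure_of_sequentially: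
  assumes "S \<subseteq> M"
  shows "compactin mtopology (mtopology closure_of S) \<longleftrightarrow>
    (\<forall>\<sigma> :: nat \<Rightarrow> 'a. range \<sigma> \<subseteq> S \<longrightarrow>
      (\<exists>l r. l \<in> M \<and> strict_mono r \<and> limitin mtopology (\<sigma> \<circ> r) l sequentially))"
proof -
  have "M \<inter> mtopology derived_set_of T = mtopology derived_set_of T" for T
    using derived_set_of_subset_topspace[of mtopology T] by auto
  then show ?thesis
    unfolding compact_closure_of_eq_Bolzano_Weierstrass Bolzano_Weierstrass_property[OF assms assms]
    using assms by auto
qed

text \<open>With \<open>x = |<z,\<eta>>|\<close> both weighted values are maximal for \<open>|z|\<close> as small as Bessel's inequality permits.
A factor \<open><z,\<eta>'>\<close> with \<open>\<eta>'\<close> orthogonal to \<open>\<eta>\<close> is at most \<open>(1 - x^2)^(1/2)\<close>, which is worth the extra factor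
\<open>j^(-1/2)\<close>.\<close>

lemma weighted_bound_power:
  assumes "0 < \<alpha>"
  obtains C where "0 \<le> C"
    "\<And>(\<eta> :: complex ^ 'n) j. norm \<eta> = 1 \<Longrightarrow>
      weighted_bound \<alpha> (C * real (Suc j) powr - \<alpha>) (\<lambda>z. hinner z \<eta> ^ j)"
    "\<And>(\<eta> :: complex ^ 'n) \<eta>' j. norm \<eta> = 1 \<Longrightarrow> norm \<eta>' = 1 \<Longrightarrow> hinner \<eta> \<eta>' = 0 \<Longrightarrow>
      weighted_bound \<alpha> (C * real (Suc j) powr - (\<alpha> + 1 / 2)) (\<lambda>z. hinner z \<eta> ^ j * hinner z \<eta>')"
proof -
  obtain C1 where C1: "0 \<le> C1"
    "\<And>x j. 0 \<le> x \<Longrightarrow> x \<le> 1 \<Longrightarrow> ((1 - x\<^sup>2) * real (Suc j)) powr \<alpha> * x ^ j \<le> C1"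
    using powr_times_power_bounded[of \<alpha>] assms by auto
  obtain C2 where C2: "0 \<le> C2"
    "\<And>x j. 0 \<le> x \<Longrightarrow> x \<le> 1 \<Longrightarrow> ((1 - x\<^sup>2) * real (Suc j)) powr (\<alpha> + 1 / 2) * x ^ j \<le> C2"
    using powr_times_power_bounded[of "\<alpha> + 1 / 2"] assms by auto
  have conv: "t powr \<kappa> * y \<le> C * real (Suc j) powr - \<kappa>"
    if "(t * real (Suc j)) powr \<kappa> * y \<le> C" "0 \<le> t" for t \<kappa> y C j
    using that by (simp add: powr_mult powr_minus field_simps del: of_nat_Suc)
  show ?thesis
  proof (rule that[of "max C1 C2"])
    show "0 \<le> max C1 C2" using C1 by simp
    fix \<eta> :: "complex ^ 'n" and j assume \<eta>: "norm \<eta> = 1"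
    show "weighted_bound \<alpha> (max C1 C2 * real (Suc j) powr - \<alpha>) (\<lambda>z. hinner z \<eta> ^ j)"
      unfolding weighted_bound_def
    proof
      fix z :: "complex ^ 'n" assume z: "z \<in> ball 0 1"
      define x where "x = norm (hinner z \<eta>)"
      have x: "0 \<le> x" "x \<le> norm z" using norm_hinner_le[of z \<eta>] \<eta> by (simp_all add: x_def)
      then have xz: "x\<^sup>2 \<le> (norm z)\<^sup>2" "x \<le> 1" using z by (auto intro: power_mono)
      have "(1 - (norm z)\<^sup>2) powr \<alpha> * norm (hinner z \<eta> ^ j) \<le> (1 - x\<^sup>2) powr \<alpha> * x ^ j"
        unfolding norm_power x_def[symmetric] using xz one_minus_norm_square_pos[OF z] assms x
        by (intro mult_right_mono powr_mono2) auto
      also have "\<dots> \<le> C1 * real (Suc j) powr - \<alpha>"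
        using C1(2)[OF x(1) xz(2)] x xz(2) by (intro conv) (auto simp: power_le_one)
      also have "\<dots> \<le> max C1 C2 * real (Suc j) powr - \<alpha>"
        by (intro mult_right_mono) auto
      finally show "(1 - (norm z)\<^sup>2) powr \<alpha> * norm (hinner z \<eta> ^ j) \<le> max C1 C2 * real (Suc j) powr - \<alpha>" .
    qed
  next
    fix \<eta> \<eta>' :: "complex ^ 'n" and j assume \<eta>: "norm \<eta> = 1" "norm \<eta>' = 1" "hinner \<eta> \<eta>' = 0"
    show "weighted_bound \<alpha> (max C1 C2 * real (Suc j) powr - (\<alpha> + 1 / 2)) (\<lambda>z. hinner z \<eta> ^ j * hinner z \<eta>')"
      unfolding weighted_bound_def
    proof
      fix z :: "complex ^ 'n" assume z: "z \<in> ball 0 1"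
      define x where "x = norm (hinner z \<eta>)"
      define y where "y = norm (hinner z \<eta>')"
      have z1: "(norm z)\<^sup>2 < 1" using one_minus_norm_square_pos[OF z] by simp
      have xy: "x\<^sup>2 + y\<^sup>2 \<le> (norm z)\<^sup>2" unfolding x_def y_def by (rule bessel_two[OF \<eta>])
      then have x2: "x\<^sup>2 \<le> (norm z)\<^sup>2" and x1: "x\<^sup>2 < 1" and y2: "y\<^sup>2 \<le> 1 - x\<^sup>2"
        using z1 zero_le_power2[of y] by linarith+
      have x: "0 \<le> x" "x \<le> 1" "0 \<le> y" using x1 by (auto simp: x_def y_def abs_square_less_1)
      have y: "y \<le> (1 - x\<^sup>2) powr (1 / 2)" using y2 x1 by (simp add: powr_half_sqrt real_le_rsqrt)
      have "(1 - (norm z)\<^sup>2) powr \<alpha> * norm (hinner z \<eta> ^ j * hinner z \<eta>') =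
         (1 - (norm z)\<^sup>2) powr \<alpha> * y * x ^ j"
        by (simp add: norm_mult norm_power x_def y_def)
      also have "\<dots> \<le> (1 - x\<^sup>2) powr \<alpha> * (1 - x\<^sup>2) powr (1 / 2) * x ^ j"
        using x2 z1 x y assms by (intro mult_right_mono mult_mono powr_mono2) auto
      also have "\<dots> = (1 - x\<^sup>2) powr (\<alpha> + 1 / 2) * x ^ j"
        by (simp only: powr_add)
      also have "\<dots> \<le> C2 * real (Suc j) powr - (\<alpha> + 1 / 2)"
        using C2(2)[OF x(1,2)] x1 by (intro conv) auto
      also have "\<dots> \<le> max C1 C2 * real (Suc j) powr - (\<alpha> + 1 / 2)"
        by (intro mult_right_mono) auto
      finally show "(1 - (norm z)\<^sup>2) powr \<alpha> * norm (hinner z \<eta> ^ j * hinner z \<eta>')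
        \<le> max C1 C2 * real (Suc j) powr - (\<alpha> + 1 / 2)" .
    qed
  qed
qed

text \<open>Evaluate at a combination of \<open>\<eta>\<close> and \<open>\<eta>'\<close>, with a small coefficient for \<open>\<eta>'\<close> whose phase makes the two
contributions to each inner product add up.\<close>

lemma wnorm_power_pair_ge:
  fixes \<eta> \<eta>' :: "complex ^ 'n"
  assumes \<alpha>: "0 < \<alpha>" and \<eta>: "norm \<eta> = 1" "norm \<eta>' = 1" and b: "0 < b" "b < 1 / 2"
  shows "ennreal (b powr \<alpha> * ((1 - 2 * b) ^ j * b)) \<le> wnorm \<alpha> (\<lambda>z. hinner z \<eta> ^ j * hinner z \<eta>')"
proof -
  define c where "c = hinner \<eta>' \<eta>"
  define \<omega> where "\<omega> = (if c = 0 then 1 else cnj c / of_real (norm c))"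
  have \<omega>: "norm \<omega> = 1" "\<omega> * c = of_real (norm c)"
    by (auto simp: \<omega>_def norm_divide complex_norm_square[symmetric] mult.commute[of "cnj c"] power2_eq_square)
  have "cnj \<omega> * hinner \<eta> \<eta>' = cnj (\<omega> * c)"
    unfolding c_def by (subst hinner_commute) simp
  then have \<omega>': "cnj \<omega> * hinner \<eta> \<eta>' = of_real (norm c)" by (simp add: \<omega>)
  have cw: "cnj \<omega> * \<omega> = 1"
    using \<omega>(1) complex_norm_square[of \<omega>] by (simp add: mult.commute)
  define z where "z = of_real (1 - 2 * b) *s \<eta> + (of_real b * \<omega>) *s \<eta>'"
  have "norm z \<le> norm (complex_of_real (1 - 2 * b) *s \<eta>) + norm ((of_real b * \<omega>) *s \<eta>')"
    unfolding z_def by (rule norm_triangle_ineq)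
  also have "\<dots> = (1 - 2 * b) + b"
    unfolding norm_complex_scale norm_mult norm_of_real using b \<eta> \<omega> by simp
  finally have nz: "norm z \<le> 1 - b" by simp
  then have z: "z \<in> ball 0 1" using b by simp
  have "(norm z)\<^sup>2 \<le> norm z" using nz b by (simp add: power2_eq_square mult_left_le)
  then have 1: "b \<le> 1 - (norm z)\<^sup>2" using nz by simp
  have "hinner z \<eta> = of_real (1 - 2 * b + b * norm c)"
  proof -
    have "hinner z \<eta> = of_real (1 - 2 * b) * hinner \<eta> \<eta> + of_real b * (\<omega> * c)"
      unfolding z_def hinner_add_left hinner_scale_left c_def by (simp only: mult.assoc)
    then show ?thesis using \<eta> by (simp add: \<omega> hinner_self)
  qed
  then have "norm (hinner z \<eta>) = 1 - 2 * b + b * norm c"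
    using b by (simp only: norm_of_real) (simp add: abs_of_nonneg)
  then have 2: "1 - 2 * b \<le> norm (hinner z \<eta>)" using b by simp
  have "cnj \<omega> * hinner z \<eta>' = of_real ((1 - 2 * b) * norm c + b)"
  proof -
    have "cnj \<omega> * hinner z \<eta>' = of_real (1 - 2 * b) * (cnj \<omega> * hinner \<eta> \<eta>') + of_real b * (cnj \<omega> * \<omega>) * hinner \<eta>' \<eta>'"
      unfolding z_def hinner_add_left hinner_scale_left by (simp only: distrib_left mult_ac)
    then show ?thesis using \<eta> by (simp add: \<omega>' cw hinner_self)
  qed
  then have "norm (cnj \<omega> * hinner z \<eta>') = (1 - 2 * b) * norm c + b"
    using b by (simp only: norm_of_real) (simp add: abs_of_nonneg)
  then have 3: "b \<le> norm (hinner z \<eta>')" using b \<omega> by (simp add: norm_mult)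
  have "b powr \<alpha> * ((1 - 2 * b) ^ j * b) \<le> (1 - (norm z)\<^sup>2) powr \<alpha> * norm (hinner z \<eta> ^ j * hinner z \<eta>')"
    unfolding norm_mult norm_power using 1 2 3 b \<alpha>
    by (intro mult_mono powr_mono2 power_mono mult_nonneg_nonneg) auto
  then show ?thesis
    using wnorm_upper[OF z, of \<alpha> "\<lambda>z. hinner z \<eta> ^ j * hinner z \<eta>'"] by (meson ennreal_leI order_trans)
qed

lemma wnorm_power_ge:
  fixes \<eta> :: "complex ^ 'n"
  assumes \<alpha>: "0 < \<alpha>" and \<eta>: "norm \<eta> = 1" and b: "0 < b" "b < 1 / 2"
  shows "ennreal (b powr \<alpha> * ((1 - 2 * b) ^ j * b)) \<le> wnorm \<alpha> (\<lambda>z. hinner z \<eta> ^ j)"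
proof (rule order_trans[OF wnorm_power_pair_ge[OF \<alpha> \<eta> \<eta> b]])
  show "wnorm \<alpha> (\<lambda>z. hinner z \<eta> ^ j * hinner z \<eta>) \<le> wnorm \<alpha> (\<lambda>z. hinner z \<eta> ^ j)"
    unfolding wnorm_def
  proof (rule SUP_mono)
    fix z :: "complex ^ 'n" assume z: "z \<in> ball 0 1"
    have "norm (hinner z \<eta>) \<le> 1" using norm_hinner_le[of z \<eta>] \<eta> z by simp
    then have "norm (hinner z \<eta> ^ j * hinner z \<eta>) \<le> norm (hinner z \<eta> ^ j) * 1"
      unfolding norm_mult by (intro mult_left_mono) auto
    then show "\<exists>m\<in>ball 0 1. ennreal ((1 - (norm z)\<^sup>2) powr \<alpha> * norm (hinner z \<eta> ^ j * hinner z \<eta>))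
        \<le> ennreal ((1 - (norm m)\<^sup>2) powr \<alpha> * norm (hinner m \<eta> ^ j))"
      using z by (intro bexI[of _ z] ennreal_leI mult_left_mono) auto
  qed
qed

section \<open>Compactness of the difference\<close>

lemma bounded_op_wcomp_bound:
  assumes "bounded_op \<alpha> \<beta> (wcomp u \<phi>)" "\<phi> ` ball 0 1 \<subseteq> ball 0 1"
  obtains K where "0 \<le> K" "\<And>f. holomorphic_sv f (ball 0 1) \<Longrightarrow> wnorm \<alpha> f < \<infinity> \<Longrightarrow>
    wnorm \<beta> (\<lambda>z. u z * f (\<phi> z)) \<le> ennreal K * wnorm \<alpha> f"
proof -
  obtain K where K: "0 \<le> K" "\<And>f. f \<in> Hinf \<alpha> \<Longrightarrow> wnorm \<beta> (wcomp u \<phi> f) \<le> ennreal K * wnorm \<alpha> f"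
    using assms(1) unfolding bounded_op_def by blast
  have "wnorm \<beta> (\<lambda>z. u z * f (\<phi> z)) \<le> ennreal K * wnorm \<alpha> f"
    if "holomorphic_sv f (ball 0 1)" "wnorm \<alpha> f < \<infinity>" for f
  proof -
    have "wnorm \<beta> (\<lambda>z. u z * f (\<phi> z)) = wnorm \<beta> (wcomp u \<phi> (extend_0 f))"
      using assms(2) by (intro wnorm_cong) (auto simp: wcomp_def extend_0_def image_subset_iff)
    moreover have "wnorm \<alpha> (extend_0 f) = wnorm \<alpha> f"
      by (intro wnorm_cong) (simp add: extend_0_def)
    ultimately show ?thesis
      using K(2)[OF extend_0_in_Hinf[OF that]] by simp
  qed
  with K(1) that show ?thesis by blast
qed

text \<open>The second bound says that the weight compensates the growth of functions at \<open>\<psi> a\<close>. Boundedness on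
powers of linear forms suffices for it: this is the kernel test with a constant sequence in place of a
null sequence and without a second point.\<close>

lemma bounded_op_weight_bound:
  fixes \<psi> :: "complex ^ 'n \<Rightarrow> complex ^ 'n"
  assumes \<alpha>: "0 < \<alpha>" and bdd: "bounded_op \<alpha> \<beta> (wcomp v \<psi>)" and \<psi>: "\<psi> ` ball 0 1 \<subseteq> ball 0 1"
  obtains K K' where
    "\<And>a. a \<in> ball 0 1 \<Longrightarrow> (1 - (norm a)\<^sup>2) powr \<beta> * norm (v a) \<le> K"
    "\<And>a. a \<in> ball 0 1 \<Longrightarrow> (1 - (norm a)\<^sup>2) powr \<beta> * norm (v a) \<le> K' * (1 - (norm (\<psi> a))\<^sup>2) powr \<alpha>"
proof -
  obtain L where L: "0 \<le> L" "\<And>f. holomorphic_sv f (ball 0 1) \<Longrightarrow> wnorm \<alpha> f < \<infinity> \<Longrightarrow>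
    wnorm \<beta> (\<lambda>z. v z * f (\<psi> z)) \<le> ennreal L * wnorm \<alpha> f"
    using bounded_op_wcomp_bound[OF bdd \<psi>] by blast
  have test: "(1 - (norm a)\<^sup>2) powr \<beta> * norm (v a * f (\<psi> a)) \<le> L * R"
    if f: "holomorphic_sv f (ball 0 1)" "weighted_bound \<alpha> R f" "0 \<le> R" and a: "a \<in> ball 0 1" for f R a
  proof -
    have R: "wnorm \<alpha> f \<le> ennreal R" using f by (simp add: wnorm_le_iff)
    have "wnorm \<beta> (\<lambda>z. v z * f (\<psi> z)) \<le> ennreal L * wnorm \<alpha> f"
      using R by (intro L f) (auto intro: le_less_trans)
    also have "\<dots> \<le> ennreal L * ennreal R" by (intro mult_left_mono R) auto
    also have "\<dots> = ennreal (L * R)" using L f by (simp add: ennreal_mult)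
    finally have "weighted_bound \<beta> (L * R) (\<lambda>z. v z * f (\<psi> z))"
      using L f by (simp add: wnorm_le_iff)
    then show ?thesis using a by (simp add: weighted_bound_def)
  qed
  have one: "weighted_bound \<alpha> 1 (\<lambda>_ :: complex ^ 'n. 1)"
    unfolding weighted_bound_def
  proof
    fix z :: "complex ^ 'n" assume "z \<in> ball 0 1"
    then have "(1 - (norm z)\<^sup>2) powr \<alpha> \<le> 1 powr \<alpha>"
      using \<alpha> one_minus_norm_square_pos[of z] by (intro powr_mono2) auto
    then show "(1 - (norm z)\<^sup>2) powr \<alpha> * norm (1 :: complex) \<le> 1" by simp
  qed
  have w: "(1 - (norm a)\<^sup>2) powr \<beta> * norm (v a) \<le> L" if "a \<in> ball 0 1" for a
    using test[OF holomorphic_sv_const one _ that] by simp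
  obtain C where C: "0 \<le> C" "\<And>(\<eta> :: complex ^ 'n) j. norm \<eta> = 1 \<Longrightarrow>
      weighted_bound \<alpha> (C * real (Suc j) powr - \<alpha>) (\<lambda>z. hinner z \<eta> ^ j)"
    using weighted_bound_power[OF \<alpha>] by metis
  obtain n where n: "\<alpha> \<le> real n" using real_arch_simple by blast
  obtain C' where C': "0 \<le> C'"
    "\<And>(p :: complex ^ 'n) q u v e M. p \<in> ball 0 1 \<Longrightarrow> 1 / 2 \<le> norm p \<Longrightarrow> q \<in> ball 0 1 \<Longrightarrow>
      (\<And>j. 0 \<le> e j) \<Longrightarrow> (\<And>j. e j \<le> M) \<Longrightarrow>
      (\<And>\<eta> j. norm \<eta> = 1 \<Longrightarrow> p = of_real (norm p) *s \<eta> \<Longrightarrow> norm (u * hinner p \<eta> ^ j - v * hinner q \<eta> ^ j) \<le> e j * real (Suc j) powr - \<alpha>) \<Longrightarrow>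
      (1 - (norm p)\<^sup>2) powr (real n - \<alpha> + 1) *
        norm (u / of_real (1 - (norm p)\<^sup>2) ^ Suc n - v / (1 - hinner q p) ^ Suc n)
        \<le> C' * abel_mean e (sqrt (norm p))"
    using kernel_test[OF n, where ?'n = 'n] by blast
  define K' where "K' = max (C' * (L * C)) (L / (1 / 2) powr \<alpha>)"
  have "(1 - (norm a)\<^sup>2) powr \<beta> * norm (v a) \<le> K' * (1 - (norm (\<psi> a))\<^sup>2) powr \<alpha>"
    if a: "a \<in> ball 0 1" for a
  \<comment> \<open>The kernel test needs a direction, hence a point away from the origin; near the origin the first bound suffices.\<close>
  proof (cases "1 / 2 \<le> norm (\<psi> a)")
    case True
    define A where "A = 1 - (norm (\<psi> a))\<^sup>2"
    define w where "w = of_real ((1 - (norm a)\<^sup>2) powr \<beta>) * v a"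
    have q: "\<psi> a \<in> ball 0 1" using a \<psi> by blast
    have A: "0 < A" using one_minus_norm_square_pos[OF q] by (simp add: A_def)
    have "norm (w * hinner (\<psi> a) \<eta> ^ j - 0 * hinner 0 \<eta> ^ j) \<le> (L * C) * real (Suc j) powr - \<alpha>"
      if \<eta>: "norm \<eta> = 1" for \<eta> :: "complex ^ 'n" and j
      using test[OF _ C(2)[OF \<eta>] _ a, of j] C(1)
      by (simp add: w_def norm_mult mult_ac holomorphic_sv_power holomorphic_sv_hinner)
    then have "A powr (real n - \<alpha> + 1) * norm (w / of_real A ^ Suc n - 0 / (1 - hinner 0 (\<psi> a)) ^ Suc n)
        \<le> C' * abel_mean (\<lambda>_. L * C) (sqrt (norm (\<psi> a)))"
      unfolding A_def using L C q by (intro C'(2)[OF q True, where M = "L * C"]) auto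
    also have "\<dots> = C' * (L * C)" using q by (simp add: abel_mean_const)
    also have "\<dots> \<le> K'" by (simp add: K'_def)
    finally have le: "norm w * (A powr (real n - \<alpha> + 1) / A ^ Suc n) \<le> K'"
      using A by (simp add: norm_divide norm_mult norm_power mult.commute)
    have eq: "A powr (real n - \<alpha> + 1) / A ^ Suc n = 1 / A powr \<alpha>"
    proof -
      have "A ^ Suc n = A powr (real n - \<alpha> + 1) * A powr \<alpha>"
        using A by (simp add: powr_add[symmetric] powr_realpow[symmetric] add.commute del: power_Suc)
      then show ?thesis using A by simp
    qed
    have "norm w \<le> K' * A powr \<alpha>" using le A unfolding eq by (simp add: field_simps)
    then show ?thesis by (simp add: w_def A_def norm_mult)
  next
    case False
    have "(norm (\<psi> a))\<^sup>2 \<le> (1 / 2)\<^sup>2" using False by (intro power_mono) auto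
    then have "(1 / 2) powr \<alpha> \<le> (1 - (norm (\<psi> a))\<^sup>2) powr \<alpha>"
      using \<alpha> by (intro powr_mono2) (auto simp: power2_eq_square)
    then have "L / (1 / 2) powr \<alpha> * (1 / 2) powr \<alpha> \<le> K' * (1 - (norm (\<psi> a))\<^sup>2) powr \<alpha>"
      using L by (intro mult_mono) (auto simp: K'_def le_max_iff_disj)
    then show ?thesis using w[OF a] by simp
  qed
  with w that show ?thesis by blast
qed

lemma weighted_bound_diff:
  fixes f g :: "complex ^ 'n \<Rightarrow> complex"
  assumes "weighted_bound \<gamma> M f" "weighted_bound \<gamma> N g"
  shows "weighted_bound \<gamma> (M + N) (\<lambda>z. f z - g z)"
  unfolding weighted_bound_def
proof
  fix z :: "complex ^ 'n" assume z: "z \<in> ball 0 1"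
  have "(1 - (norm z)\<^sup>2) powr \<gamma> * norm (f z - g z) \<le> (1 - (norm z)\<^sup>2) powr \<gamma> * (norm (f z) + norm (g z))"
    by (intro mult_left_mono norm_triangle_ineq4) auto
  also have "\<dots> \<le> M + N"
    using assms z unfolding weighted_bound_def distrib_left by (intro add_mono) auto
  finally show "(1 - (norm z)\<^sup>2) powr \<gamma> * norm (f z - g z) \<le> M + N" .
qed

lemma mbounded_Hinf_weighted_bound:
  assumes "Metric_space.mbounded (Hinf \<alpha>) (wdist \<alpha>) B"
  obtains M where "0 \<le> M" "\<And>f. f \<in> B \<Longrightarrow> f \<in> Hinf \<alpha> \<and> weighted_bound \<alpha> M f"
proof (cases "B = {}")
  case True
  then show ?thesis using that[of 0] by simp
next
  case False
  interpret Metric_space "Hinf \<alpha>" "wdist \<alpha>" by (rule Metric_space_Hinf)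
  obtain g c where g: "g \<in> Hinf \<alpha>" "\<And>f. f \<in> B \<Longrightarrow> f \<in> Hinf \<alpha> \<and> wdist \<alpha> g f \<le> c"
    using assms False unfolding mbounded by auto
  define N where "N = enn2real (wnorm \<alpha> g)"
  have gN: "weighted_bound \<alpha> N g" using Hinf_weighted_bound[OF g(1)] by (simp add: N_def)
  have "weighted_bound \<alpha> (N + max c 0) f" if f: "f \<in> B" for f
  proof -
    have "weighted_bound \<alpha> (max c 0) (\<lambda>z. g z - f z)"
      using wdist_pointwise[OF g(1), of f] g(2)[OF f] unfolding weighted_bound_def
      by (meson max.coboundedI1 order_trans)
    from weighted_bound_diff[OF gN this] show ?thesis by simp
  qed
  then show ?thesis using g(2) by (intro that[of "N + max c 0"]) (auto simp: N_def)
qed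

lemma difference_in_Hinf:
  assumes "bounded_op \<alpha> \<beta> (wcomp u \<phi>)" "bounded_op \<alpha> \<beta> (wcomp v \<psi>)"
  shows "(\<lambda>f z. wcomp u \<phi> f z - wcomp v \<psi> f z) ` Hinf \<alpha> \<subseteq> Hinf \<beta>"
  using assms unfolding bounded_op_def by (auto intro!: Hinf_diff)

text \<open>A bounded sequence has a subsequence that converges at each point, and the differences from the limit
satisfy the assumptions on \<open>F\<close> in \<open>weighted_difference_tendsto_0\<close>. Applied at points where the weighted
norms of their images are nearly attained, that lemma shows that the images converge in norm.\<close>

theorem compact_op_if_power_tests:
  fixes \<phi> \<psi> :: "complex ^ 'n \<Rightarrow> complex ^ 'n"
  assumes \<alpha>: "0 < \<alpha>"
    and \<phi>: "\<phi> ` ball 0 1 \<subseteq> ball 0 1" and \<psi>: "\<psi> ` ball 0 1 \<subseteq> ball 0 1"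
    and bdd: "bounded_op \<alpha> \<beta> (wcomp u \<phi>)" "bounded_op \<alpha> \<beta> (wcomp v \<psi>)"
    and e: "\<And>j. 0 \<le> e j" "e \<longlonglongrightarrow> 0"
    and H1: "\<And>\<eta> j. norm \<eta> = 1 \<Longrightarrow>
      weighted_bound \<beta> (e j * real (Suc j) powr - \<alpha>) (\<lambda>z. u z * hinner (\<phi> z) \<eta> ^ j - v z * hinner (\<psi> z) \<eta> ^ j)"
    and H2: "\<And>\<eta> \<eta>' j. norm \<eta> = 1 \<Longrightarrow> norm \<eta>' = 1 \<Longrightarrow> hinner \<eta> \<eta>' = 0 \<Longrightarrow>
      weighted_bound \<beta> (e j * real (Suc j) powr - (\<alpha> + 1 / 2))
        (\<lambda>z. u z * hinner (\<phi> z) \<eta> ^ j * hinner (\<phi> z) \<eta>' - v z * hinner (\<psi> z) \<eta> ^ j * hinner (\<psi> z) \<eta>')"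
  shows "compact_op \<alpha> \<beta> (\<lambda>f z. wcomp u \<phi> f z - wcomp v \<psi> f z)"
proof -
  define T where "T f z = wcomp u \<phi> f z - wcomp v \<psi> f z" for f z
  interpret B: Metric_space "Hinf \<beta>" "wdist \<beta>" by (rule Metric_space_Hinf)
  have T: "T f \<in> Hinf \<beta>" if "f \<in> Hinf \<alpha>" for f
    using difference_in_Hinf[OF bdd] that by (auto simp: T_def[abs_def])
  obtain Ku where Ku: "\<And>a. a \<in> ball 0 1 \<Longrightarrow> (1 - (norm a)\<^sup>2) powr \<beta> * norm (u a) \<le> Ku"
    using bounded_op_weight_bound[OF \<alpha> bdd(1) \<phi>] by metis
  obtain Kv K' where Kv: "\<And>a. a \<in> ball 0 1 \<Longrightarrow> (1 - (norm a)\<^sup>2) powr \<beta> * norm (v a) \<le> Kv"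
    and K': "\<And>a. a \<in> ball 0 1 \<Longrightarrow> (1 - (norm a)\<^sup>2) powr \<beta> * norm (v a) \<le> K' * (1 - (norm (\<psi> a))\<^sup>2) powr \<alpha>"
    using bounded_op_weight_bound[OF \<alpha> bdd(2) \<psi>] by metis
  have "compactin B.mtopology (B.mtopology closure_of (T ` S))"
    if S: "Metric_space.mbounded (Hinf \<alpha>) (wdist \<alpha>) S" for S
  proof -
    obtain M where M: "0 \<le> M" "\<And>f. f \<in> S \<Longrightarrow> f \<in> Hinf \<alpha> \<and> weighted_bound \<alpha> M f"
      using mbounded_Hinf_weighted_bound[OF S] by blast
    have TS: "T ` S \<subseteq> Hinf \<beta>" using M(2) T by blast
    have "\<exists>l r. l \<in> Hinf \<beta> \<and> strict_mono r \<and> limitin B.mtopology (\<sigma> \<circ> r) l sequentially"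
      if \<sigma>: "range \<sigma> \<subseteq> T ` S" for \<sigma> :: "nat \<Rightarrow> _"
    proof -
      have "\<forall>k. \<exists>f. f \<in> S \<and> \<sigma> k = T f" using \<sigma> by blast
      then obtain f where f: "\<And>k. f k \<in> S" "\<And>k. \<sigma> k = T (f k)" by metis
      have hol: "holomorphic_sv (f k) (ball 0 1)" and wb: "weighted_bound \<alpha> M (f k)"
        and fH: "f k \<in> Hinf \<alpha>" for k
        using M(2)[OF f(1)] by (auto simp: Hinf_def)
      obtain s g0 where s: "strict_mono (s :: nat \<Rightarrow> nat)"
        and g0: "\<And>z. z \<in> ball 0 1 \<Longrightarrow> (\<lambda>k. f (s k) z) \<longlonglongrightarrow> g0 z"
        using pointwise_convergent_subsequence[where F = f, OF hol wb \<alpha> M(1)] by blast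
      have g0_props: "holomorphic_sv g0 (ball 0 1)" "weighted_bound \<alpha> M g0"
        using holomorphic_sv_pointwise_limit[where F = "\<lambda>k. f (s k)", OF hol wb \<alpha> M(1) g0] by simp_all
      define g where "g = extend_0 g0"
      have "wnorm \<alpha> g0 < \<infinity>"
        using g0_props(2) M(1) by (simp add: wnorm_le_iff[symmetric] le_less_trans)
      then have gH: "g \<in> Hinf \<alpha>" unfolding g_def using g0_props(1) by (intro extend_0_in_Hinf)
      have gwb: "weighted_bound \<alpha> M g"
        using g0_props(2) by (simp add: weighted_bound_def g_def extend_0_def)
      define F where "F k z = f (s k) z - g z" for k z
      have F: "holomorphic_sv (F k) (ball 0 1)" "weighted_bound \<alpha> (M + M) (F k)" for k
        using holomorphic_sv_diff[OF hol] gH weighted_bound_diff[OF wb gwb]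
        by (auto simp: F_def[abs_def] Hinf_def)
      have F0: "(\<lambda>k. F k z) \<longlonglongrightarrow> 0" if "z \<in> ball 0 1" for z
        using g0[OF that] that by (simp add: F_def g_def extend_0_def LIM_zero)
      have diff: "(\<lambda>z. T (f (s k)) z - T g z) \<in> Hinf \<beta>" for k
        by (intro Hinf_diff T fH gH)
      have "\<exists>a. a \<in> ball 0 1 \<and> wdist \<beta> (T (f (s k))) (T g)
          \<le> 2 * ((1 - (norm a)\<^sup>2) powr \<beta> * norm (T (f (s k)) a - T g a))" for k
        using wnorm_nearly_attained[of \<beta> "\<lambda>z. T (f (s k)) z - T g z"] diff[of k]
        unfolding wdist_def Hinf_def by blast
      then obtain a where a: "\<And>k. a k \<in> ball 0 1"
        and attained: "\<And>k. wdist \<beta> (T (f (s k))) (T g)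
          \<le> 2 * ((1 - (norm (a k))\<^sup>2) powr \<beta> * norm (T (f (s k)) (a k) - T g (a k)))"
        by metis
      define w where "w k = complex_of_real ((1 - (norm (a k))\<^sup>2) powr \<beta>)" for k
      have nw: "norm (w k) = (1 - (norm (a k))\<^sup>2) powr \<beta>" for k by (simp add: w_def)
      have lim: "(\<lambda>k. (w k * u (a k)) * F k (\<phi> (a k)) - (w k * v (a k)) * F k (\<psi> (a k))) \<longlonglongrightarrow> 0"
      proof (rule weighted_difference_tendsto_0[OF \<alpha> _ F F0 e])
        show "0 \<le> M + M" using M(1) by simp
        show "\<phi> (a k) \<in> ball 0 1" "\<psi> (a k) \<in> ball 0 1" for k
          using a[of k] \<phi> \<psi> by blast+
        show "norm (w k * u (a k)) \<le> max Ku Kv" "norm (w k * v (a k)) \<le> max Ku Kv" for k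
          using Ku[OF a[of k]] Kv[OF a[of k]] by (simp_all add: norm_mult nw)
        show "norm (w k * v (a k)) \<le> K' * (1 - (norm (\<psi> (a k)))\<^sup>2) powr \<alpha>" for k
          using K'[OF a[of k]] by (simp add: norm_mult nw)
        show "power_tests \<alpha> e (\<phi> (a k)) (\<psi> (a k)) (w k * u (a k)) (w k * v (a k))" for k
          unfolding power_tests_def
        proof (intro conjI allI impI)
          fix \<eta> :: "complex ^ 'n" and j assume \<eta>: "norm \<eta> = 1"
          have "w k * u (a k) * hinner (\<phi> (a k)) \<eta> ^ j - w k * v (a k) * hinner (\<psi> (a k)) \<eta> ^ j =
              w k * (u (a k) * hinner (\<phi> (a k)) \<eta> ^ j - v (a k) * hinner (\<psi> (a k)) \<eta> ^ j)"
            by (simp add: algebra_simps)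
          then show "norm (w k * u (a k) * hinner (\<phi> (a k)) \<eta> ^ j - w k * v (a k) * hinner (\<psi> (a k)) \<eta> ^ j)
              \<le> e j * real (Suc j) powr - \<alpha>"
            using H1[OF \<eta>, of j] a[of k] by (simp add: weighted_bound_def norm_mult nw)
        next
          fix \<eta> \<eta>' :: "complex ^ 'n" and j
          assume \<eta>: "norm \<eta> = 1" "norm \<eta>' = 1" "hinner \<eta> \<eta>' = 0"
          have "w k * u (a k) * hinner (\<phi> (a k)) \<eta> ^ j * hinner (\<phi> (a k)) \<eta>'
                - w k * v (a k) * hinner (\<psi> (a k)) \<eta> ^ j * hinner (\<psi> (a k)) \<eta>' =
              w k * (u (a k) * hinner (\<phi> (a k)) \<eta> ^ j * hinner (\<phi> (a k)) \<eta>'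
                - v (a k) * hinner (\<psi> (a k)) \<eta> ^ j * hinner (\<psi> (a k)) \<eta>')"
            by (simp add: algebra_simps)
          then show "norm (w k * u (a k) * hinner (\<phi> (a k)) \<eta> ^ j * hinner (\<phi> (a k)) \<eta>'
                - w k * v (a k) * hinner (\<psi> (a k)) \<eta> ^ j * hinner (\<psi> (a k)) \<eta>')
              \<le> e j * real (Suc j) powr - (\<alpha> + 1 / 2)"
            using H2[OF \<eta>, of j] a[of k] by (simp add: weighted_bound_def norm_mult nw)
        qed
      qed
      have "(w k * u (a k)) * F k (\<phi> (a k)) - (w k * v (a k)) * F k (\<psi> (a k)) =
          w k * (T (f (s k)) (a k) - T g (a k))" for k
        using a[of k] by (simp add: T_def wcomp_def F_def algebra_simps)
      with lim have "(\<lambda>k. w k * (T (f (s k)) (a k) - T g (a k))) \<longlonglongrightarrow> 0" by simp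
      then have "(\<lambda>k. 2 * norm (w k * (T (f (s k)) (a k) - T g (a k)))) \<longlonglongrightarrow> 0"
        by (intro tendsto_mult_right_zero tendsto_norm_zero)
      then have "(\<lambda>k. wdist \<beta> (T (f (s k))) (T g)) \<longlonglongrightarrow> 0"
        by (rule Lim_null_comparison[rotated])
          (use attained in \<open>auto simp: norm_mult nw intro!: always_eventually\<close>)
      then have "limitin B.mtopology (\<sigma> \<circ> s) (T g) sequentially"
        unfolding B.limitin_metric_dist_null using T gH fH by (simp add: f(2))
      then show ?thesis using T[OF gH] s by blast
    qed
    then show ?thesis
      unfolding B.compactin_closure_of_sequentially[OF TS] by blast
  qed
  moreover have "T ` Hinf \<alpha> \<subseteq> Hinf \<beta>" using T by blast
  ultimately show ?thesis
    unfolding compact_op_def T_def[abs_def] by blast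
qed

text \<open>If the norms of the images of the normalized functions do not tend to 0 uniformly in \<open>i\<close>, pick
functions whose images stay away from 0. A limit point of these images in norm is also their limit at
each point, so it is 0, a contradiction.\<close>

theorem compact_op_normalized_tendsto_0:
  fixes \<phi> \<psi> :: "complex ^ 'n \<Rightarrow> complex ^ 'n" and m :: "nat \<Rightarrow> 'i \<Rightarrow> complex ^ 'n \<Rightarrow> complex"
  assumes \<phi>: "\<phi> ` ball 0 1 \<subseteq> ball 0 1" and \<psi>: "\<psi> ` ball 0 1 \<subseteq> ball 0 1"
    and compact: "compact_op \<alpha> \<beta> (\<lambda>f z. wcomp u \<phi> f z - wcomp v \<psi> f z)"
    and m: "\<And>j i. i \<in> I \<Longrightarrow> holomorphic_sv (m j i) (ball 0 1)"
      "\<And>j i. i \<in> I \<Longrightarrow> 0 < wnorm \<alpha> (m j i)" "\<And>j i. i \<in> I \<Longrightarrow> wnorm \<alpha> (m j i) < \<infinity>"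
    and small: "\<And>z. z \<in> ball 0 1 \<Longrightarrow> \<exists>r. r \<longlonglongrightarrow> 0 \<and>
      (\<forall>j. \<forall>i\<in>I. norm (m j i z) \<le> r j * enn2real (wnorm \<alpha> (m j i)))"
  shows "limsup (\<lambda>j. SUP i\<in>I. wnorm \<beta> (\<lambda>z. u z * m j i (\<phi> z) - v z * m j i (\<psi> z)) / wnorm \<alpha> (m j i)) = 0"
proof (rule ccontr)
  define T where "T f z = wcomp u \<phi> f z - wcomp v \<psi> f z" for f z
  define R where "R j i = wnorm \<beta> (\<lambda>z. u z * m j i (\<phi> z) - v z * m j i (\<psi> z)) / wnorm \<alpha> (m j i)" for j i
  interpret A: Metric_space "Hinf \<alpha>" "wdist \<alpha>" by (rule Metric_space_Hinf)
  interpret B: Metric_space "Hinf \<beta>" "wdist \<beta>" by (rule Metric_space_Hinf)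
  assume "\<not> ?thesis"
  then have "0 < limsup (\<lambda>j. SUP i\<in>I. R j i)" by (simp add: R_def zero_less_iff_neq_zero)
  then obtain \<epsilon>' where "0 < \<epsilon>'" "\<epsilon>' < limsup (\<lambda>j. SUP i\<in>I. R j i)"
    using dense by blast
  then obtain \<epsilon> where \<epsilon>: "0 < \<epsilon>" "ennreal \<epsilon> < limsup (\<lambda>j. SUP i\<in>I. R j i)"
    by (cases \<epsilon>') auto
  have "\<exists>\<^sub>\<infinity>j. ennreal \<epsilon> < (SUP i\<in>I. R j i)"
  proof (rule ccontr)
    assume "\<not> ?thesis"
    then have "\<forall>\<^sub>F j in sequentially. (SUP i\<in>I. R j i) \<le> ennreal \<epsilon>"
      by (simp add: frequently_def cofinite_eq_sequentially not_less)
    from Limsup_bounded[OF this] \<epsilon>(2) show False by simp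
  qed
  then have "infinite {j. ennreal \<epsilon> < (SUP i\<in>I. R j i)}" by (simp add: INFM_iff_infinite)
  then obtain s :: "nat \<Rightarrow> nat" where s: "strict_mono s" "\<And>k. ennreal \<epsilon> < (SUP i\<in>I. R (s k) i)"
    using infinite_enumerate by blast
  then have "\<forall>k. \<exists>i\<in>I. ennreal \<epsilon> < R (s k) i" by (simp add: less_SUP_iff)
  then obtain i where i: "\<And>k. i k \<in> I" "\<And>k. ennreal \<epsilon> < R (s k) (i k)" by metis
  define N where "N k = enn2real (wnorm \<alpha> (m (s k) (i k)))" for k
  have N: "wnorm \<alpha> (m (s k) (i k)) = ennreal (N k)" "0 < N k" for k
    using m(2,3)[OF i(1)[of k], of "s k"]
    by (auto simp: N_def ennreal_enn2real_if enn2real_positive_iff)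
  define h where "h k z = of_real (1 / N k) * m (s k) (i k) z" for k z
  define f where "f k = extend_0 (h k)" for k
  have wh: "wnorm \<alpha> (h k) = 1" for k
    unfolding h_def[abs_def] wnorm_scale N using N(2)[of k]
    by (simp add: ennreal_mult[symmetric] norm_divide)
  have "holomorphic_sv (h k) (ball 0 1)" for k
    unfolding h_def[abs_def] by (intro holomorphic_sv_mult holomorphic_sv_const m i)
  then have fH: "f k \<in> Hinf \<alpha>" for k
    unfolding f_def by (intro extend_0_in_Hinf) (simp_all add: wh)
  have "A.mbounded (range f)"
    unfolding A.mbounded
  proof (intro disjI2 conjI exI ballI)
    show "(\<lambda>_. 0) \<in> Hinf \<alpha>" by (simp add: Hinf_def holomorphic_sv_const wnorm_def)
    fix x assume "x \<in> range f"
    then obtain k where x: "x = f k" by blast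
    show "x \<in> Hinf \<alpha>" using x fH by simp
    have "wnorm \<alpha> (\<lambda>z. 0 - x z) = wnorm \<alpha> (h k)"
      unfolding wnorm_def by (intro SUP_cong) (auto simp: x f_def extend_0_def)
    then show "wdist \<alpha> (\<lambda>_. 0) x \<le> 1" by (simp add: wdist_def wh)
  qed
  then have "compactin B.mtopology (B.mtopology closure_of (T ` range f))"
    using compact unfolding compact_op_def T_def[abs_def] by blast
  moreover have T: "T f \<in> Hinf \<beta>" if "f \<in> Hinf \<alpha>" for f
    using compact that unfolding compact_op_def T_def[abs_def] by blast
  then have TR: "T ` range f \<subseteq> Hinf \<beta>" using fH by blast
  ultimately obtain l r where l: "l \<in> Hinf \<beta>" and r: "strict_mono r"
    and lim: "limitin B.mtopology ((\<lambda>k. T (f k)) \<circ> r) l sequentially"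
    unfolding B.compactin_closure_of_sequentially[OF TR] by (auto dest!: spec[of _ "\<lambda>k. T (f k)"])
  have dist0: "(\<lambda>k. wdist \<beta> (T (f (r k))) l) \<longlonglongrightarrow> 0"
    using lim unfolding B.limitin_metric_dist_null by (simp add: o_def)
  have f0: "(\<lambda>k. f (r k) z) \<longlonglongrightarrow> 0" if z: "z \<in> ball 0 1" for z
  proof -
    obtain \<rho> where \<rho>: "\<rho> \<longlonglongrightarrow> 0" "\<And>j i. i \<in> I \<Longrightarrow> norm (m j i z) \<le> \<rho> j * enn2real (wnorm \<alpha> (m j i))"
      using small[OF z] by blast
    have "norm (f k z) \<le> \<rho> (s k)" for k
    proof -
      have "norm (m (s k) (i k) z) \<le> \<rho> (s k) * N k"
        using \<rho>(2)[OF i(1)] by (simp add: N_def)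
      then show ?thesis using z N(2)[of k] by (simp add: f_def extend_0_def h_def norm_mult norm_divide field_simps)
    qed
    moreover have "(\<lambda>k. \<rho> (s (r k))) \<longlonglongrightarrow> 0"
      using LIMSEQ_subseq_LIMSEQ[OF \<rho>(1) strict_mono_o[OF s(1) r]] by (simp add: o_def)
    ultimately show ?thesis
      by (intro Lim_null_comparison[of "\<lambda>k. f (r k) z" "\<lambda>k. \<rho> (s (r k))"]) (auto intro: always_eventually)
  qed
  have "l z = 0" for z
  proof (cases "z \<in> ball 0 1")
    case True
    have "(\<lambda>k. T (f (r k)) z) \<longlonglongrightarrow> u z * 0 - v z * 0"
      unfolding T_def wcomp_def using True \<phi> \<psi> by (simp only: if_True) (intro tendsto_intros f0; blast)
    then have 1: "(\<lambda>k. T (f (r k)) z) \<longlonglongrightarrow> 0" by simp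
    have c: "0 < (1 - (norm z)\<^sup>2) powr \<beta>" using one_minus_norm_square_pos[OF True] by simp
    have "norm (T (f (r k)) z - l z) \<le> wdist \<beta> (T (f (r k))) l / (1 - (norm z)\<^sup>2) powr \<beta>" for k
      using wdist_pointwise[OF T[OF fH] l True, of "r k"] c by (simp add: field_simps)
    moreover have "(\<lambda>k. wdist \<beta> (T (f (r k))) l / (1 - (norm z)\<^sup>2) powr \<beta>) \<longlonglongrightarrow> 0"
      using tendsto_divide[OF dist0 tendsto_const] c by fastforce
    ultimately have "(\<lambda>k. T (f (r k)) z - l z) \<longlonglongrightarrow> 0"
      by (intro Lim_null_comparison[of "\<lambda>k. T (f (r k)) z - l z"
            "\<lambda>k. wdist \<beta> (T (f (r k))) l / (1 - (norm z)\<^sup>2) powr \<beta>"]) (auto intro: always_eventually)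
    then have "(\<lambda>k. T (f (r k)) z) \<longlonglongrightarrow> l z" by (simp add: LIM_zero_iff)
    with 1 show ?thesis using LIMSEQ_unique by blast
  qed (use l in \<open>auto simp: Hinf_def\<close>)
  have "\<epsilon> \<le> wdist \<beta> (T (f k)) l" for k
  proof -
    define W where "W = wnorm \<beta> (\<lambda>z. u z * m (s k) (i k) (\<phi> z) - v z * m (s k) (i k) (\<psi> z))"
    have "wnorm \<beta> (\<lambda>z. T (f k) z - l z) =
        wnorm \<beta> (\<lambda>z. of_real (1 / N k) * (u z * m (s k) (i k) (\<phi> z) - v z * m (s k) (i k) (\<psi> z)))"
      using \<phi> \<psi> by (intro wnorm_cong)
        (auto simp: T_def wcomp_def f_def extend_0_def h_def \<open>\<And>z. l z = 0\<close> image_subset_iff algebra_simps)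
    also have "\<dots> = ennreal (1 / N k) * W"
      unfolding wnorm_scale W_def using N(2)[of k] by (simp add: norm_divide)
    also have "\<dots> = W / ennreal (N k)"
      using N(2)[of k] by (simp add: divide_ennreal_def inverse_ennreal mult.commute inverse_eq_divide)
    also have "\<dots> = R (s k) (i k)" by (simp add: R_def W_def N(1))
    finally have "ennreal \<epsilon> < wnorm \<beta> (\<lambda>z. T (f k) z - l z)" using i(2)[of k] by simp
    moreover have "wnorm \<beta> (\<lambda>z. T (f k) z - l z) < \<infinity>"
      using wnorm_diff_finite[OF T[OF fH] l] .
    ultimately show ?thesis
      using \<epsilon>(1) unfolding wdist_def by (metis enn2real_ennreal enn2real_mono infinity_ennreal_def less_imp_le)
  qed
  then have "\<epsilon> \<le> 0"
    using LIMSEQ_le_const[OF dist0, of \<epsilon>] by blast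
  with \<epsilon>(1) show False by simp
qed

lemma holomorphic_sv_power_pair: "holomorphic_sv (\<lambda>z. hinner z \<eta> ^ j * hinner z \<eta>') S"
  by (intro holomorphic_sv_mult holomorphic_sv_power holomorphic_sv_hinner)

lemma wnorm_power_pos:
  fixes \<eta> \<eta>' :: "complex ^ 'n"
  assumes "0 < \<alpha>" "norm \<eta> = 1" "norm \<eta>' = 1"
  shows "0 < wnorm \<alpha> (\<lambda>z. hinner z \<eta> ^ j)" "0 < wnorm \<alpha> (\<lambda>z. hinner z \<eta> ^ j * hinner z \<eta>')"
proof -
  have pos: "(0 :: ennreal) < ennreal ((1 / 4) powr \<alpha> * ((1 - 2 * (1 / 4)) ^ j * (1 / 4)))" by simp
  show "0 < wnorm \<alpha> (\<lambda>z. hinner z \<eta> ^ j)"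
    by (rule less_le_trans[OF pos wnorm_power_ge]) (use assms in auto)
  show "0 < wnorm \<alpha> (\<lambda>z. hinner z \<eta> ^ j * hinner z \<eta>')"
    by (rule less_le_trans[OF pos wnorm_power_pair_ge]) (use assms in auto)
qed

lemma wnorm_power_finite:
  fixes \<eta> \<eta>' :: "complex ^ 'n"
  assumes "0 < \<alpha>" "norm \<eta> = 1" "norm \<eta>' = 1"
  shows "wnorm \<alpha> (\<lambda>z. hinner z \<eta> ^ j) < \<infinity>" "wnorm \<alpha> (\<lambda>z. hinner z \<eta> ^ j * hinner z \<eta>') < \<infinity>"
proof -
  have *: "weighted_bound \<alpha> 1 (\<lambda>z. hinner z \<eta> ^ j * f z)"
    if f: "\<And>z. z \<in> ball 0 1 \<Longrightarrow> norm (f z) \<le> 1" for f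
    unfolding weighted_bound_def
  proof
    fix z :: "complex ^ 'n" assume z: "z \<in> ball 0 1"
    have h: "norm (hinner z \<eta>) \<le> 1"
      using norm_hinner_le[of z \<eta>] assms z by simp
    have "(1 - (norm z)\<^sup>2) powr \<alpha> \<le> 1 powr \<alpha>"
      using assms one_minus_norm_square_pos[OF z] by (intro powr_mono2) auto
    then have "(1 - (norm z)\<^sup>2) powr \<alpha> * norm (hinner z \<eta> ^ j * f z) \<le> 1 * (1 * 1)"
      unfolding norm_mult norm_power using h f[OF z] by (intro mult_mono power_le_one) auto
    then show "(1 - (norm z)\<^sup>2) powr \<alpha> * norm (hinner z \<eta> ^ j * f z) \<le> 1" by simp
  qed
  have fin: "wnorm \<alpha> f < \<infinity>" if "weighted_bound \<alpha> 1 f" for f :: "complex ^ 'n \<Rightarrow> complex"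
    using that wnorm_le_iff[of 1 \<alpha> f] by (auto intro: le_less_trans)
  show "wnorm \<alpha> (\<lambda>z. hinner z \<eta> ^ j) < \<infinity>"
    using fin[OF *[of "\<lambda>_. 1"]] by simp
  show "wnorm \<alpha> (\<lambda>z. hinner z \<eta> ^ j * hinner z \<eta>') < \<infinity>"
    by (intro fin * order_trans[OF norm_hinner_le]) (auto simp: assms)
qed

text \<open>At a point \<open>z\<close> the powers are at most \<open>|z|^j\<close>, while their norms are at least a constant times
\<open>(1 - 2 b)^j\<close> with \<open>1 - 2 b > |z|\<close>.\<close>

lemma normalized_powers_small:
  fixes z :: "complex ^ 'n"
  assumes \<alpha>: "0 < \<alpha>" and z: "z \<in> ball 0 1"
  shows "\<exists>r. r \<longlonglongrightarrow> 0 \<and>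
    (\<forall>j. \<forall>\<eta>\<in>sphere 0 1. norm (hinner z \<eta> ^ j) \<le> r j * enn2real (wnorm \<alpha> (\<lambda>z. hinner z \<eta> ^ j)))" (is ?power)
  "\<exists>r. r \<longlonglongrightarrow> 0 \<and>
    (\<forall>j. \<forall>i\<in>sphere 0 1 \<times> sphere 0 1. norm (hinner z (fst i) ^ j * hinner z (snd i))
      \<le> r j * enn2real (wnorm \<alpha> (\<lambda>z. hinner z (fst i) ^ j * hinner z (snd i))))" (is ?pair)
proof -
  define b where "b = (1 - norm z) / 4"
  have nz: "0 \<le> norm z" "norm z < 1" using z by auto
  have b: "0 < b" "b < 1 / 2" "norm z < 1 - 2 * b"
    unfolding b_def using nz by argo+
  define r where "r j = (norm z / (1 - 2 * b)) ^ j / (b powr \<alpha> * b)" for j :: nat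
  have b': "0 < 1 - 2 * b" using b by linarith
  have "norm z / (1 - 2 * b) < 1" using b(3) unfolding divide_less_eq_1_pos[OF b'] .
  moreover have "0 \<le> norm z / (1 - 2 * b)" by (rule divide_nonneg_pos[OF nz(1) b'])
  ultimately have "(\<lambda>j. (norm z / (1 - 2 * b)) ^ j) \<longlonglongrightarrow> 0"
    by (intro LIMSEQ_realpow_zero)
  from tendsto_divide[OF this tendsto_const[of "b powr \<alpha> * b"]] have r: "r \<longlonglongrightarrow> 0"
    unfolding r_def[abs_def] using b by simp
  have r0: "0 \<le> r j" for j
    unfolding r_def using b b' nz by (intro divide_nonneg_nonneg zero_le_power) (linarith | simp)+
  have key: "norm z ^ j \<le> r j * enn2real w"
    if "ennreal (b powr \<alpha> * ((1 - 2 * b) ^ j * b)) \<le> w" "w < \<infinity>" for w j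
  proof -
    have "norm z ^ j = r j * (b powr \<alpha> * ((1 - 2 * b) ^ j * b))"
      using b by (simp add: r_def power_divide)
    also have "b powr \<alpha> * ((1 - 2 * b) ^ j * b) \<le> enn2real w"
      using enn2real_mono[OF that(1)] that(2) b by simp
    finally show ?thesis using r0[of j] by (simp add: mult_left_mono)
  qed
  have h: "norm (hinner z \<eta>) \<le> norm z" if "norm \<eta> = 1" for \<eta>
    using norm_hinner_le[of z \<eta>] that by simp
  have "norm (hinner z \<eta> ^ j) \<le> r j * enn2real (wnorm \<alpha> (\<lambda>z. hinner z \<eta> ^ j))"
    if \<eta>: "norm \<eta> = 1" for \<eta> j
  proof -
    have "norm (hinner z \<eta> ^ j) \<le> norm z ^ j"
      unfolding norm_power using h[OF \<eta>] by (intro power_mono) auto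
    also have "\<dots> \<le> r j * enn2real (wnorm \<alpha> (\<lambda>z. hinner z \<eta> ^ j))"
      by (intro key wnorm_power_ge wnorm_power_finite[where \<eta>' = \<eta>] \<alpha> \<eta> b)
    finally show ?thesis .
  qed
  with r show ?power by auto
  have "norm (hinner z \<eta> ^ j * hinner z \<eta>') \<le> r j * enn2real (wnorm \<alpha> (\<lambda>z. hinner z \<eta> ^ j * hinner z \<eta>'))"
    if \<eta>: "norm \<eta> = 1" "norm \<eta>' = 1" for \<eta> \<eta>' j
  proof -
    have "norm (hinner z \<eta> ^ j * hinner z \<eta>') \<le> norm z ^ j * 1"
      unfolding norm_power norm_mult using h[OF \<eta>(1)] h[OF \<eta>(2)] nz by (intro mult_mono power_mono) auto
    also have "norm z ^ j * 1 \<le> r j * enn2real (wnorm \<alpha> (\<lambda>z. hinner z \<eta> ^ j * hinner z \<eta>'))"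
      unfolding mult_1_right by (intro key wnorm_power_pair_ge wnorm_power_finite \<alpha> \<eta> b)
    finally show ?thesis .
  qed
  with r show ?pair by auto
qed

lemma weighted_bound_of_ratio:
  assumes "wnorm \<beta> g / wnorm \<alpha> m \<le> ennreal r" "0 < wnorm \<alpha> m" "weighted_bound \<alpha> c m" "0 \<le> r" "0 \<le> c"
  shows "weighted_bound \<beta> (r * c) g"
proof -
  have c: "wnorm \<alpha> m \<le> ennreal c" using assms by (simp add: wnorm_le_iff)
  then have "wnorm \<alpha> m < top" by (rule le_less_trans) simp
  then have "wnorm \<beta> g = wnorm \<beta> g / wnorm \<alpha> m * wnorm \<alpha> m"
    using assms(2) by (simp add: ennreal_divide_times)
  also have "\<dots> \<le> ennreal r * ennreal c" by (intro mult_mono assms c) auto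
  also have "\<dots> = ennreal (r * c)" using assms by (simp add: ennreal_mult)
  finally show ?thesis using assms by (simp add: wnorm_le_iff)
qed

section \<open>Compactness in terms of powers of linear forms\<close>

theorem corollary3p3:
  fixes \<alpha> \<beta> :: real
    and u v :: "complex ^ 'n \<Rightarrow> complex"
    and \<phi> \<psi> :: "complex ^ 'n \<Rightarrow> complex ^ 'n"
    and \<xi> \<zeta> :: "complex ^ 'n \<Rightarrow> complex ^ 'n"
  assumes "0 < \<alpha>" and "0 < \<beta>"
    and "holomorphic_sv u (ball 0 1)" and "holomorphic_sv v (ball 0 1)"
    and "holomorphic_self_map \<phi>" and "holomorphic_self_map \<psi>"
    and "\<And>a. \<xi> a = ball_aut (\<phi> a) (\<psi> a) /\<^sub>R norm (ball_aut (\<phi> a) (\<psi> a))"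
    and "\<And>a. \<zeta> a = ball_aut (\<psi> a) (\<phi> a) /\<^sub>R norm (ball_aut (\<psi> a) (\<phi> a))"
    and "\<exists>C>0.
      (INF a\<in>{a \<in> ball 0 1. \<phi> a \<noteq> \<psi> a}.
        ereal ((1 - (norm (\<phi> a))\<^sup>2) / norm (1 - hinner (\<phi> a) (\<xi> a)))) > ereal C \<and>
      (INF a\<in>{a \<in> ball 0 1. \<phi> a \<noteq> \<psi> a}.
        ereal ((1 - (norm (\<psi> a))\<^sup>2) / norm (1 - hinner (\<psi> a) (\<zeta> a)))) > ereal C"
    and "bounded_op \<alpha> \<beta> (wcomp u \<phi>)" and "bounded_op \<alpha> \<beta> (wcomp v \<psi>)"
  shows "compact_op \<alpha> \<beta> (\<lambda>f z. wcomp u \<phi> f z - wcomp v \<psi> f z) \<longleftrightarrow>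
    limsup (\<lambda>j::nat. SUP \<eta>\<in>sphere 0 1.
      wnorm \<beta> (\<lambda>z. u z * hinner (\<phi> z) \<eta> ^ j - v z * hinner (\<psi> z) \<eta> ^ j)
      / wnorm \<alpha> (\<lambda>z. hinner z \<eta> ^ j)) = 0 \<and>
    limsup (\<lambda>j::nat. SUP (\<eta>, \<eta>')\<in>sphere 0 1 \<times> sphere 0 1.
      wnorm \<beta> (\<lambda>z. u z * hinner (\<phi> z) \<eta> ^ j * hinner (\<phi> z) \<eta>'
                  - v z * hinner (\<psi> z) \<eta> ^ j * hinner (\<psi> z) \<eta>')
      / wnorm \<alpha> (\<lambda>z. hinner z \<eta> ^ j * hinner z \<eta>')) = 0"
    (is "?compact \<longleftrightarrow> limsup ?F = 0 \<and> limsup ?G = 0")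
proof -
  have \<alpha>: "0 < \<alpha>" by (rule assms(1))
  have \<phi>: "\<phi> ` ball 0 1 \<subseteq> ball 0 1" and \<psi>: "\<psi> ` ball 0 1 \<subseteq> ball 0 1"
    using assms(5,6) by (auto simp: holomorphic_self_map_def)
  note bdd = assms(10,11)
  have pow: "holomorphic_sv (\<lambda>z. hinner z \<eta> ^ j) (ball 0 1)" "0 < wnorm \<alpha> (\<lambda>z. hinner z \<eta> ^ j)"
    "wnorm \<alpha> (\<lambda>z. hinner z \<eta> ^ j) < \<infinity>"
    if "\<eta> \<in> sphere 0 1" for \<eta> :: "complex ^ 'n" and j
    using that wnorm_power_pos(1)[OF \<alpha>, of \<eta> \<eta>] wnorm_power_finite(1)[OF \<alpha>, of \<eta> \<eta>]
    by (simp_all add: holomorphic_sv_power holomorphic_sv_hinner)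
  have pair: "holomorphic_sv (\<lambda>z. hinner z (fst i) ^ j * hinner z (snd i)) (ball 0 1)"
    "0 < wnorm \<alpha> (\<lambda>z. hinner z (fst i) ^ j * hinner z (snd i))"
    "wnorm \<alpha> (\<lambda>z. hinner z (fst i) ^ j * hinner z (snd i)) < \<infinity>"
    if "i \<in> sphere 0 1 \<times> sphere 0 1" for i :: "(complex ^ 'n) \<times> (complex ^ 'n)" and j
    using that wnorm_power_pos(2)[OF \<alpha>, of "fst i" "snd i"] wnorm_power_finite(2)[OF \<alpha>, of "fst i" "snd i"]
    by (auto simp: holomorphic_sv_power_pair)
  show ?thesis
  proof
    assume compact: ?compact
    have "limsup ?F = 0"
    proof (rule compact_op_normalized_tendsto_0[OF \<phi> \<psi> compact, where m = "\<lambda>j \<eta> z. hinner z \<eta> ^ j"])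
    qed (rule pow normalized_powers_small(1)[OF \<alpha>]; assumption)+
    moreover have "limsup (\<lambda>j. SUP i\<in>sphere 0 1 \<times> sphere 0 1.
        wnorm \<beta> (\<lambda>z. u z * (hinner (\<phi> z) (fst i) ^ j * hinner (\<phi> z) (snd i))
          - v z * (hinner (\<psi> z) (fst i) ^ j * hinner (\<psi> z) (snd i)))
        / wnorm \<alpha> (\<lambda>z. hinner z (fst i) ^ j * hinner z (snd i))) = 0"
    proof (rule compact_op_normalized_tendsto_0[OF \<phi> \<psi> compact,
          where m = "\<lambda>j i z. hinner z (fst i) ^ j * hinner z (snd i)"])
    qed (rule pair normalized_powers_small(2)[OF \<alpha>]; assumption)+
    then have "limsup ?G = 0" by (simp add: case_prod_beta mult.assoc)
    ultimately show "limsup ?F = 0 \<and> limsup ?G = 0" by blast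
  next
    assume lim: "limsup ?F = 0 \<and> limsup ?G = 0"
    obtain Ku where Ku: "0 \<le> Ku" "\<And>f. holomorphic_sv f (ball 0 1) \<Longrightarrow> wnorm \<alpha> f < \<infinity> \<Longrightarrow>
        wnorm \<beta> (\<lambda>z. u z * f (\<phi> z)) \<le> ennreal Ku * wnorm \<alpha> f"
      using bounded_op_wcomp_bound[OF bdd(1) \<phi>] by blast
    obtain Kv where Kv: "0 \<le> Kv" "\<And>f. holomorphic_sv f (ball 0 1) \<Longrightarrow> wnorm \<alpha> f < \<infinity> \<Longrightarrow>
        wnorm \<beta> (\<lambda>z. v z * f (\<psi> z)) \<le> ennreal Kv * wnorm \<alpha> f"
      using bounded_op_wcomp_bound[OF bdd(2) \<psi>] by blast
    have ratio: "wnorm \<beta> (\<lambda>z. u z * f (\<phi> z) - v z * f (\<psi> z)) / wnorm \<alpha> f \<le> ennreal (Ku + Kv)"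
      if f: "holomorphic_sv f (ball 0 1)" "wnorm \<alpha> f < \<infinity>" "0 < wnorm \<alpha> f" for f
    proof (rule divide_le_posI_ennreal[OF f(3)])
      have "wnorm \<beta> (\<lambda>z. u z * f (\<phi> z) - v z * f (\<psi> z))
          \<le> wnorm \<beta> (\<lambda>z. u z * f (\<phi> z)) + wnorm \<beta> (\<lambda>z. v z * f (\<psi> z))"
        using wnorm_triangle[of \<beta> "\<lambda>z. u z * f (\<phi> z)" "\<lambda>z. - (v z * f (\<psi> z))"]
        by (simp add: wnorm_def)
      also have "\<dots> \<le> ennreal Ku * wnorm \<alpha> f + ennreal Kv * wnorm \<alpha> f"
        by (intro add_mono Ku Kv f)
      also have "\<dots> = wnorm \<alpha> f * ennreal (Ku + Kv)"
        using Ku Kv by (simp add: ennreal_plus distrib_left mult.commute)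
      finally show "wnorm \<beta> (\<lambda>z. u z * f (\<phi> z) - v z * f (\<psi> z)) \<le> wnorm \<alpha> f * ennreal (Ku + Kv)" .
    qed
    have F_le: "?F j \<le> ennreal (Ku + Kv)" for j
      by (intro SUP_least ratio pow)
    have G_le: "?G j \<le> ennreal (Ku + Kv)" for j
    proof (rule SUP_least, clarify)
      fix \<eta> \<eta>' :: "complex ^ 'n" assume "\<eta> \<in> sphere 0 1" "\<eta>' \<in> sphere 0 1"
      then show "wnorm \<beta> (\<lambda>z. u z * hinner (\<phi> z) \<eta> ^ j * hinner (\<phi> z) \<eta>'
                  - v z * hinner (\<psi> z) \<eta> ^ j * hinner (\<psi> z) \<eta>')
          / wnorm \<alpha> (\<lambda>z. hinner z \<eta> ^ j * hinner z \<eta>') \<le> ennreal (Ku + Kv)"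
        using ratio[of "\<lambda>z. hinner z \<eta> ^ j * hinner z \<eta>'"]
          pair[of "(\<eta>, \<eta>')" j]
        by (simp add: mult.assoc)
    qed
    define r where "r j = enn2real (max (?F j) (?G j))" for j
    have r: "max (?F j) (?G j) = ennreal (r j)" for j
    proof -
      have "max (?F j) (?G j) < top"
        by (rule le_less_trans[of _ "ennreal (Ku + Kv)"]) (use F_le[of j] G_le[of j] in auto)
      then show ?thesis unfolding r_def by simp
    qed
    have r0: "0 \<le> r j" for j by (simp add: r_def)
    have r_lim: "r \<longlonglongrightarrow> 0"
    proof -
      have "?F \<longlonglongrightarrow> 0" "?G \<longlonglongrightarrow> 0"
        using lim by (auto intro: tendsto_0_if_Limsup_eq_0_ennreal)
      from tendsto_max[OF this] show ?thesis
        unfolding r_def[abs_def] by (intro tendsto_enn2real) auto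
    qed
    obtain C where C: "0 \<le> C"
      "\<And>(\<eta> :: complex ^ 'n) j. norm \<eta> = 1 \<Longrightarrow>
        weighted_bound \<alpha> (C * real (Suc j) powr - \<alpha>) (\<lambda>z. hinner z \<eta> ^ j)"
      "\<And>(\<eta> :: complex ^ 'n) \<eta>' j. norm \<eta> = 1 \<Longrightarrow> norm \<eta>' = 1 \<Longrightarrow> hinner \<eta> \<eta>' = 0 \<Longrightarrow>
        weighted_bound \<alpha> (C * real (Suc j) powr - (\<alpha> + 1 / 2)) (\<lambda>z. hinner z \<eta> ^ j * hinner z \<eta>')"
      using weighted_bound_power[OF \<alpha>, where ?'n = 'n] by blast
    show ?compact
    proof (rule compact_op_if_power_tests[OF \<alpha> \<phi> \<psi> bdd, where e = "\<lambda>j. r j * C"])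
      show "0 \<le> r j * C" for j using r0 C(1) by simp
      show "(\<lambda>j. r j * C) \<longlonglongrightarrow> 0" by (rule tendsto_mult_left_zero[OF r_lim])
    next
      fix \<eta> :: "complex ^ 'n" and j assume \<eta>: "norm \<eta> = 1"
      let ?g = "\<lambda>z. u z * hinner (\<phi> z) \<eta> ^ j - v z * hinner (\<psi> z) \<eta> ^ j"
      have "wnorm \<beta> ?g / wnorm \<alpha> (\<lambda>z. hinner z \<eta> ^ j) \<le> ?F j"
        using \<eta> by (intro SUP_upper2[of \<eta>]) auto
      also have "\<dots> \<le> ennreal (r j)" unfolding r[symmetric] by simp
      finally have "weighted_bound \<beta> (r j * (C * real (Suc j) powr - \<alpha>)) ?g"
        by (rule weighted_bound_of_ratio[OF _ wnorm_power_pos(1)[OF \<alpha> \<eta> \<eta>] C(2)[OF \<eta>] r0])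
          (use C in simp)
      then show "weighted_bound \<beta> (r j * C * real (Suc j) powr - \<alpha>) ?g" by (simp only: mult.assoc)
    next
      fix \<eta> \<eta>' :: "complex ^ 'n" and j assume \<eta>: "norm \<eta> = 1" "norm \<eta>' = 1" "hinner \<eta> \<eta>' = 0"
      let ?g = "\<lambda>z. u z * hinner (\<phi> z) \<eta> ^ j * hinner (\<phi> z) \<eta>' - v z * hinner (\<psi> z) \<eta> ^ j * hinner (\<psi> z) \<eta>'"
      have "wnorm \<beta> ?g / wnorm \<alpha> (\<lambda>z. hinner z \<eta> ^ j * hinner z \<eta>') \<le> ?G j"
        using \<eta> by (intro SUP_upper2[of "(\<eta>, \<eta>')"]) auto
      also have "\<dots> \<le> ennreal (r j)" unfolding r[symmetric] by simp
      finally have "weighted_bound \<beta> (r j * (C * real (Suc j) powr - (\<alpha> + 1 / 2))) ?g"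
        by (rule weighted_bound_of_ratio[OF _ wnorm_power_pos(2)[OF \<alpha> \<eta>(1,2)] C(3)[OF \<eta>] r0])
          (use C in simp)
      then show "weighted_bound \<beta> (r j * C * real (Suc j) powr - (\<alpha> + 1 / 2)) ?g" by (simp only: mult.assoc)
    qed
  qed
qed

end
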